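(* Let CAT be one of TOP, PL, or DIFF. Let $M$ be a (possibly disconnected) CAT $n$-manifold, let $r,r'$ be disjoint rays in $M$ with tubular neighborhood maps $\nu,\nu'$ having disjoint images, and let $N$ be the quotient space obtained by attaching a 1-handle at infinity $E=\mathbb{R}\times\mathbb{R}^{n-1}$ to $M$ using $\nu$ and $\nu'$. Then the quotient space $N$ is naturally an $n$-dimensional CAT manifold. If $M$ is oriented and the 1-handle is oriented, then $N$ is naturally an oriented manifold. The maps $i_M:M\to N$ and $i_E:E\to N$ are open embeddings, and if the 1-handle is oriented, then $i_M$ and $i_E$ are orientation-preserving.
   Context: CAT manifolds are Hausdorff and paracompact, possibly with boundary. Embeddings and homeomorphisms are CAT. A ray in $M$ is a proper, locally flat embedding $r:[0,\infty)\to M$ with image in the manifold interior of $M$. A tubular neighborhood map of $r$ is a proper, locally flat embedding $\nu:[0,\infty)\times D^{n-1}\to M$ with image in the manifold interior of $M$ and $\nu(x,0)=r(x)$, where $D^{n-1}$ is the closed disk. Let $U$ and $U'$ be the images under $\nu$ and $\nu'$ of the manifold interior $(0,\infty)\times(D^{n-1})^\circ$; these are open in $M$. Let $E=\mathbb{R}\times\mathbb{R}^{n-1}$, $E_-=(-\infty,0)\times\mathbb{R}^{n-1}$, $E_0=\{0\}\times\mathbb{R}^{n-1}$, $E_+=(0,\infty)\times\mathbb{R}^{n-1}$. Fix an orientation-reversing isomorphism $\rho:(0,\infty)\to(0,\infty)$ and a radial expansion isomorphism $\lambda:(D^{n-1})^\circ\to\mathbb{R}^{n-1}$. Define isomorphisms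 $\phi_+:E_+\to U$, $\phi_+(t,y)=\nu(\rho(t),\lambda^{-1}(y))$, and $\phi_-:E_-\to U'$, $\phi_-(t,y)=\nu'(\rho(-t),\lambda^{-1}(y))$. Then $N$ is the quotient space of $M\sqcup E$ by the equivalence relation generated by $x\sim\phi_+(x)$ for $x\in E_+$ and $x\sim\phi_-(x)$ for $x\in E_-$, with quotient map $q:M\sqcup E\to N$. The maps $i_M$ and $i_E$ are the composites of $q$ with the inclusions $M\hookrightarrow M\sqcup E$ and $E\hookrightarrow M\sqcup E$. "Naturally" means with the structure whose charts are those of $M$ and $E$ transported to $N$ by $i_M$ and $i_E$. When $M$ is oriented (and $E=\mathbb{R}^n$ has its standard orientation), the 1-handle is oriented if $\phi_+$ and $\phi_-$ are both orientation-preserving. *)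

theory Defs
  imports "HOL-Analysis.Analysis" "HOL-Homology.Homology"
begin

section \<open>Maps of the categories TOP, PL and DIFF between subsets of Euclidean spaces\<close>

datatype cat = TOP | PL | DIFF

fun differentiable_order_on ::
    "'a::real_normed_vector set \<Rightarrow> ('a \<Rightarrow> 'b::real_normed_vector) \<Rightarrow> nat \<Rightarrow> bool" where
  "differentiable_order_on S f 0 \<longleftrightarrow> continuous_on S f"
| "differentiable_order_on S f (Suc m) \<longleftrightarrow>
     (\<forall>x\<in>S. f differentiable (at x)) \<and>
     (\<forall>v. differentiable_order_on S (\<lambda>x. frechet_derivative f (at x) v) m)"

text \<open>Only meant for open \<open>S\<close>, where it says that \<open>f\<close> is \<open>C\<^sup>\<infinity>\<close> on \<open>S\<close>.\<close>

definition smooth_on_open ::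
    "'a::real_normed_vector set \<Rightarrow> ('a \<Rightarrow> 'b::real_normed_vector) \<Rightarrow> bool" where
  "smooth_on_open S f \<longleftrightarrow> (\<forall>m. differentiable_order_on S f m)"

text \<open>
  \<open>S\<close> is an arbitrary subset. A PL map is affine on each of finitely many polytopes in \<open>S\<close> that
  together form a neighbourhood in \<open>S\<close> of a given point (continuity follows, as the polytopes are
  closed). A smooth map is one that extends locally to a smooth map of the ambient space; this is
  the usual meaning at the boundary points of a half-space and on a linear subspace.
\<close>

definition pl_map :: "'a::euclidean_space set \<Rightarrow> ('a \<Rightarrow> 'b::euclidean_space) \<Rightarrow> bool" where
  "pl_map S f \<longleftrightarrow>
     (\<forall>x\<in>S. \<exists>\<P> T. finite \<P> \<and> (\<forall>P\<in>\<P>. polytope P) \<and> open T \<and> x \<in> T \<and>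
        S \<inter> T \<subseteq> \<Union>\<P> \<and> \<Union>\<P> \<subseteq> S \<and>
        (\<forall>P\<in>\<P>. \<exists>L b. linear L \<and> (\<forall>y\<in>P. f y = L y + b)))"

definition smooth_map :: "'a::euclidean_space set \<Rightarrow> ('a \<Rightarrow> 'b::euclidean_space) \<Rightarrow> bool" where
  "smooth_map S f \<longleftrightarrow>
     (\<forall>x\<in>S. \<exists>T F. open T \<and> x \<in> T \<and> smooth_on_open T F \<and> (\<forall>y\<in>S \<inter> T. F y = f y))"

fun cat_map :: "cat \<Rightarrow> 'a::euclidean_space set \<Rightarrow> ('a \<Rightarrow> 'b::euclidean_space) \<Rightarrow> bool" where
  "cat_map TOP S f \<longleftrightarrow> continuous_on S f"
| "cat_map PL S f \<longleftrightarrow> pl_map S f"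
| "cat_map DIFF S f \<longleftrightarrow> smooth_map S f"

definition cat_iso ::
    "cat \<Rightarrow> 'a::euclidean_space set \<Rightarrow> 'b::euclidean_space set \<Rightarrow> ('a \<Rightarrow> 'b) \<Rightarrow> bool" where
  "cat_iso C S T f \<longleftrightarrow> (\<exists>g. homeomorphism S T f g \<and> cat_map C S f \<and> cat_map C T g)"


section \<open>CAT manifolds\<close>

text \<open>
  A chart is a pair of a domain and a coordinate function, whose values outside the domain are
  irrelevant. The dimension is \<open>CARD('n)\<close>; since index types are nonempty, it is at least 1.
  The atlas of a manifold need not be maximal.
\<close>

type_synonym ('p, 'n) chart = "'p set \<times> ('p \<Rightarrow> real ^ 'n)"

record ('p, 'n) mfd =
  mspace :: "'p topology"
  matlas :: "('p set \<times> ('p \<Rightarrow> real ^ 'n)) set"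

definition is_chart :: "'p topology \<Rightarrow> ('p, 'n::finite) chart \<Rightarrow> bool" where
  "is_chart X = (\<lambda>(U, c). openin X U \<and>
     homeomorphic_map (subtopology X U) (top_of_set (c ` U)) c \<and>
     (open (c ` U) \<or> (\<exists>j. openin (top_of_set {x. 0 \<le> x $ j}) (c ` U))))"

definition compatible_charts ::
    "cat \<Rightarrow> ('p, 'n::finite) chart \<Rightarrow> ('p, 'n) chart \<Rightarrow> bool" where
  "compatible_charts C = (\<lambda>(U, c) (V, d).
     cat_iso C (c ` (U \<inter> V)) (d ` (U \<inter> V)) (d \<circ> inv_into U c))"

definition paracompact_space :: "'p topology \<Rightarrow> bool" where
  "paracompact_space X \<longleftrightarrow>
     (\<forall>\<U>. (\<forall>U\<in>\<U>. openin X U) \<and> \<Union>\<U> = topspace X \<longrightarrow>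
        (\<exists>\<V>. (\<forall>V\<in>\<V>. openin X V \<and> (\<exists>U\<in>\<U>. V \<subseteq> U)) \<and> \<Union>\<V> = topspace X \<and>
             locally_finite_in X \<V>))"

definition cat_manifold :: "cat \<Rightarrow> ('p, 'n::finite) mfd \<Rightarrow> bool" where
  "cat_manifold C M \<longleftrightarrow>
     Hausdorff_space (mspace M) \<and> paracompact_space (mspace M) \<and>
     (\<forall>\<kappa>\<in>matlas M. is_chart (mspace M) \<kappa>) \<and>
     (\<Union>\<kappa>\<in>matlas M. fst \<kappa>) = topspace (mspace M) \<and>
     (\<forall>\<kappa>\<in>matlas M. \<forall>\<kappa>'\<in>matlas M. compatible_charts C \<kappa> \<kappa>')"

definition mfd_interior :: "('p, 'n::finite) mfd \<Rightarrow> 'p set" where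
  "mfd_interior M = {x. \<exists>(U, c)\<in>matlas M. x \<in> U \<and> c x \<in> interior (c ` U)}"

definition restrict_atlas :: "'p set \<Rightarrow> ('p, 'n::finite) chart set \<Rightarrow> ('p, 'n) chart set" where
  "restrict_atlas G \<A> = (\<lambda>(U, c). (U \<inter> G, c)) ` \<A>"

definition open_submfd :: "('p, 'n::finite) mfd \<Rightarrow> 'p set \<Rightarrow> ('p, 'n) mfd" where
  "open_submfd M G =
     \<lparr> mspace = subtopology (mspace M) G, matlas = restrict_atlas G (matlas M) \<rparr>"

definition cat_open_embedding ::
    "cat \<Rightarrow> ('p, 'n::finite) mfd \<Rightarrow> ('q, 'n) mfd \<Rightarrow> ('p \<Rightarrow> 'q) \<Rightarrow> bool" where
  "cat_open_embedding C M N f \<longleftrightarrow>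
     embedding_map (mspace M) (mspace N) f \<and> open_map (mspace M) (mspace N) f \<and>
     (\<forall>(U, c)\<in>matlas M. \<forall>(V, d)\<in>matlas N.
        cat_iso C (c ` (U \<inter> f -` V)) (d ` (f ` U \<inter> V)) (d \<circ> f \<circ> inv_into U c))"


section \<open>Orientations\<close>

text \<open>
  For an open embedding \<open>f\<close> of an open subset \<open>U\<close> of \<open>\<real>\<^sup>n\<close>: at each point \<open>x\<close> of \<open>U\<close>, the map
  \<open>f\<close> induces the same map on local homology, \<open>H\<^sub>n(U, U - x) \<rightarrow> H\<^sub>n(\<real>\<^sup>n, \<real>\<^sup>n - f x)\<close>, as the
  translation taking \<open>x\<close> to \<open>f x\<close> (that is, \<open>f\<close> has local degree 1). For convenience both are
  composed with the translation taking \<open>f x\<close> to 0.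
\<close>

definition orientation_preserving_on :: "(real ^ 'n::finite) set \<Rightarrow> (real ^ 'n \<Rightarrow> real ^ 'n) \<Rightarrow> bool" where
  "orientation_preserving_on U f \<longleftrightarrow>
     (\<forall>x\<in>U. \<forall>a\<in>carrier (relative_homology_group (int CARD('n)) (top_of_set U) (U - {x})).
        hom_induced (int CARD('n)) (top_of_set U) (U - {x}) euclidean (- {0}) (\<lambda>y. f y - f x) a =
        hom_induced (int CARD('n)) (top_of_set U) (U - {x}) euclidean (- {0}) (\<lambda>y. y - x) a)"

text \<open>
  An orientation of \<open>M\<close> is an orientation of its interior, given by an oriented atlas whose members
  belong to the CAT structure of \<open>M\<close>. Working in the interior also covers 1-manifolds with
  boundary, where charts onto \<open>[0,\<infinity>)\<close> alone would not suffice.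
\<close>

definition is_orientation ::
    "cat \<Rightarrow> ('p, 'n::finite) mfd \<Rightarrow> ('p, 'n) chart set \<Rightarrow> bool" where
  "is_orientation C M \<O> \<longleftrightarrow>
     (\<forall>\<kappa>\<in>\<O>. is_chart (mspace M) \<kappa> \<and> open (snd \<kappa> ` fst \<kappa>) \<and>
        (\<forall>\<kappa>'\<in>matlas M. compatible_charts C \<kappa> \<kappa>')) \<and>
     (\<Union>\<kappa>\<in>\<O>. fst \<kappa>) = mfd_interior M \<and>
     (\<forall>(U, c)\<in>\<O>. \<forall>(V, d)\<in>\<O>. orientation_preserving_on (c ` (U \<inter> V)) (d \<circ> inv_into U c))"

definition orientation_preserving_map ::
    "('p, 'n::finite) chart set \<Rightarrow> ('q, 'n) chart set \<Rightarrow> ('p \<Rightarrow> 'q) \<Rightarrow> bool" where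
  "orientation_preserving_map \<O> \<O>' f \<longleftrightarrow>
     (\<forall>(U, c)\<in>\<O>. \<forall>(V, d)\<in>\<O>'.
        orientation_preserving_on (c ` (U \<inter> f -` V)) (d \<circ> f \<circ> inv_into U c))"


section \<open>The 1-handle at infinity and its ends\<close>

text \<open>
  To include \<open>n = 1\<close>, the space \<open>\<real>\<^bsup>n-1\<^esup>\<close> is realized as the coordinate hyperplane \<open>y $ k = 0\<close> of
  \<open>\<real>\<^sup>n\<close>, for some coordinate \<open>k\<close>. The identification of \<open>E = \<real> \<times> \<real>\<^bsup>n-1\<^esup>\<close> with \<open>\<real>\<^sup>n\<close> puts the
  factor \<open>\<real>\<close> in coordinate \<open>k\<close>; it is the single chart of \<open>E\<close> and also represents the standard
  orientation.
\<close>

type_synonym 'n handle_pt = "real \<times> (real ^ 'n)"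

definition hyp :: "'n::finite \<Rightarrow> (real ^ 'n) set" where
  "hyp k = {y. y $ k = 0}"

definition handle_carrier :: "'n::finite \<Rightarrow> ('n handle_pt) set" where
  "handle_carrier k = UNIV \<times> hyp k"

definition handle_mfd :: "'n::finite \<Rightarrow> ('n handle_pt, 'n) mfd" where
  "handle_mfd k =
     \<lparr> mspace = top_of_set (handle_carrier k),
       matlas = {(handle_carrier k, \<lambda>(t, y). axis k t + y)} \<rparr>"

definition handle_neg :: "'n::finite \<Rightarrow> ('n handle_pt) set" where
  "handle_neg k = {..<0} \<times> hyp k"

definition handle_pos :: "'n::finite \<Rightarrow> ('n handle_pt) set" where
  "handle_pos k = {0<..} \<times> hyp k"

text \<open>The PL disk is a cube, since a round disk is not a polyhedron.\<close>

definition disk_norm :: "cat \<Rightarrow> real ^ 'n::finite \<Rightarrow> real" where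
  "disk_norm C y = (if C = PL then infnorm y else norm y)"

definition disk :: "cat \<Rightarrow> 'n::finite \<Rightarrow> (real ^ 'n) set" where
  "disk C k = {y \<in> hyp k. disk_norm C y \<le> 1}"

definition open_disk :: "cat \<Rightarrow> 'n::finite \<Rightarrow> (real ^ 'n) set" where
  "open_disk C k = {y \<in> hyp k. disk_norm C y < 1}"

text \<open>
  Concentric spheres go to concentric spheres and, in TOP and DIFF, rays from the origin are
  preserved. A PL isomorphism from the open cube to the whole space cannot preserve all of these
  rays (when \<open>n > 2\<close>); it can only map concentric cubes to concentric cubes.
\<close>

definition radial_expansion :: "cat \<Rightarrow> 'n::finite \<Rightarrow> (real ^ 'n \<Rightarrow> real ^ 'n) \<Rightarrow> bool" where
  "radial_expansion C k \<Lambda> \<longleftrightarrow>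
     (\<exists>h. strict_mono_on {0..<1} h \<and>
        (\<forall>y\<in>open_disk C k. disk_norm C (\<Lambda> y) = h (disk_norm C y) \<and>
           (C \<noteq> PL \<longrightarrow> (\<exists>s\<ge>0. \<Lambda> y = s *\<^sub>R y))))"

text \<open>
  A map \<open>f\<close> defined on a subset \<open>A\<close> of \<open>E = \<real>\<^sup>n\<close> is locally flat if near each point it is the
  restriction of a CAT open embedding \<open>F\<close>, so that the pair \<open>(M, f A)\<close> is locally CAT isomorphic to
  \<open>(\<real>\<^sup>n, A)\<close>. It will be used for \<open>A = [0,\<infinity>) \<times> 0\<close> and for \<open>A = [0,\<infinity>) \<times> D\<^bsup>n-1\<^esup>\<close>; in the
  latter case it includes the DIFF condition at the corners of \<open>A\<close>. In particular, a locally flat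
  embedding is CAT.
\<close>

definition locally_flat ::
    "cat \<Rightarrow> 'n::finite \<Rightarrow> ('p, 'n) mfd \<Rightarrow> ('n handle_pt) set \<Rightarrow> ('n handle_pt \<Rightarrow> 'p) \<Rightarrow> bool" where
  "locally_flat C k M A f \<longleftrightarrow>
     (\<forall>a\<in>A. \<exists>G F. openin (mspace (handle_mfd k)) G \<and> a \<in> G \<and>
        cat_open_embedding C (open_submfd (handle_mfd k) G) M F \<and> F ` G \<subseteq> mfd_interior M \<and>
        (\<forall>x\<in>G \<inter> A. F x = f x) \<and> F ` G \<inter> f ` A = f ` (G \<inter> A))"

definition is_ray :: "cat \<Rightarrow> 'n::finite \<Rightarrow> ('p, 'n) mfd \<Rightarrow> (real \<Rightarrow> 'p) \<Rightarrow> bool" where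
  "is_ray C k M r \<longleftrightarrow>
     proper_map (top_of_set {0..}) (mspace M) r \<and>
     embedding_map (top_of_set {0..}) (mspace M) r \<and>
     locally_flat C k M ({0..} \<times> {0}) (r \<circ> fst) \<and>
     r ` {0..} \<subseteq> mfd_interior M"

definition is_tubular_nbhd_map ::
    "cat \<Rightarrow> 'n::finite \<Rightarrow> ('p, 'n) mfd \<Rightarrow> (real \<Rightarrow> 'p) \<Rightarrow> ('n handle_pt \<Rightarrow> 'p) \<Rightarrow> bool" where
  "is_tubular_nbhd_map C k M r \<nu> \<longleftrightarrow>
     proper_map (top_of_set ({0..} \<times> disk C k)) (mspace M) \<nu> \<and>
     embedding_map (top_of_set ({0..} \<times> disk C k)) (mspace M) \<nu> \<and>
     locally_flat C k M ({0..} \<times> disk C k) \<nu> \<and>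
     \<nu> ` ({0..} \<times> disk C k) \<subseteq> mfd_interior M \<and>
     (\<forall>x\<ge>0. \<nu> (x, 0) = r x)"

definition phi_pos ::
    "cat \<Rightarrow> 'n::finite \<Rightarrow> (real \<Rightarrow> real) \<Rightarrow> (real ^ 'n \<Rightarrow> real ^ 'n) \<Rightarrow>
     ('n handle_pt \<Rightarrow> 'p) \<Rightarrow> 'n handle_pt \<Rightarrow> 'p" where
  "phi_pos C k \<rho> \<Lambda> \<nu> = (\<lambda>(t, y). \<nu> (\<rho> t, inv_into (open_disk C k) \<Lambda> y))"

definition phi_neg ::
    "cat \<Rightarrow> 'n::finite \<Rightarrow> (real \<Rightarrow> real) \<Rightarrow> (real ^ 'n \<Rightarrow> real ^ 'n) \<Rightarrow>
     ('n handle_pt \<Rightarrow> 'p) \<Rightarrow> 'n handle_pt \<Rightarrow> 'p" where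
  "phi_neg C k \<rho> \<Lambda> \<nu>' = (\<lambda>(t, y). \<nu>' (\<rho> (- t), inv_into (open_disk C k) \<Lambda> y))"


section \<open>Attaching the handle\<close>

definition disjoint_sum_topology :: "'a topology \<Rightarrow> 'b topology \<Rightarrow> ('a + 'b) topology" where
  "disjoint_sum_topology X Y = topology (\<lambda>W. openin X (Inl -` W) \<and> openin Y (Inr -` W))"

definition eq_class :: "('a \<Rightarrow> 'a \<Rightarrow> bool) \<Rightarrow> 'a \<Rightarrow> 'a set" where
  "eq_class R x = {y. R x y}"

definition quotient_topology :: "'a topology \<Rightarrow> ('a \<Rightarrow> 'a \<Rightarrow> bool) \<Rightarrow> 'a set topology" where
  "quotient_topology X R =
     topology (\<lambda>W. W \<subseteq> eq_class R ` topspace X \<and> openin X {x \<in> topspace X. eq_class R x \<in> W})"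

definition glue_rel ::
    "'n::finite \<Rightarrow> ('n handle_pt \<Rightarrow> 'p) \<Rightarrow> ('n handle_pt \<Rightarrow> 'p) \<Rightarrow>
     'p + 'n handle_pt \<Rightarrow> 'p + 'n handle_pt \<Rightarrow> bool" where
  "glue_rel k \<phi>p \<phi>n = equivclp (\<lambda>a b.
     (\<exists>x\<in>handle_pos k. a = Inr x \<and> b = Inl (\<phi>p x)) \<or>
     (\<exists>x\<in>handle_neg k. a = Inr x \<and> b = Inl (\<phi>n x)))"

definition handle_quotient ::
    "'n::finite \<Rightarrow> ('p, 'n) mfd \<Rightarrow> ('n handle_pt \<Rightarrow> 'p) \<Rightarrow> ('n handle_pt \<Rightarrow> 'p) \<Rightarrow>
     ('p + 'n handle_pt) set topology" where
  "handle_quotient k M \<phi>p \<phi>n =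
     quotient_topology (disjoint_sum_topology (mspace M) (mspace (handle_mfd k)))
       (glue_rel k \<phi>p \<phi>n)"

definition incl_M ::
    "'n::finite \<Rightarrow> ('n handle_pt \<Rightarrow> 'p) \<Rightarrow> ('n handle_pt \<Rightarrow> 'p) \<Rightarrow>
     'p \<Rightarrow> ('p + 'n handle_pt) set" where
  "incl_M k \<phi>p \<phi>n = eq_class (glue_rel k \<phi>p \<phi>n) \<circ> Inl"

definition incl_E ::
    "'n::finite \<Rightarrow> ('n handle_pt \<Rightarrow> 'p) \<Rightarrow> ('n handle_pt \<Rightarrow> 'p) \<Rightarrow>
     'n handle_pt \<Rightarrow> ('p + 'n handle_pt) set" where
  "incl_E k \<phi>p \<phi>n = eq_class (glue_rel k \<phi>p \<phi>n) \<circ> Inr"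

definition transport_atlas ::
    "'p set \<Rightarrow> ('p \<Rightarrow> 'q) \<Rightarrow> ('p, 'n::finite) chart set \<Rightarrow> ('q, 'n) chart set" where
  "transport_atlas S i \<A> = (\<lambda>(U, c). (i ` U, c \<circ> inv_into S i)) ` \<A>"

text \<open>Used with \<open>\<A>\<close> the atlas of \<open>M\<close> and with \<open>\<A>\<close> an oriented atlas of its interior.\<close>

definition handle_atlas ::
    "'n::finite \<Rightarrow> ('p, 'n) mfd \<Rightarrow> ('n handle_pt \<Rightarrow> 'p) \<Rightarrow> ('n handle_pt \<Rightarrow> 'p) \<Rightarrow>
     ('p, 'n) chart set \<Rightarrow> (('p + 'n handle_pt) set, 'n) chart set" where
  "handle_atlas k M \<phi>p \<phi>n \<A> =
     transport_atlas (topspace (mspace M)) (incl_M k \<phi>p \<phi>n) \<A> \<union>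
     transport_atlas (handle_carrier k) (incl_E k \<phi>p \<phi>n) (matlas (handle_mfd k))"

definition attach_handle ::
    "'n::finite \<Rightarrow> ('p, 'n) mfd \<Rightarrow> ('n handle_pt \<Rightarrow> 'p) \<Rightarrow> ('n handle_pt \<Rightarrow> 'p) \<Rightarrow>
     (('p + 'n handle_pt) set, 'n) mfd" where
  "attach_handle k M \<phi>p \<phi>n =
     \<lparr> mspace = handle_quotient k M \<phi>p \<phi>n, matlas = handle_atlas k M \<phi>p \<phi>n (matlas M) \<rparr>"

definition oriented_handle ::
    "'n::finite \<Rightarrow> ('p, 'n) chart set \<Rightarrow> ('n handle_pt \<Rightarrow> 'p) \<Rightarrow> ('n handle_pt \<Rightarrow> 'p) \<Rightarrow> bool" where
  "oriented_handle k \<O> \<phi>p \<phi>n \<longleftrightarrow>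
     orientation_preserving_map (restrict_atlas (handle_pos k) (matlas (handle_mfd k))) \<O> \<phi>p \<and>
     orientation_preserving_map (restrict_atlas (handle_neg k) (matlas (handle_mfd k))) \<O> \<phi>n"

end

theory Submission
  imports Defs
begin

text \<open>
  Everything about \<open>N\<close> is read off from three properties of the attaching maps \<open>\<phi>\<^sub>\<plusminus>\<close>: they are open
  embeddings, they are CAT in charts, and they converge to infinity in \<open>M\<close> as the handle coordinate
  \<open>t\<close> tends to 0. The first two hold because local flatness makes \<open>\<nu>\<close>, over the interior of its
  domain, locally a restriction of a CAT open embedding, so no invariance of domain is needed. The
  third holds because \<open>\<nu>\<close> is a closed map: the sets \<open>\<nu> ([s,\<infinity>) \<times> D)\<close> are closed in \<open>M\<close> and have
  empty intersection.

  The first property makes \<open>i\<^sub>M\<close> and \<open>i\<^sub>E\<close> open embeddings, so that the only question about the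
  Hausdorff property is to separate a point of \<open>M\<close> from a point of \<open>E\<^sub>0\<close>, which is the third property.
  The latter also shows that suitable neighbourhoods of the compact shells \<open>0 \<times> {m \<le> \<bar>y\<bar> \<le> m + 1}\<close>
  form a locally finite family in \<open>N\<close>, whence paracompactness. For orientations, the local degree of
  the coordinate changes is local by excision, and that of an inverse is determined by functoriality.
\<close>

section \<open>Smooth maps\<close>

text \<open>The direction of \<open>\<rho>\<close> decides whether N is a manifold: t near 0 has to
  mean far out on the rays. For an increasing \<open>\<rho>\<close>, the points \<phi>_+(t,y) would
  converge in M as t tends to 0, to the point of the initial disk of the tube that corresponds to y,
  and this point could not be separated from (0,y) in N. Paracompactness cannot rest on a countable
  basis, since M may have uncountably many components. Only E_0 is treated by a countable
  exhaustion; everything else is inherited from M. Charts may have images that are relatively open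
  in a half-space, and the disk lies in a hyperplane, so CAT maps have to be handled on sets that
  are not open. PL maps restrict only to relatively open subsets; this is why the restriction lemmas
  carry openness hypotheses through every overlap of charts. An orientation is an atlas of its own.
  Its charts are compatible with those of M, but the attaching maps are known to be CAT only in the
  charts of M, so a chart of the orientation is compared with the handle through charts of
  M.\<close>

lemma differentiable_order_on_cong:
  assumes "open S" "\<And>x. x \<in> S \<Longrightarrow> f x = g x" "differentiable_order_on S f m"
  shows "differentiable_order_on S g m"
  using assms
proof (induction m arbitrary: f g)
  case 0
  then show ?case by (simp cong: continuous_on_cong)
next
  case (Suc m)
  have d: "f differentiable (at x)" if "x \<in> S" for x
    using Suc.prems that by simp
  \<comment> \<open>Openness of \<open>S\<close> enters here: f and g agree on a whole neighbourhood
    of x, so they share their derivative at x.\<close>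
  have fd: "(g has_derivative frechet_derivative f (at x)) (at x)" if "x \<in> S" for x
    using d[OF that] has_derivative_transform_within_open[of f _ x UNIV S g] Suc.prems(1,2) that
    by (simp add: frechet_derivative_works)
  then have eq: "frechet_derivative g (at x) = frechet_derivative f (at x)" if "x \<in> S" for x
    using frechet_derivative_at that by metis
  have "differentiable_order_on S (\<lambda>x. frechet_derivative g (at x) v) m" for v
    using Suc.IH[of "\<lambda>x. frechet_derivative f (at x) v"] Suc.prems eq by simp
  then show ?case
    using fd by (auto simp: differentiable_def)
qed

lemma differentiable_order_on_Suc_imp:
  "differentiable_order_on S f (Suc m) \<Longrightarrow> differentiable_order_on S f m"
proof (induction m arbitrary: f)
  case 0
  then show ?case
    by (auto intro!: continuous_at_imp_continuous_on differentiable_imp_continuous_within)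
next
  case (Suc m)
  then show ?case by simp
qed

lemma differentiable_order_on_subset:
  "differentiable_order_on S f m \<Longrightarrow> T \<subseteq> S \<Longrightarrow> differentiable_order_on T f m"
  by (induction m arbitrary: f) (auto intro: continuous_on_subset)

lemma differentiable_order_on_const: "differentiable_order_on S (\<lambda>x. c) m"
  by (induction m arbitrary: c) auto

lemma differentiable_order_on_linear:
  assumes "bounded_linear L"
  shows "differentiable_order_on S L m"
proof (cases m)
  case 0
  then show ?thesis
    using assms by (simp add: linear_continuous_on)
next
  case (Suc m')
  have "(L has_derivative L) (at x)" for x
    using assms by (rule bounded_linear_imp_has_derivative)
  then have "frechet_derivative L (at x) = L" "L differentiable (at x)" for x
    using frechet_derivative_at[of L L x] by (auto simp: differentiable_def)
  then show ?thesis
    by (simp add: Suc differentiable_order_on_const)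
qed

lemma differentiable_order_on_add:
  assumes "open S" "differentiable_order_on S f m" "differentiable_order_on S g m"
  shows "differentiable_order_on S (\<lambda>x. f x + g x) m"
  using assms
proof (induction m arbitrary: f g)
  case 0
  then show ?case by (auto intro!: continuous_intros)
next
  case (Suc m)
  have d: "((\<lambda>x. f x + g x) has_derivative
      (\<lambda>v. frechet_derivative f (at x) v + frechet_derivative g (at x) v)) (at x)" if "x \<in> S" for x
    using Suc.prems that by (auto intro!: has_derivative_add simp: frechet_derivative_works)
  then have eq: "frechet_derivative (\<lambda>x. f x + g x) (at x) =
      (\<lambda>v. frechet_derivative f (at x) v + frechet_derivative g (at x) v)" if "x \<in> S" for x
    using frechet_derivative_at that by metis
  have "differentiable_order_on S (\<lambda>x. frechet_derivative (\<lambda>x. f x + g x) (at x) v) m" for v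
    by (rule differentiable_order_on_cong[OF \<open>open S\<close>, of
          "\<lambda>x. frechet_derivative f (at x) v + frechet_derivative g (at x) v"])
      (use Suc.IH Suc.prems eq in simp_all)
  then show ?case
    using d by (auto simp: differentiable_def)
qed

lemma differentiable_order_on_sum:
  assumes "open S" "\<And>i. i \<in> I \<Longrightarrow> differentiable_order_on S (f i) m"
  shows "differentiable_order_on S (\<lambda>x. \<Sum>i\<in>I. f i x) m"
proof (cases "finite I")
  case True
  then show ?thesis
    using assms(2)
    by (induction I)
      (simp_all add: differentiable_order_on_const differentiable_order_on_add assms(1))
qed (simp add: differentiable_order_on_const)

lemma differentiable_order_on_scaleR:
  assumes "open S" "differentiable_order_on S f m" "differentiable_order_on S g m"
  shows "differentiable_order_on S (\<lambda>x. f x *\<^sub>R g x) m"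
  using assms
proof (induction m arbitrary: f g)
  case 0
  then show ?case by (simp add: continuous_on_scaleR)
next
  case (Suc m)
  have d: "((\<lambda>x. f x *\<^sub>R g x) has_derivative
      (\<lambda>v. f x *\<^sub>R frechet_derivative g (at x) v + frechet_derivative f (at x) v *\<^sub>R g x)) (at x)"
    if "x \<in> S" for x
    by (rule has_derivative_scaleR) (use Suc.prems that in \<open>simp_all flip: frechet_derivative_works\<close>)
  then have eq: "frechet_derivative (\<lambda>x. f x *\<^sub>R g x) (at x) =
      (\<lambda>v. f x *\<^sub>R frechet_derivative g (at x) v + frechet_derivative f (at x) v *\<^sub>R g x)"
    if "x \<in> S" for x
    using frechet_derivative_at[OF d[OF that]] by simp
  \<comment> \<open>Each term of the product rule keeps one factor undifferentiated, so the
    induction needs the order m of f and g besides that of their derivatives.\<close>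
  have "differentiable_order_on S f m" "differentiable_order_on S g m"
    using Suc.prems(2,3)[THEN differentiable_order_on_Suc_imp] by auto
  then have "differentiable_order_on S (\<lambda>x. f x *\<^sub>R frechet_derivative g (at x) v +
      frechet_derivative f (at x) v *\<^sub>R g x) m" for v
    using Suc.prems(2,3)
    by (intro differentiable_order_on_add Suc.IH \<open>open S\<close>) simp_all
  then have "differentiable_order_on S (\<lambda>x. frechet_derivative (\<lambda>x. f x *\<^sub>R g x) (at x) v) m" for v
    by (rule differentiable_order_on_cong[OF \<open>open S\<close>, rotated]) (simp add: eq)
  then show ?case
    using d by (auto simp: differentiable_def)
qed

lemma differentiable_order_on_compose_linear:
  assumes "open S" "bounded_linear L" "differentiable_order_on S f m"
  shows "differentiable_order_on S (\<lambda>x. L (f x)) m"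
  using assms(3)
proof (induction m arbitrary: f)
  case 0
  then show ?case
    using bounded_linear.continuous_on[OF assms(2)] by simp
next
  case (Suc m)
  have d: "((\<lambda>x. L (f x)) has_derivative (\<lambda>v. L (frechet_derivative f (at x) v))) (at x)"
    if "x \<in> S" for x
    by (rule bounded_linear.has_derivative[OF assms(2)])
      (use Suc.prems that in \<open>simp flip: frechet_derivative_works\<close>)
  then have eq: "frechet_derivative (\<lambda>x. L (f x)) (at x) = (\<lambda>v. L (frechet_derivative f (at x) v))"
    if "x \<in> S" for x
    using frechet_derivative_at[OF d[OF that]] by simp
  have "differentiable_order_on S (\<lambda>x. L (frechet_derivative f (at x) v)) m" for v
    using Suc.IH[of "\<lambda>x. frechet_derivative f (at x) v"] Suc.prems by simp
  then have "differentiable_order_on S (\<lambda>x. frechet_derivative (\<lambda>x. L (f x)) (at x) v) m" for v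
    by (rule differentiable_order_on_cong[OF \<open>open S\<close>, rotated]) (simp add: eq)
  then show ?case
    using d by (auto simp: differentiable_def)
qed

text \<open>By the chain rule, the derivative of g o f in direction v is a derivative of g in a
  direction that varies with x, whereas the induction hypothesis speaks of fixed directions.
  Expanding the varying direction in the basis of the middle space, which is Euclidean for this
  purpose, gives a finite sum of scalar functions times derivatives of g along basis vectors. The
  induction applies to the latter, the sum and product rules do the rest.\<close>

lemma differentiable_order_on_compose:
  fixes f :: "'a::real_normed_vector \<Rightarrow> 'b::euclidean_space"
  assumes "open S" "open T" "f ` S \<subseteq> T"
    and "differentiable_order_on S f m" "differentiable_order_on T g m"
  shows "differentiable_order_on S (\<lambda>x. g (f x)) m"
  using assms(4,5)
proof (induction m arbitrary: g)
  case 0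
  then show ?case
    using assms(3) by (auto intro: continuous_on_compose2[of T g S f])
next
  case (Suc m)
  have dg: "(g has_derivative frechet_derivative g (at (f x))) (at (f x))" if "x \<in> S" for x
    using Suc.prems that assms(3) by (auto simp: frechet_derivative_works)
  have d: "((\<lambda>x. g (f x)) has_derivative
      (\<lambda>v. frechet_derivative g (at (f x)) (frechet_derivative f (at x) v))) (at x)"
    if "x \<in> S" for x
    by (rule has_derivative_compose[where f=f and g=g])
      (use Suc.prems that dg in \<open>simp_all flip: frechet_derivative_works\<close>)
  have expand: "frechet_derivative g (at (f x)) w =
      (\<Sum>b\<in>Basis. (w \<bullet> b) *\<^sub>R frechet_derivative g (at (f x)) b)" if "x \<in> S" for x w
  proof -
    have "linear (frechet_derivative g (at (f x)))"
      using dg[OF that] has_derivative_linear by blast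
    then show ?thesis
      by (subst euclidean_representation[of w, symmetric])
        (simp add: linear_sum linear_cmul o_def)
  qed
  have eq: "frechet_derivative (\<lambda>x. g (f x)) (at x) v =
      (\<Sum>b\<in>Basis. (frechet_derivative f (at x) v \<bullet> b) *\<^sub>R frechet_derivative g (at (f x)) b)"
    if "x \<in> S" for x v
    using frechet_derivative_at[OF d[OF that]] expand[OF that] by metis
  have f: "differentiable_order_on S f m"
    using Suc.prems(1) by (rule differentiable_order_on_Suc_imp)
  have "differentiable_order_on S
      (\<lambda>x. (frechet_derivative f (at x) v \<bullet> b) *\<^sub>R frechet_derivative g (at (f x)) b) m" for v b
  proof (rule differentiable_order_on_scaleR[OF \<open>open S\<close>])
    show "differentiable_order_on S (\<lambda>x. frechet_derivative f (at x) v \<bullet> b) m"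
      by (rule differentiable_order_on_compose_linear[OF \<open>open S\<close> bounded_linear_inner_left])
        (use Suc.prems in auto)
    show "differentiable_order_on S (\<lambda>x. frechet_derivative g (at (f x)) b) m"
      using Suc.IH[OF f, of "\<lambda>y. frechet_derivative g (at y) b"] Suc.prems(2) by simp
  qed
  then have "differentiable_order_on S (\<lambda>x. \<Sum>b\<in>Basis.
      (frechet_derivative f (at x) v \<bullet> b) *\<^sub>R frechet_derivative g (at (f x)) b) m" for v
    by (intro differentiable_order_on_sum[OF \<open>open S\<close>])
  then have "differentiable_order_on S (\<lambda>x. frechet_derivative (\<lambda>x. g (f x)) (at x) v) m" for v
    by (rule differentiable_order_on_cong[OF \<open>open S\<close>, rotated]) (simp add: eq)
  then show ?case
    using d by (auto simp: differentiable_def)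
qed

lemma smooth_on_open_imp_continuous_on: "smooth_on_open S f \<Longrightarrow> continuous_on S f"
  unfolding smooth_on_open_def by (metis differentiable_order_on.simps(1))

abbreviation smooth_at ::
    "'a::euclidean_space set \<Rightarrow> ('a \<Rightarrow> 'b::euclidean_space) \<Rightarrow> 'a \<Rightarrow> bool" where
  "smooth_at S f x \<equiv> \<exists>T F. open T \<and> x \<in> T \<and> smooth_on_open T F \<and> (\<forall>y\<in>S \<inter> T. F y = f y)"

lemma smooth_mapI:
  assumes "\<And>x. x \<in> S \<Longrightarrow> smooth_at S f x"
  shows "smooth_map S f"
  unfolding smooth_map_def using assms by (rule ballI)

lemma smooth_mapE:
  assumes "smooth_map S f" "x \<in> S"
  obtains T F where "open T" "x \<in> T" "smooth_on_open T F" "\<forall>y\<in>S \<inter> T. F y = f y"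
proof -
  have "smooth_at S f x"
    using assms(1) unfolding smooth_map_def by (rule bspec) (rule assms(2))
  then obtain T F where "open T" "x \<in> T" "smooth_on_open T F" "\<forall>y\<in>S \<inter> T. F y = f y"
    by (elim exE conjE)
  then show thesis
    by (intro that[of T F]) simp_all
qed

lemma smooth_map_cong:
  assumes "\<And>x. x \<in> S \<Longrightarrow> f x = g x"
  shows "smooth_map S f = smooth_map S g"
  unfolding smooth_map_def using assms by (metis (no_types, lifting) IntD1)

lemma smooth_map_imp_continuous_on:
  assumes "smooth_map S f"
  shows "continuous_on S f"
proof -
  have "continuous (at x within S) f" if x: "x \<in> S" for x
  proof -
    from smooth_mapE[OF assms x] obtain T F where
      T: "open T" "x \<in> T" "smooth_on_open T F" "\<forall>y\<in>S \<inter> T. F y = f y" .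
    have "continuous_on (S \<inter> T) F"
      using smooth_on_open_imp_continuous_on[OF T(3)] by (rule continuous_on_subset) simp
    then have "continuous_on (S \<inter> T) f"
      using T(4) continuous_on_cong[of "S \<inter> T" "S \<inter> T" F f] by simp
    moreover have "at x within S = at x within (S \<inter> T)"
      using T(1,2) by (intro at_within_nhd[of x T]) auto
    ultimately show ?thesis
      using x T(2) by (simp add: continuous_on_eq_continuous_within)
  qed
  then show ?thesis
    by (simp add: continuous_on_eq_continuous_within)
qed

lemma smooth_on_open_subset: "smooth_on_open S f \<Longrightarrow> T \<subseteq> S \<Longrightarrow> smooth_on_open T f"
  unfolding smooth_on_open_def by (intro allI differentiable_order_on_subset[of S f _ T]) simp_all

lemma smooth_map_subset:
  assumes "smooth_map S f" "S' \<subseteq> S"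
  shows "smooth_map S' f"
proof (rule smooth_mapI)
  fix x assume "x \<in> S'"
  then have "x \<in> S"
    using assms(2) by blast
  from smooth_mapE[OF assms(1) this] obtain T F where
    "open T" "x \<in> T" "smooth_on_open T F" "\<forall>y\<in>S \<inter> T. F y = f y" .
  then show "smooth_at S' f x"
    using assms(2) by (intro exI[of _ T] exI[of _ F]) (simp add: subset_iff)
qed

lemma smooth_map_locally:
  assumes "\<And>x. x \<in> S \<Longrightarrow> \<exists>S'. x \<in> S' \<and> openin (top_of_set S) S' \<and> smooth_map S' f"
  shows "smooth_map S f"
proof (rule smooth_mapI)
  fix x assume "x \<in> S"
  from assms[OF this] obtain S' where S'_open: "openin (top_of_set S) S'"
    and S'_map: "x \<in> S'" "smooth_map S' f"
    by (elim exE conjE)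
  from S'_open obtain T' where "open T'" "S' = S \<inter> T'"
    unfolding openin_open by (elim exE conjE)
  note S' = S'_map this
  from smooth_mapE[OF S'_map(2,1)] obtain T F where
    "open T" "x \<in> T" "smooth_on_open T F" "\<forall>y\<in>S' \<inter> T. F y = f y" .
  then show "smooth_at S f x"
    using S' by (intro exI[of _ "T \<inter> T'"] exI[of _ F])
      (auto intro: smooth_on_open_subset)
qed

lemma smooth_map_compose:
  assumes "smooth_map S f" "smooth_map R g" "f ` S \<subseteq> R"
  shows "smooth_map S (\<lambda>x. g (f x))"
proof (rule smooth_mapI)
  fix x assume x: "x \<in> S"
  from smooth_mapE[OF assms(1) x] obtain T F where
    T: "open T" "x \<in> T" "smooth_on_open T F" "\<forall>y\<in>S \<inter> T. F y = f y" .
  have "f x \<in> R"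
    using assms(3) x by blast
  from smooth_mapE[OF assms(2) this] obtain U G where
    U: "open U" "f x \<in> U" "smooth_on_open U G" "\<forall>y\<in>R \<inter> U. G y = g y" .
  \<comment> \<open>The local extension F agrees with f only on S, so it may leave U elsewhere in T;
    the neighbourhood is shrunk until G o F makes sense.\<close>
  let ?V = "T \<inter> F -` U"
  have V: "open ?V"
    using smooth_on_open_imp_continuous_on[OF T(3)] T(1) U(1) by (rule continuous_open_preimage)
  have "smooth_on_open ?V (\<lambda>x. G (F x))"
    unfolding smooth_on_open_def
  proof
    fix m
    have "differentiable_order_on T F m" and G: "differentiable_order_on U G m"
      using T(3) U(3) unfolding smooth_on_open_def by simp_all
    then have F: "differentiable_order_on ?V F m"
      using differentiable_order_on_subset[of T F m ?V] by simp
    have "F ` ?V \<subseteq> U"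
      by auto
    from differentiable_order_on_compose[OF V U(1) this F G]
    show "differentiable_order_on ?V (\<lambda>x. G (F x)) m" .
  qed
  moreover have "G (F y) = g (f y)" if "y \<in> S \<inter> ?V" for y
  proof -
    have "F y = f y"
      using that by (intro T(4)[THEN bspec]) simp
    moreover have "f y \<in> R"
      using that assms(3) by blast
    ultimately have "f y \<in> R \<inter> U"
      using that by simp
    with U(4) have "G (f y) = g (f y)"
      by (rule bspec)
    with \<open>F y = f y\<close> show ?thesis
      by simp
  qed
  moreover have "x \<in> ?V"
    using T(2,4) U(2) x by simp
  ultimately show "smooth_at S (\<lambda>x. g (f x)) x"
    using V by (intro exI[of _ ?V] exI[of _ "\<lambda>x. G (F x)"] conjI ballI)
qed

lemma smooth_map_add:
  assumes "smooth_map S f" "smooth_map S g"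
  shows "smooth_map S (\<lambda>x. f x + g x)"
proof (rule smooth_mapI)
  fix x assume x: "x \<in> S"
  from smooth_mapE[OF assms(1) x] obtain T F where
    T: "open T" "x \<in> T" "smooth_on_open T F" "\<forall>y\<in>S \<inter> T. F y = f y" .
  from smooth_mapE[OF assms(2) x] obtain U G where
    U: "open U" "x \<in> U" "smooth_on_open U G" "\<forall>y\<in>S \<inter> U. G y = g y" .
  have "smooth_on_open (T \<inter> U) (\<lambda>x. F x + G x)"
    unfolding smooth_on_open_def
  proof
    fix m
    have "differentiable_order_on T F m" "differentiable_order_on U G m"
      using T(3) U(3) unfolding smooth_on_open_def by simp_all
    then have "differentiable_order_on (T \<inter> U) F m" "differentiable_order_on (T \<inter> U) G m"
      using differentiable_order_on_subset[of T F m "T \<inter> U"]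
        differentiable_order_on_subset[of U G m "T \<inter> U"] by simp_all
    then show "differentiable_order_on (T \<inter> U) (\<lambda>x. F x + G x) m"
      using T(1) U(1) by (intro differentiable_order_on_add open_Int)
  qed
  then show "smooth_at S (\<lambda>x. f x + g x) x"
    using T U by (intro exI[of _ "T \<inter> U"] exI[of _ "\<lambda>x. F x + G x"]) (simp add: open_Int)
qed

lemma smooth_map_affine:
  assumes "linear L"
  shows "smooth_map S (\<lambda>x. L x + b)"
proof -
  have "smooth_on_open UNIV (\<lambda>x. L x + b)"
    unfolding smooth_on_open_def
    using assms
    by (intro allI differentiable_order_on_add differentiable_order_on_const
        differentiable_order_on_linear) (simp_all add: linear_conv_bounded_linear)
  then show ?thesis
    unfolding smooth_map_def by (metis UNIV_I open_UNIV)
qed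

section \<open>PL maps\<close>

abbreviation affine_on :: "'a::euclidean_space set \<Rightarrow> ('a \<Rightarrow> 'b::euclidean_space) \<Rightarrow> bool" where
  "affine_on P f \<equiv> \<exists>L b. linear L \<and> (\<forall>y\<in>P. f y = L y + b)"

lemma pl_mapI:
  assumes "\<And>x. x \<in> S \<Longrightarrow> \<exists>\<P> T. finite \<P> \<and> open T \<and> x \<in> T \<and> S \<inter> T \<subseteq> \<Union>\<P> \<and>
    (\<forall>P\<in>\<P>. polytope P \<and> P \<subseteq> S \<and> affine_on P f)"
  shows "pl_map S f"
  unfolding pl_map_def
proof
  fix x assume "x \<in> S"
  from assms[OF this] obtain \<P> T where "finite \<P>" "open T" "x \<in> T" "S \<inter> T \<subseteq> \<Union>\<P>"
    "\<forall>P\<in>\<P>. polytope P \<and> P \<subseteq> S \<and> affine_on P f"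
    by (elim exE conjE)
  then show "\<exists>\<P> T. finite \<P> \<and> (\<forall>P\<in>\<P>. polytope P) \<and> open T \<and> x \<in> T \<and>
      S \<inter> T \<subseteq> \<Union>\<P> \<and> \<Union>\<P> \<subseteq> S \<and> (\<forall>P\<in>\<P>. affine_on P f)"
    by (intro exI[of _ \<P>] exI[of _ T]) (simp add: Sup_le_iff)
qed

lemma pl_mapE:
  assumes "pl_map S f" "x \<in> S"
  obtains \<P> T where "finite \<P>" "open T" "x \<in> T" "S \<inter> T \<subseteq> \<Union>\<P>"
    "\<forall>P\<in>\<P>. polytope P" "\<forall>P\<in>\<P>. P \<subseteq> S"
    "\<forall>P\<in>\<P>. affine_on P f"
proof -
  have "\<exists>\<P> T. finite \<P> \<and> (\<forall>P\<in>\<P>. polytope P) \<and> open T \<and> x \<in> T \<and>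
      S \<inter> T \<subseteq> \<Union>\<P> \<and> \<Union>\<P> \<subseteq> S \<and> (\<forall>P\<in>\<P>. affine_on P f)"
    using assms(1) unfolding pl_map_def by (rule bspec) (rule assms(2))
  then obtain \<P> T where "finite \<P>" "\<forall>P\<in>\<P>. polytope P" "open T" "x \<in> T" "S \<inter> T \<subseteq> \<Union>\<P>"
      "\<Union>\<P> \<subseteq> S" "\<forall>P\<in>\<P>. affine_on P f"
    by (elim exE conjE)
  then show thesis
    by (intro that[of \<P> T]) (simp_all add: Sup_le_iff)
qed

lemma pl_map_cong:
  assumes "\<And>x. x \<in> S \<Longrightarrow> f x = g x"
  shows "pl_map S f = pl_map S g"
proof -
  have "pl_map S v" if u: "pl_map S u" and uv: "\<And>x. x \<in> S \<Longrightarrow> v x = u x"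
    for u v :: "'a \<Rightarrow> 'b"
  proof (rule pl_mapI)
    fix x assume "x \<in> S"
    from pl_mapE[OF u this] obtain \<P> T where P: "finite \<P>" "open T" "x \<in> T" "S \<inter> T \<subseteq> \<Union>\<P>"
      "\<forall>P\<in>\<P>. polytope P" "\<forall>P\<in>\<P>. P \<subseteq> S"
      "\<forall>P\<in>\<P>. affine_on P u" .
    have "affine_on P v" if "P \<in> \<P>" for P
      using P(6,7)[THEN bspec, OF that] uv by (metis subsetD)
    with P show "\<exists>\<P> T. finite \<P> \<and> open T \<and> x \<in> T \<and> S \<inter> T \<subseteq> \<Union>\<P> \<and>
        (\<forall>P\<in>\<P>. polytope P \<and> P \<subseteq> S \<and> affine_on P v)"
      by (intro exI[of _ \<P>] exI[of _ T]) simp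
  qed
  from this[of f g] this[of g f] show ?thesis
    using assms by metis
qed

lemma pl_map_imp_continuous_on:
  assumes "pl_map S f"
  shows "continuous_on S f"
proof -
  have "continuous (at x within S) f" if x: "x \<in> S" for x
  proof -
    from pl_mapE[OF assms x] obtain \<P> T where P: "finite \<P>" "open T" "x \<in> T" "S \<inter> T \<subseteq> \<Union>\<P>"
      "\<forall>P\<in>\<P>. polytope P" "\<forall>P\<in>\<P>. P \<subseteq> S"
      "\<forall>P\<in>\<P>. affine_on P f" .
    have "continuous_on P f" if mem: "P \<in> \<P>" for P
    proof -
      obtain L b where L: "linear L" "\<forall>y\<in>P. f y = L y + b"
        using bspec[OF P(7) mem] by blast
      have "continuous_on P (\<lambda>y. L y + b)"
        using L(1) by (intro continuous_on_add continuous_on_const linear_continuous_on)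
          (simp add: linear_conv_bounded_linear)
      then show ?thesis
        using L(2) by (simp cong: continuous_on_cong)
    qed
    then have "continuous_on (\<Union>P\<in>\<P>. P) f"
      using P(1,5) by (intro continuous_on_closed_Union) (auto simp: polytope_imp_closed)
    then have "continuous_on (S \<inter> T) f"
      using P(4) continuous_on_subset by fastforce
    moreover have "at x within S = at x within (S \<inter> T)"
      using P(2,3) by (intro at_within_nhd[of x T]) auto
    ultimately show ?thesis
      using x P(3) by (simp add: continuous_on_eq_continuous_within)
  qed
  then show ?thesis
    by (simp add: continuous_on_eq_continuous_within)
qed

text \<open>A PL map need not restrict to an arbitrary subset, because the domain itself must
  locally be a finite union of polytopes. For a relatively open subset, the given polytopes are cut
  with a closed box inside the open set.\<close>

lemma pl_map_openin_subset:
  assumes "pl_map S f" "openin (top_of_set S) S'"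
  shows "pl_map S' f"
proof (rule pl_mapI)
  fix x assume x: "x \<in> S'"
  obtain R where R: "open R" "S' = S \<inter> R"
    using assms(2) unfolding openin_open by blast
  with x obtain a b where ab: "x \<in> box a b" "cbox a b \<subseteq> R"
    by (metis IntD2 open_contains_cbox)
  have "x \<in> S"
    using x R by simp
  from pl_mapE[OF assms(1) this] obtain \<P> T where
    P: "finite \<P>" "open T" "x \<in> T" "S \<inter> T \<subseteq> \<Union>\<P>"
      "\<forall>P\<in>\<P>. polytope P" "\<forall>P\<in>\<P>. P \<subseteq> S"
      "\<forall>P\<in>\<P>. affine_on P f" .
  let ?\<R> = "(\<lambda>P. P \<inter> cbox a b) ` \<P>"
  have "S' \<inter> (T \<inter> box a b) \<subseteq> \<Union>?\<R>"
    using P(4) R box_subset_cbox[of a b] by auto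
  moreover have "polytope P \<and> P \<subseteq> S' \<and> affine_on P f"
    if "P \<in> ?\<R>" for P
  proof -
    from that obtain Q where Q: "Q \<in> \<P>" "P = Q \<inter> cbox a b"
      by blast
    with P(7) obtain L b where "linear L" "\<forall>y\<in>Q. f y = L y + b"
      by blast
    then show ?thesis
      using P(5,6)[THEN bspec, OF Q(1)] Q(2) R(2) ab(2) by (auto intro: polytope_Int polytope_interval)
  qed
  ultimately show "\<exists>\<P> T. finite \<P> \<and> open T \<and> x \<in> T \<and> S' \<inter> T \<subseteq> \<Union>\<P> \<and>
      (\<forall>P\<in>\<P>. polytope P \<and> P \<subseteq> S' \<and> affine_on P f)"
    using P(1-3) ab(1)
    by (intro exI[of _ ?\<R>] exI[of _ "T \<inter> box a b"]) (simp only: finite_imageI open_Int open_box Int_iff, simp)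
qed

lemma pl_map_locally:
  assumes "\<And>x. x \<in> S \<Longrightarrow> \<exists>S'. x \<in> S' \<and> openin (top_of_set S) S' \<and> pl_map S' f"
  shows "pl_map S f"
proof (rule pl_mapI)
  fix x assume "x \<in> S"
  from assms[OF this] obtain S' where S'_open: "openin (top_of_set S) S'"
    and S'_map: "x \<in> S'" "pl_map S' f"
    by (elim exE conjE)
  from S'_open obtain T' where "open T'" "S' = S \<inter> T'"
    unfolding openin_open by (elim exE conjE)
  note S' = S'_map this
  from pl_mapE[OF S'_map(2,1)] obtain \<P> T where
    "finite \<P>" "open T" "x \<in> T" "S' \<inter> T \<subseteq> \<Union>\<P>"
      "\<forall>P\<in>\<P>. polytope P" "\<forall>P\<in>\<P>. P \<subseteq> S'"
      "\<forall>P\<in>\<P>. affine_on P f" .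
  then show "\<exists>\<P> T. finite \<P> \<and> open T \<and> x \<in> T \<and> S \<inter> T \<subseteq> \<Union>\<P> \<and>
      (\<forall>P\<in>\<P>. polytope P \<and> P \<subseteq> S \<and> affine_on P f)"
    using S' by (intro exI[of _ \<P>] exI[of _ "T \<inter> T'"]) (simp add: Int_assoc Int_commute[of T] open_Int)
qed

text \<open>The preimage of a half-space with normal a is cut out by the normal
  \<open>adjoint L a\<close>. If this vanishes, the preimage is empty or everything, which is still
  a polyhedron.\<close>

lemma polyhedron_affine_preimage:
  fixes L :: "'a::euclidean_space \<Rightarrow> 'b::euclidean_space"
  assumes "polyhedron Q" "linear L"
  shows "polyhedron {y. L y + b \<in> Q}"
proof -
  obtain F where F: "finite F" "Q = \<Inter>F" "\<forall>h\<in>F. \<exists>a c. a \<noteq> 0 \<and> h = {x. a \<bullet> x \<le> c}"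
    using assms(1) unfolding polyhedron_def by blast
  have "polyhedron {y. L y + b \<in> h}" if "h \<in> F" for h
  proof -
    obtain a :: 'b and c where "h = {x. a \<bullet> x \<le> c}"
      using F(3) \<open>h \<in> F\<close> by blast
    then have "{y. L y + b \<in> h} = {y. adjoint L a \<bullet> y \<le> c - a \<bullet> b}"
      using adjoint_works[OF assms(2)] by (auto simp: inner_add_right inner_commute)
    then show ?thesis
      by (simp add: polyhedron_halfspace_le)
  qed
  then have "polyhedron (\<Inter>h\<in>F. {y. L y + b \<in> h})"
    using F by (intro polyhedron_Inter) auto
  moreover have "(\<Inter>h\<in>F. {y. L y + b \<in> h}) = {y. L y + b \<in> Q}"
    using F by auto
  ultimately show ?thesis
    by simp
qed

text \<open>For pieces P of f and Q of g, the points of P that f sends into Q form the intersection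
  of P with an affine preimage of Q. This preimage may be unbounded; intersecting with P makes it a
  polytope again.\<close>

lemma pl_map_compose:
  fixes f :: "'a::euclidean_space \<Rightarrow> 'b::euclidean_space" and g :: "'b \<Rightarrow> 'c::euclidean_space"
  assumes "pl_map S f" "pl_map R g" "f ` S \<subseteq> R"
  shows "pl_map S (\<lambda>x. g (f x))"
proof (rule pl_mapI)
  fix x assume x: "x \<in> S"
  from pl_mapE[OF assms(1) x] obtain \<P> T where
    P: "finite \<P>" "open T" "x \<in> T" "S \<inter> T \<subseteq> \<Union>\<P>"
      "\<forall>P\<in>\<P>. polytope P" "\<forall>P\<in>\<P>. P \<subseteq> S"
      "\<forall>P\<in>\<P>. affine_on P f" .
  have "f x \<in> R"
    using assms x by blast
  from pl_mapE[OF assms(2) this] obtain \<Q> U where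
    Q: "finite \<Q>" "open U" "f x \<in> U" "R \<inter> U \<subseteq> \<Union>\<Q>"
      "\<forall>P\<in>\<Q>. polytope P" "\<forall>P\<in>\<Q>. P \<subseteq> R"
      "\<forall>P\<in>\<Q>. affine_on P g" .
  \<comment> \<open>Near x the values of f have to stay in U, the region of R that the pieces of g
    are known to cover.\<close>
  obtain V where V: "open V" "S \<inter> f -` U = S \<inter> V"
    using continuous_openin_preimage_gen[OF pl_map_imp_continuous_on[OF assms(1)] Q(2)]
    unfolding openin_open by blast
  define \<R> where "\<R> = (\<lambda>(P, Q). {y \<in> P. f y \<in> Q}) ` (\<P> \<times> \<Q>)"
  have fin: "finite \<R>"
    unfolding \<R>_def using P(1) Q(1) by simp
  have R: "polytope Z \<and> Z \<subseteq> S \<and> (\<exists>L b. linear L \<and> (\<forall>y\<in>Z. g (f y) = L y + b))"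
    if mem: "Z \<in> \<R>" for Z
  proof -
    obtain P Q where PQ: "P \<in> \<P>" "Q \<in> \<Q>" "Z = {y \<in> P. f y \<in> Q}"
      using mem unfolding \<R>_def by auto
    obtain L b where L: "linear L" "\<forall>y\<in>P. f y = L y + b"
      using P(7)[THEN bspec, OF PQ(1)] by blast
    obtain L' b' where L': "linear L'" "\<forall>y\<in>Q. g y = L' y + b'"
      using Q(7)[THEN bspec, OF PQ(2)] by blast
    have "Z = P \<inter> {y. L y + b \<in> Q}"
      using PQ(3) L(2) by auto
    moreover have "polytope P" "polyhedron Q"
      using P(5)[THEN bspec, OF PQ(1)] Q(5)[THEN bspec, OF PQ(2)] by (auto simp: polytope_imp_polyhedron)
    ultimately have "polytope Z"
      using L(1) by (simp add: polytope_Int_polyhedron polyhedron_affine_preimage)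
    moreover have "linear (L' \<circ> L)"
      using L(1) L'(1) by (rule linear_compose)
    moreover have "\<forall>y\<in>Z. g (f y) = (L' \<circ> L) y + (L' b + b')"
      using PQ(3) L(2) L' by (auto simp: linear_add)
    ultimately show ?thesis
      using PQ(3) P(6)[THEN bspec, OF PQ(1)] by blast
  qed
  have cover: "S \<inter> (T \<inter> V) \<subseteq> \<Union>\<R>"
  proof
    fix y assume y: "y \<in> S \<inter> (T \<inter> V)"
    then have "y \<in> S \<inter> T" "f y \<in> R \<inter> U"
      using V(2) assms(3) by blast+
    then obtain P Q where "P \<in> \<P>" "y \<in> P" "Q \<in> \<Q>" "f y \<in> Q"
      using P(4) Q(4) by blast
    then show "y \<in> \<Union>\<R>"
      unfolding \<R>_def by blast
  qed
  have "open (T \<inter> V)" "x \<in> T \<inter> V"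
    using P(2,3) V Q(3) x by auto
  with fin R cover show "\<exists>\<P> T. finite \<P> \<and> open T \<and> x \<in> T \<and> S \<inter> T \<subseteq> \<Union>\<P> \<and>
      (\<forall>P\<in>\<P>. polytope P \<and> P \<subseteq> S \<and> (\<exists>L b. linear L \<and> (\<forall>y\<in>P. g (f y) = L y + b)))"
    by (intro exI[of _ \<R>] exI[of _ "T \<inter> V"]) simp
qed

lemma pl_map_add:
  assumes "pl_map S f" "pl_map S g"
  shows "pl_map S (\<lambda>x. f x + g x)"
proof (rule pl_mapI)
  fix x assume x: "x \<in> S"
  from pl_mapE[OF assms(1) x] obtain \<P> T where
    P: "finite \<P>" "open T" "x \<in> T" "S \<inter> T \<subseteq> \<Union>\<P>"
      "\<forall>P\<in>\<P>. polytope P" "\<forall>P\<in>\<P>. P \<subseteq> S"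
      "\<forall>P\<in>\<P>. affine_on P f" .
  from pl_mapE[OF assms(2) x] obtain \<Q> U where
    Q: "finite \<Q>" "open U" "x \<in> U" "S \<inter> U \<subseteq> \<Union>\<Q>"
      "\<forall>P\<in>\<Q>. polytope P" "\<forall>P\<in>\<Q>. P \<subseteq> S"
      "\<forall>P\<in>\<Q>. affine_on P g" .
  define \<R> where "\<R> = (\<lambda>(P, Q). P \<inter> Q) ` (\<P> \<times> \<Q>)"
  have fin: "finite \<R>"
    unfolding \<R>_def using P(1) Q(1) by simp
  have R: "polytope Z \<and> Z \<subseteq> S \<and> (\<exists>L b. linear L \<and> (\<forall>y\<in>Z. f y + g y = L y + b))"
    if mem: "Z \<in> \<R>" for Z
  proof -
    obtain P Q where PQ: "P \<in> \<P>" "Q \<in> \<Q>" "Z = P \<inter> Q"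
      using mem unfolding \<R>_def by auto
    obtain L b where L: "linear L" "\<forall>y\<in>P. f y = L y + b"
      using P(7)[THEN bspec, OF PQ(1)] by blast
    obtain L' b' where L': "linear L'" "\<forall>y\<in>Q. g y = L' y + b'"
      using Q(7)[THEN bspec, OF PQ(2)] by blast
    have "linear (\<lambda>y. L y + L' y)"
      using L(1) L'(1) by (rule linear_compose_add)
    moreover have "\<forall>y\<in>Z. f y + g y = (L y + L' y) + (b + b')"
      using PQ(3) L(2) L'(2) by auto
    moreover have "polytope Z"
      unfolding PQ(3) using P(5) Q(5) PQ(1,2) by (simp add: polytope_Int)
    moreover have "Z \<subseteq> S"
      unfolding PQ(3) using P(6) PQ(1) by blast
    ultimately show ?thesis
      by (intro conjI exI[of _ "\<lambda>y. L y + L' y"] exI[of _ "b + b'"])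
  qed
  have "S \<inter> (T \<inter> U) \<subseteq> \<Union>\<R>"
  proof
    fix y assume "y \<in> S \<inter> (T \<inter> U)"
    then obtain P Q where "P \<in> \<P>" "y \<in> P" "Q \<in> \<Q>" "y \<in> Q"
      using P(4) Q(4) by blast
    then show "y \<in> \<Union>\<R>"
      unfolding \<R>_def by blast
  qed
  with fin R P(2,3) Q(2,3) show "\<exists>\<P> T. finite \<P> \<and> open T \<and> x \<in> T \<and> S \<inter> T \<subseteq> \<Union>\<P> \<and>
      (\<forall>P\<in>\<P>. polytope P \<and> P \<subseteq> S \<and> (\<exists>L b. linear L \<and> (\<forall>y\<in>P. f y + g y = L y + b)))"
    by (intro exI[of _ \<R>] exI[of _ "T \<inter> U"]) (simp add: open_Int)
qed

lemma pl_map_affine: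
  assumes "open S" "linear L"
  shows "pl_map S (\<lambda>x. L x + b)"
proof (rule pl_mapI)
  fix x assume "x \<in> S"
  then obtain a c where "x \<in> box a c" "cbox a c \<subseteq> S"
    using assms(1) by (metis open_contains_cbox)
  then show "\<exists>\<P> T. finite \<P> \<and> open T \<and> x \<in> T \<and> S \<inter> T \<subseteq> \<Union>\<P> \<and>
      (\<forall>P\<in>\<P>. polytope P \<and> P \<subseteq> S \<and> (\<exists>L' b'. linear L' \<and> (\<forall>y\<in>P. L y + b = L' y + b')))"
    using assms(2) box_subset_cbox[of a c]
    by (intro exI[of _ "{cbox a c}"] exI[of _ "box a c"]) (auto simp: polytope_interval open_box)
qed

section \<open>Operations common to the three categories\<close>

lemma cat_map_cong:
  assumes "\<And>x. x \<in> S \<Longrightarrow> f x = g x"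
  shows "cat_map C S f = cat_map C S g"
  using assms continuous_on_cong[of S S f g] pl_map_cong[of S f g] smooth_map_cong[of S f g]
  by (cases C) auto

lemma cat_map_imp_continuous_on: "cat_map C S f \<Longrightarrow> continuous_on S f"
  by (cases C) (auto simp: pl_map_imp_continuous_on smooth_map_imp_continuous_on)

lemma cat_map_openin_subset:
  assumes "cat_map C S f" "openin (top_of_set S) S'"
  shows "cat_map C S' f"
  using assms openin_imp_subset[OF assms(2)]
  by (cases C) (auto intro: continuous_on_subset pl_map_openin_subset smooth_map_subset)

lemma cat_map_locally:
  assumes "\<And>x. x \<in> S \<Longrightarrow> \<exists>S'. x \<in> S' \<and> openin (top_of_set S) S' \<and> cat_map C S' f"
  shows "cat_map C S f"
proof (cases C)
  case TOP
  have "continuous (at x within S) f" if x: "x \<in> S" for x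
  proof -
    obtain T where T: "open T" "x \<in> T" "continuous_on (S \<inter> T) f"
      using assms[OF x] TOP unfolding openin_open by auto
    moreover have "at x within S = at x within (S \<inter> T)"
      using T by (intro at_within_nhd[of x T]) auto
    ultimately show ?thesis
      using x by (simp add: continuous_on_eq_continuous_within)
  qed
  then show ?thesis
    using TOP by (simp add: continuous_on_eq_continuous_within)
next
  case PL
  then show ?thesis
    using pl_map_locally[of S f] assms by simp
next
  case DIFF
  then show ?thesis
    using smooth_map_locally[of S f] assms by simp
qed

lemma cat_map_compose:
  assumes "cat_map C S f" "cat_map C R g" "f ` S \<subseteq> R"
  shows "cat_map C S (\<lambda>x. g (f x))"
  using assms
  by (cases C) (auto intro: continuous_on_compose2 pl_map_compose smooth_map_compose)

lemma cat_map_add: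
  assumes "cat_map C S f" "cat_map C S g"
  shows "cat_map C S (\<lambda>x. f x + g x)"
  using assms by (cases C) (auto intro: continuous_on_add pl_map_add smooth_map_add)

text \<open>Openness of \<open>S\<close> serves PL, where the domain must be locally a union of
  polytopes: each point of an open set has a box around it.\<close>

lemma cat_map_affine:
  assumes "open S" "linear L"
  shows "cat_map C S (\<lambda>x. L x + b)"
proof (cases C)
  case TOP
  have "continuous_on S (\<lambda>x. L x + b)"
    using assms(2) by (intro continuous_on_add continuous_on_const linear_continuous_on)
      (simp add: linear_conv_bounded_linear)
  with TOP show ?thesis
    by simp
qed (simp_all add: assms pl_map_affine smooth_map_affine)

section \<open>Coordinate changes\<close>

text \<open>
  \<open>d\<close> is a CAT function of \<open>c\<close> on \<open>W\<close>. For injective \<open>c\<close> and \<open>d\<close>, the coordinate change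
  \<open>c ` W \<rightarrow> d ` W\<close> is a CAT isomorphism if and only if this holds in both directions; this form avoids
  the inverse functions, and it can be moved along a map \<open>h\<close> by \<open>cat_dependent_image\<close>.
\<close>

definition cat_dependent ::
    "cat \<Rightarrow> 'p set \<Rightarrow> ('p \<Rightarrow> 'a::euclidean_space) \<Rightarrow> ('p \<Rightarrow> 'b::euclidean_space) \<Rightarrow> bool" where
  "cat_dependent C W c d \<longleftrightarrow> (\<exists>f. cat_map C (c ` W) f \<and> (\<forall>x\<in>W. f (c x) = d x))"

abbreviation cat_related ::
    "cat \<Rightarrow> 'p set \<Rightarrow> ('p \<Rightarrow> 'a::euclidean_space) \<Rightarrow> ('p \<Rightarrow> 'b::euclidean_space) \<Rightarrow> bool" where
  "cat_related C W c d \<equiv> cat_dependent C W c d \<and> cat_dependent C W d c"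

lemma cat_dependentI:
  assumes "cat_map C (c ` W) f" "\<And>x. x \<in> W \<Longrightarrow> f (c x) = d x"
  shows "cat_dependent C W c d"
  unfolding cat_dependent_def using assms by (intro exI[of _ f]) simp

lemma cat_dependentE:
  assumes "cat_dependent C W c d"
  obtains f where "cat_map C (c ` W) f" "\<forall>x\<in>W. f (c x) = d x"
  using assms unfolding cat_dependent_def by (elim exE conjE)

lemma cat_dependent_trans:
  assumes "cat_dependent C W c d" "cat_dependent C W d e"
  shows "cat_dependent C W c e"
proof -
  from assms(1) obtain f where f: "cat_map C (c ` W) f" "\<forall>x\<in>W. f (c x) = d x"
    by (rule cat_dependentE)
  from assms(2) obtain g where g: "cat_map C (d ` W) g" "\<forall>x\<in>W. g (d x) = e x"
    by (rule cat_dependentE)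
  have "f ` c ` W \<subseteq> d ` W"
    using f(2) by auto
  from cat_map_compose[OF f(1) g(1) this] show ?thesis
    by (rule cat_dependentI) (simp add: f(2) g(2))
qed

lemma cat_dependent_subset:
  assumes "cat_dependent C W c d" "W' \<subseteq> W" "openin (top_of_set (c ` W)) (c ` W')"
  shows "cat_dependent C W' c d"
proof -
  from assms(1) obtain f where f: "cat_map C (c ` W) f" "\<forall>x\<in>W. f (c x) = d x"
    by (rule cat_dependentE)
  show ?thesis
    using assms(2) f(2) by (intro cat_dependentI[OF cat_map_openin_subset[OF f(1) assms(3)]]) auto
qed

lemma cat_dependent_cong:
  assumes "\<And>x. x \<in> W \<Longrightarrow> c x = c' x" "\<And>x. x \<in> W \<Longrightarrow> d x = d' x"
  shows "cat_dependent C W c d \<longleftrightarrow> cat_dependent C W c' d'"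
proof -
  have "c ` W = c' ` W"
    using assms(1) by (rule image_cong[OF refl])
  then show ?thesis
    unfolding cat_dependent_def using assms by simp
qed

lemma cat_dependent_image: "cat_dependent C (h ` W) c d \<longleftrightarrow> cat_dependent C W (c \<circ> h) (d \<circ> h)"
  unfolding cat_dependent_def by (simp add: image_comp)

text \<open>The local witnesses need not be chosen coherently: as c is injective, each of them
  coincides with \<open>d \<circ> inv_into W c\<close> on its domain, and being CAT is a local
  property.\<close>

lemma cat_dependent_locally:
  assumes "inj_on c W"
    and loc: "\<And>x. x \<in> W \<Longrightarrow> \<exists>W'. x \<in> W' \<and> W' \<subseteq> W \<and> openin (top_of_set (c ` W)) (c ` W') \<and>
      cat_dependent C W' c d"
  shows "cat_dependent C W c d"
proof (rule cat_dependentI)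
  show "(d \<circ> inv_into W c) (c x) = d x" if "x \<in> W" for x
    using assms(1) that by simp
  show "cat_map C (c ` W) (d \<circ> inv_into W c)"
  proof (rule cat_map_locally)
    fix z assume "z \<in> c ` W"
    then obtain x where x: "x \<in> W" "z = c x"
      by blast
    from loc[OF x(1)] obtain W' where W': "x \<in> W'" "W' \<subseteq> W"
        "openin (top_of_set (c ` W)) (c ` W')" "cat_dependent C W' c d"
      by (elim exE conjE)
    from W'(4) obtain f where f: "cat_map C (c ` W') f" "\<forall>x\<in>W'. f (c x) = d x"
      by (rule cat_dependentE)
    have "f y = (d \<circ> inv_into W c) y" if "y \<in> c ` W'" for y
      using that f(2) W'(2) assms(1) by (auto simp: subset_iff)
    from iffD1[OF cat_map_cong[OF this] f(1)]
    have "cat_map C (c ` W') (d \<circ> inv_into W c)" .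
    with W' x(2) show "\<exists>S'. z \<in> S' \<and> openin (top_of_set (c ` W)) S' \<and>
        cat_map C S' (d \<circ> inv_into W c)"
      by (intro exI[of _ "c ` W'"]) simp
  qed
qed

text \<open>An inverse of f is forced to send d x to c x, so its being CAT is dependence of c on d.
  Conversely, the two witnesses invert each other on the coordinate images and are continuous
  because CAT maps are.\<close>

lemma cat_iso_iff_cat_dependent:
  assumes "\<And>x. x \<in> W \<Longrightarrow> f (c x) = d x"
  shows "cat_iso C (c ` W) (d ` W) f \<longleftrightarrow> cat_related C W c d"
proof (intro iffI conjI)
  assume "cat_iso C (c ` W) (d ` W) f"
  then obtain g where g: "homeomorphism (c ` W) (d ` W) f g" "cat_map C (c ` W) f"
      "cat_map C (d ` W) g"
    unfolding cat_iso_def by (elim exE conjE)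
  from g(2) show "cat_dependent C W c d"
    by (rule cat_dependentI) (rule assms)
  have "g (d x) = c x" if "x \<in> W" for x
    using homeomorphism_apply1[OF g(1), of "c x"] assms[OF that] that by simp
  with g(3) show "cat_dependent C W d c"
    by (rule cat_dependentI)
next
  assume dep: "cat_related C W c d"
  from dep obtain f' where f': "cat_map C (c ` W) f'" "\<forall>x\<in>W. f' (c x) = d x"
    by (elim conjE cat_dependentE)
  from dep obtain g where g: "cat_map C (d ` W) g" "\<forall>x\<in>W. g (d x) = c x"
    by (elim conjE cat_dependentE)
  have "f y = f' y" if "y \<in> c ` W" for y
    using that assms f'(2) by auto
  from iffD2[OF cat_map_cong[OF this] f'(1)] have f: "cat_map C (c ` W) f" .
  have "homeomorphism (c ` W) (d ` W) f g"
    unfolding homeomorphism_def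
    using assms g(2) cat_map_imp_continuous_on[OF f] cat_map_imp_continuous_on[OF g(1)]
    by (simp add: image_image)
  with f g(1) show "cat_iso C (c ` W) (d ` W) f"
    unfolding cat_iso_def by (intro exI[of _ g]) simp
qed

lemma compatible_charts_iff:
  assumes "inj_on c U"
  shows "compatible_charts C (U, c) (V, d) \<longleftrightarrow>
    cat_related C (U \<inter> V) c d"
  unfolding compatible_charts_def case_prod_conv
  by (rule cat_iso_iff_cat_dependent) (use assms in simp)

text \<open>The topological half of \<open>is_chart\<close>. Coordinate changes do not see whether
  the image is open in the whole space or in a half-space; that condition is added by
  \<open>is_chart_iff\<close>.\<close>

definition coord_chart :: "'p topology \<Rightarrow> 'p set \<Rightarrow> ('p \<Rightarrow> 'a::topological_space) \<Rightarrow> bool" where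
  "coord_chart X U c \<longleftrightarrow>
     openin X U \<and> homeomorphic_map (subtopology X U) (top_of_set (c ` U)) c"

lemma is_chart_iff:
  "is_chart X (U, c) \<longleftrightarrow> coord_chart X U c \<and>
     (open (c ` U) \<or> (\<exists>j. openin (top_of_set {x. 0 \<le> x $ j}) (c ` U)))"
  unfolding is_chart_def coord_chart_def by auto

lemma coord_chart_inj_on: "coord_chart X U c \<Longrightarrow> inj_on c U"
  unfolding coord_chart_def
  by (metis homeomorphic_imp_injective_map openin_subset topspace_subtopology_subset)

lemma coord_chart_openin_image:
  assumes "coord_chart X U c" "openin X W'" "W' \<subseteq> W" "W \<subseteq> U"
  shows "openin (top_of_set (c ` W)) (c ` W')"
proof -
  have "openin (subtopology X U) W'"
    using assms by (auto simp: coord_chart_def openin_open_subtopology)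
  then have "openin (top_of_set (c ` U)) (c ` W')"
    using assms(1) homeomorphic_imp_open_map unfolding coord_chart_def open_map_def by metis
  then show ?thesis
    by (rule openin_subset_trans) (use assms in auto)
qed

lemma cat_dependent_coord_subset:
  assumes "coord_chart X U c" "cat_dependent C W c d" "openin X W'" "W' \<subseteq> W" "W \<subseteq> U"
  shows "cat_dependent C W' c d"
  using cat_dependent_subset[OF assms(2,4) coord_chart_openin_image[OF assms(1,3-5)]] .

lemma cat_dependent_coord_locally:
  assumes "coord_chart X U c" "W \<subseteq> U"
    and "\<And>x. x \<in> W \<Longrightarrow> \<exists>W'. x \<in> W' \<and> openin X W' \<and> W' \<subseteq> W \<and> cat_dependent C W' c d"
  shows "cat_dependent C W c d"
proof (rule cat_dependent_locally)
  show "inj_on c W"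
    using coord_chart_inj_on[OF assms(1)] assms(2) by (rule inj_on_subset)
  fix x assume "x \<in> W"
  from assms(3)[OF this] obtain W' where
    "x \<in> W'" "openin X W'" "W' \<subseteq> W" "cat_dependent C W' c d"
    by (elim exE conjE)
  then show "\<exists>W'. x \<in> W' \<and> W' \<subseteq> W \<and> openin (top_of_set (c ` W)) (c ` W') \<and>
      cat_dependent C W' c d"
    using coord_chart_openin_image[OF assms(1) _ _ assms(2)] by (intro exI[of _ W']) simp
qed

text \<open>Compatibility is transitive only where the intermediate chart is defined. If
  intermediate charts cover the overlap, the dependences compose near each point, and locality gives
  them on the whole overlap.\<close>

lemma compatible_charts_via_cover:
  assumes c: "coord_chart X U c" and d: "coord_chart X V d"
    and cover: "\<And>x. x \<in> U \<inter> V \<Longrightarrow> \<exists>A a. x \<in> A \<and> coord_chart X A a \<and>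
      compatible_charts C (U, c) (A, a) \<and> compatible_charts C (A, a) (V, d)"
  shows "compatible_charts C (U, c) (V, d)"
proof -
  have "\<exists>W'. x \<in> W' \<and> openin X W' \<and> W' \<subseteq> U \<inter> V \<and>
      cat_related C W' c d" if x: "x \<in> U \<inter> V" for x
  proof -
    from cover[OF x] obtain A a where a: "x \<in> A" "coord_chart X A a"
        "compatible_charts C (U, c) (A, a)" "compatible_charts C (A, a) (V, d)"
      by (elim exE conjE)
    let ?W = "U \<inter> V \<inter> A"
    have W: "openin X ?W"
      using a(2) c d by (simp add: coord_chart_def openin_Int)
    have "cat_dependent C (U \<inter> A) c a" "cat_dependent C (U \<inter> A) a c"
        "cat_dependent C (A \<inter> V) a d" "cat_dependent C (A \<inter> V) d a"
      using a(3,4) coord_chart_inj_on[OF c] coord_chart_inj_on[OF a(2)]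
      by (simp_all add: compatible_charts_iff)
    note dep = this
    have "cat_dependent C ?W c a"
      by (rule cat_dependent_coord_subset[OF c dep(1) W]) auto
    moreover have "cat_dependent C ?W a c"
      by (rule cat_dependent_coord_subset[OF a(2) dep(2) W]) auto
    moreover have "cat_dependent C ?W a d"
      by (rule cat_dependent_coord_subset[OF a(2) dep(3) W]) auto
    moreover have "cat_dependent C ?W d a"
      by (rule cat_dependent_coord_subset[OF d dep(4) W]) auto
    ultimately have "cat_dependent C ?W c d" "cat_dependent C ?W d c"
      using cat_dependent_trans[of C ?W c a d] cat_dependent_trans[of C ?W d a c] by simp_all
    with W x a(1) show ?thesis
      by (intro exI[of _ ?W]) auto
  qed
  note loc = this
  have "cat_dependent C (U \<inter> V) c d"
    by (rule cat_dependent_coord_locally[OF c]) (use loc in \<open>simp, blast\<close>)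
  moreover have "cat_dependent C (U \<inter> V) d c"
    by (rule cat_dependent_coord_locally[OF d]) (use loc in \<open>simp, blast\<close>)
  ultimately show ?thesis
    using coord_chart_inj_on[OF c] by (simp add: compatible_charts_iff)
qed

section \<open>Charts transported along an open injection\<close>

lemma cat_dependent_push:
  assumes "inj_on h S" "U \<subseteq> S"
  shows "cat_dependent C (h ` U \<inter> V) (c \<circ> inv_into S h) d \<longleftrightarrow> cat_dependent C (U \<inter> h -` V) c (d \<circ> h)"
    and "cat_dependent C (h ` U \<inter> V) d (c \<circ> inv_into S h) \<longleftrightarrow> cat_dependent C (U \<inter> h -` V) (d \<circ> h) c"
proof -
  have "h ` U \<inter> V = h ` (U \<inter> h -` V)"
    by auto
  then show "cat_dependent C (h ` U \<inter> V) (c \<circ> inv_into S h) d \<longleftrightarrow> cat_dependent C (U \<inter> h -` V) c (d \<circ> h)"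
    and "cat_dependent C (h ` U \<inter> V) d (c \<circ> inv_into S h) \<longleftrightarrow> cat_dependent C (U \<inter> h -` V) (d \<circ> h) c"
    unfolding cat_dependent_image using assms
    by (auto intro!: cat_dependent_cong simp: cat_dependent_image subset_iff)
qed

lemma cat_iso_chart_map_iff:
  assumes "inj_on c U"
  shows "cat_iso C (c ` (U \<inter> f -` V)) (d ` (f ` U \<inter> V)) (d \<circ> f \<circ> inv_into U c) \<longleftrightarrow>
    cat_related C (U \<inter> f -` V) c (d \<circ> f)"
proof -
  have im: "d ` (f ` U \<inter> V) = (d \<circ> f) ` (U \<inter> f -` V)"
    by auto
  show ?thesis
    unfolding im by (rule cat_iso_iff_cat_dependent) (use assms in simp)
qed

lemma coord_chart_push:
  assumes "continuous_map Y X h" "open_map Y X h" "inj_on h (topspace Y)" "coord_chart Y U c"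
  shows "coord_chart X (h ` U) (c \<circ> inv_into (topspace Y) h)"
proof -
  have U: "openin Y U" "U \<subseteq> topspace Y"
    using assms(4) openin_subset unfolding coord_chart_def by auto
  have "homeomorphic_map Y (subtopology X (h ` topspace Y)) h"
    using injective_open_imp_embedding_map[OF assms(1-3)] unfolding embedding_map_def .
  moreover have im: "h ` U \<subseteq> topspace X"
    using U(2) continuous_map_image_subset_topspace[OF assms(1)] by blast
  moreover have "h ` (topspace Y \<inter> U) = topspace (subtopology X (h ` topspace Y)) \<inter> h ` U"
    using U(2) im by auto
  ultimately have "homeomorphic_map (subtopology Y U)
      (subtopology (subtopology X (h ` topspace Y)) (h ` U)) h"
    by (intro homeomorphic_map_subtopologies)
  moreover have "h ` topspace Y \<inter> h ` U = h ` U"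
    using U(2) by blast
  ultimately have "homeomorphic_map (subtopology Y U) (subtopology X (h ` U)) h"
    by (simp add: subtopology_subtopology)
  then obtain h' where h': "homeomorphic_maps (subtopology Y U) (subtopology X (h ` U)) h h'"
    unfolding homeomorphic_map_maps by blast
  \<comment> \<open>\<open>transport_atlas\<close> inverts h on the whole space, while h' inverts
    only its restriction to U. Injectivity of h on \<open>topspace Y\<close> makes the two agree on
    the image of U.\<close>
  have "h' z = inv_into (topspace Y) h z" if "z \<in> topspace (subtopology X (h ` U))" for z
  proof -
    from that obtain x where "x \<in> U" "z = h x"
      by auto
    then show ?thesis
      using h' assms(3) U(2) unfolding homeomorphic_maps_def by (auto simp: subset_iff)
  qed
  moreover have "homeomorphic_map (subtopology X (h ` U)) (subtopology Y U) h'"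
    using h' homeomorphic_maps_sym homeomorphic_map_maps by blast
  ultimately have "homeomorphic_map (subtopology X (h ` U)) (subtopology Y U) (inv_into (topspace Y) h)"
    by (rule homeomorphic_map_eq[rotated])
  moreover have "homeomorphic_map (subtopology Y U) (top_of_set (c ` U)) c"
    using assms(4) unfolding coord_chart_def by blast
  ultimately have "homeomorphic_map (subtopology X (h ` U)) (top_of_set (c ` U))
      (c \<circ> inv_into (topspace Y) h)"
    by (rule homeomorphic_map_compose)
  moreover have "(c \<circ> inv_into (topspace Y) h) ` h ` U = c ` U"
    using assms(3) U(2) by (simp only: image_comp[symmetric] inv_into_image_cancel)
  moreover have "openin X (h ` U)"
    using assms(2) U(1) by (simp add: open_map_def)
  ultimately show ?thesis
    unfolding coord_chart_def by simp
qed

lemma is_chart_push: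
  assumes "continuous_map Y X h" "open_map Y X h" "inj_on h (topspace Y)" "is_chart Y (U, c)"
  shows "is_chart X (h ` U, c \<circ> inv_into (topspace Y) h)"
proof -
  have c: "coord_chart Y U c"
    using assms(4) by (simp add: is_chart_iff)
  then have "U \<subseteq> topspace Y"
    using openin_subset unfolding coord_chart_def by blast
  then have "(c \<circ> inv_into (topspace Y) h) ` h ` U = c ` U"
    using assms(3) by (simp only: image_comp[symmetric] inv_into_image_cancel)
  with assms(4) coord_chart_push[OF assms(1-3) c] show ?thesis
    by (simp add: is_chart_iff)
qed

section \<open>The linear coordinate of the handle\<close>

definition handle_coord :: "'n::finite \<Rightarrow> 'n handle_pt \<Rightarrow> real ^ 'n" where
  "handle_coord k = (\<lambda>(t, y). axis k t + y)"

definition handle_coord_inv :: "'n::finite \<Rightarrow> real ^ 'n \<Rightarrow> 'n handle_pt" where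
  "handle_coord_inv k z = (z $ k, z - axis k (z $ k))"

lemma linear_axis: "linear (axis k :: real \<Rightarrow> real ^ 'n::finite)"
  by (intro linearI) (auto simp: vec_eq_iff axis_def)

lemma handle_coord_inv_coord: "p \<in> handle_carrier k \<Longrightarrow> handle_coord_inv k (handle_coord k p) = p"
  by (auto simp: handle_coord_def handle_coord_inv_def handle_carrier_def hyp_def axis_def vec_eq_iff)

lemma handle_coord_coord_inv: "handle_coord k (handle_coord_inv k z) = z"
  by (simp add: handle_coord_def handle_coord_inv_def)

lemma handle_coord_inv_mem: "handle_coord_inv k z \<in> handle_carrier k"
  by (simp add: handle_coord_inv_def handle_carrier_def hyp_def axis_def)

lemma continuous_on_handle_coord: "continuous_on S (handle_coord k)"
  unfolding handle_coord_def split_def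
  using linear_axis[of k]
  by (auto intro!: continuous_intros linear_continuous_on_compose[of _ _ "axis k"] simp: o_def)

lemma continuous_on_handle_coord_inv: "continuous_on S (handle_coord_inv k)"
  unfolding handle_coord_inv_def
  using linear_axis[of k]
  by (auto intro!: continuous_intros linear_continuous_on_compose[of _ _ "axis k"] simp: o_def)

lemma handle_coord_carrier: "handle_coord k ` handle_carrier k = UNIV"
  using handle_coord_coord_inv handle_coord_inv_mem by (metis surj_def UNIV_eq_I imageI)

lemma inj_on_handle_coord: "inj_on (handle_coord k) (handle_carrier k)"
  by (metis handle_coord_inv_coord inj_onI)

abbreviation handle_space :: "'n::finite \<Rightarrow> 'n handle_pt topology" where
  "handle_space k \<equiv> top_of_set (handle_carrier k)"

lemma coord_chart_handle: "coord_chart (handle_space k) (handle_carrier k) (handle_coord k)"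
proof -
  have "homeomorphic_maps (handle_space k) (top_of_set UNIV)
      (handle_coord k) (handle_coord_inv k)"
    unfolding homeomorphic_maps_def
    using handle_coord_inv_coord handle_coord_coord_inv handle_coord_inv_mem
      continuous_on_handle_coord continuous_on_handle_coord_inv
    by (auto simp: continuous_map_in_subtopology)
  then show ?thesis
    unfolding coord_chart_def handle_coord_carrier
    by (auto simp: homeomorphic_map_maps subtopology_subtopology)
qed

lemma matlas_handle_mfd: "matlas (handle_mfd k) = {(handle_carrier k, handle_coord k)}"
  by (simp add: handle_mfd_def handle_coord_def)

lemma mspace_handle_mfd: "mspace (handle_mfd k) = handle_space k"
  by (simp add: handle_mfd_def)

lemma handle_coord_image_open:
  assumes "openin (handle_space k) S"
  shows "open (handle_coord k ` S)"
proof -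
  have "openin (top_of_set (handle_coord k ` handle_carrier k)) (handle_coord k ` S)"
    using coord_chart_openin_image[OF coord_chart_handle assms] openin_imp_subset[OF assms] by simp
  then show ?thesis
    by (simp add: handle_coord_carrier)
qed

text \<open>In the linear coordinate z of the handle, the product map is z |->
  \<open>axis k (\<alpha> (z $ k)) + \<beta> (z - axis k (z $ k))\<close>. Thus closure under
  composition and sums, together with the linear maps, handles products in all three categories at
  once. The domain T of \<open>\<beta>\<close> is only relatively open in the hyperplane.\<close>

lemma cat_dependent_handle_product:
  assumes S: "open S" and T: "openin (top_of_set (hyp k)) T"
    and \<alpha>: "cat_map C S \<alpha>" and \<beta>: "cat_map C T \<beta>"
  shows "cat_dependent C (S \<times> T) (handle_coord k) (\<lambda>(t, y). handle_coord k (\<alpha> t, \<beta> y))"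
proof -
  let ?Z = "handle_coord k ` (S \<times> T)"
  have TE: "S \<times> T \<subseteq> handle_carrier k"
    using openin_imp_subset[OF T] by (auto simp: handle_carrier_def)
  have "openin (handle_space k) (S \<times> T)"
    unfolding handle_carrier_def using S T by (intro openin_Times) auto
  then have Z: "open ?Z"
    by (rule handle_coord_image_open)
  have fst_coord: "handle_coord k p $ k = fst p" if "p \<in> S \<times> T" for p
    using subsetD[OF TE that] by (auto simp: handle_coord_def handle_carrier_def hyp_def axis_def)
  have snd_coord: "handle_coord k p - axis k (handle_coord k p $ k) = snd p" if "p \<in> S \<times> T" for p
    unfolding fst_coord[OF that] by (simp add: handle_coord_def split_def)
  have "linear (\<lambda>z::real^'a. z $ k)"
    by (simp add: bounded_linear.linear bounded_linear_vec_nth)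
  \<comment> \<open>Here and below, the summand 0 keeps linear maps in the shape
    \<open>L x + b\<close> of \<open>cat_map_affine\<close>.\<close>
  then have "cat_map C ?Z (\<lambda>z. z $ k + 0)"
    by (rule cat_map_affine[OF Z])
  moreover have "(\<lambda>z. z $ k + 0) ` ?Z \<subseteq> S"
    using fst_coord by force
  ultimately have "cat_map C ?Z (\<lambda>z. \<alpha> (z $ k + 0))"
    using cat_map_compose[OF _ \<alpha>] by blast
  moreover have "cat_map C UNIV (\<lambda>t. axis k t + 0 :: real^'a)"
    by (rule cat_map_affine[OF open_UNIV linear_axis])
  ultimately have 1: "cat_map C ?Z (\<lambda>z. axis k (\<alpha> (z $ k + 0)) + 0 :: real^'a)"
    by (rule cat_map_compose) simp
  have "linear (\<lambda>z::real^'a. z - axis k (z $ k))"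
    by (intro linearI) (auto simp: vec_eq_iff axis_def algebra_simps)
  then have "cat_map C ?Z (\<lambda>z. z - axis k (z $ k) + 0)"
    by (rule cat_map_affine[OF Z])
  moreover have "(\<lambda>z. z - axis k (z $ k) + 0) ` ?Z \<subseteq> T"
    using snd_coord by force
  ultimately have 2: "cat_map C ?Z (\<lambda>z. \<beta> (z - axis k (z $ k) + 0))"
    using cat_map_compose[OF _ \<beta>] by blast
  show ?thesis
  proof (rule cat_dependentI[OF cat_map_add[OF 1 2]])
    fix p assume p: "p \<in> S \<times> T"
    show "axis k (\<alpha> (handle_coord k p $ k + 0)) + 0 +
        \<beta> (handle_coord k p - axis k (handle_coord k p $ k) + 0) =
        (\<lambda>(t, y). handle_coord k (\<alpha> t, \<beta> y)) p"
      by (simp only: add_0_right snd_coord[OF p] fst_coord[OF p])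
        (simp add: handle_coord_def split_def)
  qed
qed

section \<open>The model disk, and inverses of CAT isomorphisms\<close>

lemma disk_norm_continuous: "continuous_on S (disk_norm C)"
  unfolding disk_norm_def
  using continuous_on_infnorm[OF continuous_on_id, of S] continuous_on_norm_id[of S]
  by (cases "C = PL") simp_all

lemma openin_open_disk: "openin (top_of_set (hyp k)) (open_disk C k)"
proof -
  have "open {y :: real ^ 'a. disk_norm C y < 1}"
    by (intro open_Collect_less disk_norm_continuous continuous_on_const)
  then show ?thesis
    unfolding open_disk_def openin_open by (intro exI[of _ "{y. disk_norm C y < 1}"]) auto
qed

lemma open_disk_subset: "open_disk C k \<subseteq> disk C k"
  by (auto simp: open_disk_def disk_def)

text \<open>\<open>cat_iso\<close> hides its inverse behind an existential quantifier, while
  \<open>phi_pos\<close> and \<open>phi_neg\<close> use \<open>inv_into\<close>. The two inverses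
  agree on T, so the CAT property carries over.\<close>

lemma cat_isoE_inv_into:
  assumes "cat_iso C S T f"
  shows "inj_on f S" "f ` S = T" "cat_map C S f" "cat_map C T (inv_into S f)"
    "continuous_on S f" "continuous_on T (inv_into S f)"
proof -
  obtain g where g: "homeomorphism S T f g" "cat_map C S f" "cat_map C T g"
    using assms unfolding cat_iso_def by (elim exE conjE)
  show inj: "inj_on f S" and im: "f ` S = T"
    using g(1) unfolding homeomorphism_def by (metis inj_onI, simp)
  have "g y = inv_into S f y" if "y \<in> T" for y
    using that g(1) inj im by (metis homeomorphism_def imageI inv_into_f_f)
  from iffD1[OF cat_map_cong[OF this] g(3)] show 1: "cat_map C T (inv_into S f)" .
  show "cat_map C S f"
    by (rule g(2))
  show "continuous_on S f" "continuous_on T (inv_into S f)"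
    using g(2) 1 by (auto dest: cat_map_imp_continuous_on)
qed

section \<open>The attaching map of one end\<close>

lemma cat_open_embedding_dependent:
  assumes "cat_open_embedding C (open_submfd (handle_mfd k) G) M F"
    and "openin (handle_space k) G" and "(V, d) \<in> matlas M"
  shows "cat_dependent C (G \<inter> F -` V) (handle_coord k) (d \<circ> F)"
    "cat_dependent C (G \<inter> F -` V) (d \<circ> F) (handle_coord k)"
proof -
  have G: "handle_carrier k \<inter> G = G" "G \<subseteq> handle_carrier k"
    using openin_imp_subset[OF assms(2)] by auto
  have inj: "inj_on (handle_coord k) G"
    using inj_on_handle_coord G(2) by (rule inj_on_subset)
  have "cat_iso C (handle_coord k ` (G \<inter> F -` V)) (d ` (F ` G \<inter> V)) (d \<circ> F \<circ> inv_into G (handle_coord k))"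
    using assms(1,3) unfolding cat_open_embedding_def
    by (auto simp: open_submfd_def restrict_atlas_def matlas_handle_mfd G)
  then show "cat_dependent C (G \<inter> F -` V) (handle_coord k) (d \<circ> F)"
    "cat_dependent C (G \<inter> F -` V) (d \<circ> F) (handle_coord k)"
    using cat_iso_chart_map_iff[OF inj] by blast+
qed

lemma cat_manifold_chart:
  assumes "cat_manifold C M" "(V, d) \<in> matlas M"
  shows "is_chart (mspace M) (V, d)" "coord_chart (mspace M) V d" "openin (mspace M) V" "inj_on d V"
proof -
  show 1: "is_chart (mspace M) (V, d)"
    using assms unfolding cat_manifold_def by blast
  then show 2: "coord_chart (mspace M) V d"
    by (simp add: is_chart_iff)
  then show "inj_on d V"
    by (rule coord_chart_inj_on)
  from 2 show "openin (mspace M) V"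
    unfolding coord_chart_def by blast
qed

lemma embedding_imp_continuous_map: "embedding_map X Y f \<Longrightarrow> continuous_map X Y f"
  unfolding embedding_map_def
  using continuous_map_in_subtopology homeomorphic_imp_continuous_map by blast

lemma embedding_imp_inj_on: "embedding_map X Y f \<Longrightarrow> inj_on f (topspace X)"
  unfolding embedding_map_def by (rule homeomorphic_imp_injective_map)

text \<open>One end of the handle, for either sign: \<open>J\<close> is the positive half-line with
  \<open>\<sigma>\<close> = \<open>\<rho>\<close> for \<phi>_+, and the negative half-line with
  \<open>\<sigma> t\<close> = \<open>\<rho> (- t)\<close> for \<phi>_-. The assumption
  \<open>diverges\<close> is the form in which the reversal of orientation by \<open>\<rho>\<close>
  is used: \<open>\<sigma>\<close> tends to infinity as t approaches 0 within
  \<open>J\<close>.\<close>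

locale tube_end =
  fixes C :: cat and k :: "'n::finite" and M :: "('p, 'n) mfd" and r :: "real \<Rightarrow> 'p"
    and \<nu> :: "'n handle_pt \<Rightarrow> 'p" and J :: "real set" and \<sigma> :: "real \<Rightarrow> real"
    and \<Lambda> :: "real ^ 'n \<Rightarrow> real ^ 'n"
  assumes M: "cat_manifold C M" and tube: "is_tubular_nbhd_map C k M r \<nu>"
    and J: "open J" and \<sigma>: "cat_iso C J {0<..} \<sigma>"
    and \<Lambda>: "cat_iso C (open_disk C k) (hyp k) \<Lambda>"
    and diverges: "\<And>s. s > 0 \<Longrightarrow> \<exists>\<epsilon>>0. \<forall>t\<in>J. \<bar>t\<bar> < \<epsilon> \<longrightarrow> s \<le> \<sigma> t"
begin

definition reparam :: "'n handle_pt \<Rightarrow> 'n handle_pt" where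
  "reparam = (\<lambda>(t, y). (\<sigma> t, inv_into (open_disk C k) \<Lambda> y))"

definition reparam_inv :: "'n handle_pt \<Rightarrow> 'n handle_pt" where
  "reparam_inv = (\<lambda>(s, z). (inv_into J \<sigma> s, \<Lambda> z))"

definition end_map :: "'n handle_pt \<Rightarrow> 'p" where
  "end_map = \<nu> \<circ> reparam"

abbreviation end_dom :: "'n handle_pt set" where
  "end_dom \<equiv> J \<times> hyp k"

abbreviation tube_dom :: "'n handle_pt set" where
  "tube_dom \<equiv> {0<..} \<times> open_disk C k"

lemma openin_end_dom: "openin (handle_space k) end_dom"
  unfolding handle_carrier_def using J by (intro openin_Times) auto

lemma openin_tube_dom: "openin (handle_space k) tube_dom"
  unfolding handle_carrier_def by (intro openin_Times openin_open_disk) auto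

lemma tube_dom_subset: "tube_dom \<subseteq> {0..} \<times> disk C k"
  using open_disk_subset by fastforce

lemma reparam_mem: "p \<in> end_dom \<Longrightarrow> reparam p \<in> tube_dom"
  using cat_isoE_inv_into(2)[OF \<sigma>] cat_isoE_inv_into(2)[OF \<Lambda>]
  by (auto simp: reparam_def inv_into_into)

lemma reparam_inv_mem: "q \<in> tube_dom \<Longrightarrow> reparam_inv q \<in> end_dom"
  using cat_isoE_inv_into(2)[OF \<sigma>] cat_isoE_inv_into(2)[OF \<Lambda>]
  by (auto simp: reparam_inv_def inv_into_into)

lemma reparam_inv_reparam: "p \<in> end_dom \<Longrightarrow> reparam_inv (reparam p) = p"
  using cat_isoE_inv_into(1,2)[OF \<sigma>] cat_isoE_inv_into(2)[OF \<Lambda>]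
  by (auto simp: reparam_def reparam_inv_def f_inv_into_f)

lemma reparam_reparam_inv: "q \<in> tube_dom \<Longrightarrow> reparam (reparam_inv q) = q"
  using cat_isoE_inv_into(2)[OF \<sigma>] cat_isoE_inv_into(1,2)[OF \<Lambda>]
  by (auto simp: reparam_def reparam_inv_def f_inv_into_f)

lemma reparam_image: "reparam ` end_dom = tube_dom"
proof
  show "reparam ` end_dom \<subseteq> tube_dom"
    using reparam_mem by blast
  show "tube_dom \<subseteq> reparam ` end_dom"
  proof
    fix q assume "q \<in> tube_dom"
    from reparam_inv_mem[OF this] reparam_reparam_inv[OF this] show "q \<in> reparam ` end_dom"
      by (rule image_eqI[rotated, OF _ sym])
  qed
qed

lemma continuous_on_reparam: "continuous_on end_dom reparam"
  unfolding reparam_def split_def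
  using cat_isoE_inv_into(5)[OF \<sigma>] cat_isoE_inv_into(6)[OF \<Lambda>]
  by (intro continuous_on_Pair continuous_on_compose2[OF _ continuous_on_fst]
      continuous_on_compose2[OF _ continuous_on_snd] continuous_on_id) auto

lemma continuous_on_reparam_inv: "continuous_on tube_dom reparam_inv"
  unfolding reparam_inv_def split_def
  using cat_isoE_inv_into(6)[OF \<sigma>] cat_isoE_inv_into(5)[OF \<Lambda>]
  by (intro continuous_on_Pair continuous_on_compose2[OF _ continuous_on_fst]
      continuous_on_compose2[OF _ continuous_on_snd] continuous_on_id) auto

text \<open>The image is a preimage under the continuous inverse \<open>reparam_inv\<close>, hence
  open in \<open>tube_dom\<close>, which is itself open in the handle.\<close>

lemma openin_reparam_image:
  assumes "openin (top_of_set end_dom) P"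
  shows "openin (handle_space k) (reparam ` P)"
proof -
  have P: "P \<subseteq> end_dom"
    using assms by (rule openin_imp_subset)
  have "openin (top_of_set tube_dom) (tube_dom \<inter> reparam_inv -` P)"
    using continuous_on_reparam_inv assms reparam_inv_mem
    by (intro continuous_openin_preimage[of _ _ end_dom]) auto
  moreover have "tube_dom \<inter> reparam_inv -` P = reparam ` P"
  proof
    show "tube_dom \<inter> reparam_inv -` P \<subseteq> reparam ` P"
    proof
      fix q assume q: "q \<in> tube_dom \<inter> reparam_inv -` P"
      then have "reparam (reparam_inv q) = q"
        by (intro reparam_reparam_inv) simp
      with q show "q \<in> reparam ` P"
        by (intro image_eqI[of _ _ "reparam_inv q"]) simp_all
    qed
    show "reparam ` P \<subseteq> tube_dom \<inter> reparam_inv -` P"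
    proof (rule image_subsetI)
      fix p assume p: "p \<in> P"
      with P have "p \<in> end_dom"
        by (rule subsetD)
      from reparam_mem[OF this] reparam_inv_reparam[OF this] p
      show "reparam p \<in> tube_dom \<inter> reparam_inv -` P"
        by simp
    qed
  qed
  ultimately have "openin (top_of_set tube_dom) (reparam ` P)"
    by simp
  from this openin_tube_dom show ?thesis
    by (rule openin_trans)
qed

lemma cat_dependent_reparam:
  "cat_dependent C end_dom (handle_coord k) (handle_coord k \<circ> reparam)"
  "cat_dependent C end_dom (handle_coord k \<circ> reparam) (handle_coord k)"
proof -
  have "cat_dependent C end_dom (handle_coord k)
      (\<lambda>(t, y). handle_coord k (\<sigma> t, inv_into (open_disk C k) \<Lambda> y))"
    using cat_isoE_inv_into(3)[OF \<sigma>] cat_isoE_inv_into(4)[OF \<Lambda>]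
    by (intro cat_dependent_handle_product J) auto
  moreover have "(\<lambda>(t, y). handle_coord k (\<sigma> t, inv_into (open_disk C k) \<Lambda> y)) = handle_coord k \<circ> reparam"
    by (auto simp: reparam_def)
  ultimately show "cat_dependent C end_dom (handle_coord k) (handle_coord k \<circ> reparam)"
    by simp
  \<comment> \<open>The converse dependence is the same computation for the inverse map on
    \<open>tube_dom\<close>, pulled back to \<open>end_dom\<close> along
    \<open>reparam\<close>.\<close>
  have "cat_dependent C tube_dom (handle_coord k) (\<lambda>(s, z). handle_coord k (inv_into J \<sigma> s, \<Lambda> z))"
    using cat_isoE_inv_into(4)[OF \<sigma>] cat_isoE_inv_into(3)[OF \<Lambda>]
    by (intro cat_dependent_handle_product openin_open_disk) auto
  moreover have "(\<lambda>(s, z). handle_coord k (inv_into J \<sigma> s, \<Lambda> z)) = handle_coord k \<circ> reparam_inv"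
    by (auto simp: reparam_inv_def)
  ultimately have "cat_dependent C (reparam ` end_dom) (handle_coord k) (handle_coord k \<circ> reparam_inv)"
    by (simp add: reparam_image)
  then have "cat_dependent C end_dom (handle_coord k \<circ> reparam) (handle_coord k \<circ> reparam_inv \<circ> reparam)"
    by (simp add: cat_dependent_image)
  moreover have "(handle_coord k \<circ> reparam_inv \<circ> reparam) p = handle_coord k p" if "p \<in> end_dom" for p
    using reparam_inv_reparam[OF that] by simp
  ultimately show "cat_dependent C end_dom (handle_coord k \<circ> reparam) (handle_coord k)"
    using cat_dependent_cong[of end_dom _ _ "handle_coord k \<circ> reparam_inv \<circ> reparam" "handle_coord k"]
    by blast
qed

lemma inj_on_tube: "inj_on \<nu> ({0..} \<times> disk C k)"
  using tube embedding_imp_inj_on unfolding is_tubular_nbhd_map_def by fastforce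

lemma inj_on_end_map: "inj_on end_map end_dom"
proof (rule inj_onI)
  fix p q assume p: "p \<in> end_dom" and q: "q \<in> end_dom" and eq: "end_map p = end_map q"
  have "reparam p = reparam q"
    using eq subsetD[OF tube_dom_subset reparam_mem[OF p]] subsetD[OF tube_dom_subset reparam_mem[OF q]]
    unfolding end_map_def comp_apply by (rule inj_onD[OF inj_on_tube])
  then have "reparam_inv (reparam p) = reparam_inv (reparam q)"
    by simp
  then show "p = q"
    by (simp only: reparam_inv_reparam p q)
qed

lemma end_map_image_subset: "end_map ` end_dom \<subseteq> \<nu> ` ({0..} \<times> disk C k)"
proof (rule image_subsetI)
  fix p assume "p \<in> end_dom"
  from subsetD[OF tube_dom_subset reparam_mem[OF this]]
  show "end_map p \<in> \<nu> ` ({0..} \<times> disk C k)"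
    by (simp add: end_map_def)
qed

lemma end_map_interior: "end_map ` end_dom \<subseteq> mfd_interior M"
  using end_map_image_subset tube unfolding is_tubular_nbhd_map_def by blast

lemma continuous_map_end_map: "continuous_map (top_of_set end_dom) (mspace M) end_map"
  unfolding end_map_def
proof (rule continuous_map_compose)
  show "continuous_map (top_of_set end_dom) (top_of_set ({0..} \<times> disk C k)) reparam"
  proof -
    have "reparam \<in> end_dom \<rightarrow> {0..} \<times> disk C k"
      using subsetD[OF tube_dom_subset reparam_mem] by (rule funcsetI)
    then show ?thesis
      using continuous_on_reparam by (simp add: continuous_map_in_subtopology image_subset_iff_funcset)
  qed
  show "continuous_map (top_of_set ({0..} \<times> disk C k)) (mspace M) \<nu>"
    using tube unfolding is_tubular_nbhd_map_def by (simp add: embedding_imp_continuous_map)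
qed

text \<open>Along the boundary of the closed tube, F and \<open>\<nu>\<close> need not agree on any
  neighbourhood. Intersecting with \<open>tube_dom\<close>, which is open in the handle, leaves an
  open set on which they do.\<close>

lemma tube_flat_chart:
  assumes "q \<in> tube_dom"
  obtains G F where "openin (handle_space k) G" "q \<in> G"
    "\<forall>x\<in>G \<inter> tube_dom. F x = \<nu> x" "open_map (top_of_set G) (mspace M) F"
    "cat_open_embedding C (open_submfd (handle_mfd k) G) M F"
proof -
  have "q \<in> {0..} \<times> disk C k"
    using subsetD[OF tube_dom_subset assms] .
  moreover have "locally_flat C k M ({0..} \<times> disk C k) \<nu>"
    using tube unfolding is_tubular_nbhd_map_def by blast
  ultimately have "\<exists>G F. openin (handle_space k) G \<and> q \<in> G \<and>
      cat_open_embedding C (open_submfd (handle_mfd k) G) M F \<and> F ` G \<subseteq> mfd_interior M \<and>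
      (\<forall>x\<in>G \<inter> ({0..} \<times> disk C k). F x = \<nu> x) \<and>
      F ` G \<inter> \<nu> ` ({0..} \<times> disk C k) = \<nu> ` (G \<inter> ({0..} \<times> disk C k))"
    unfolding locally_flat_def mspace_handle_mfd by (rule bspec[rotated])
  then obtain G F where G: "openin (handle_space k) G" "q \<in> G"
    "cat_open_embedding C (open_submfd (handle_mfd k) G) M F" "\<forall>x\<in>G \<inter> ({0..} \<times> disk C k). F x = \<nu> x"
    by (elim exE conjE)
  have "G \<subseteq> handle_carrier k"
    using G(1) by (rule openin_imp_subset)
  then have "open_map (top_of_set G) (mspace M) F"
    using G(3) by (simp add: cat_open_embedding_def open_submfd_def mspace_handle_mfd
        subtopology_subtopology inf.absorb2)
  moreover have "\<forall>x\<in>G \<inter> tube_dom. F x = \<nu> x"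
    using G(4) tube_dom_subset by blast
  ultimately show thesis
    using G(1-3) by (intro that[of G F])
qed

text \<open>Openness of the image is checked near each of its points: P lies over the interior of
  the tube, so \<open>\<nu>\<close> equals an open map F on the open set
  \<open>G \<inter> P\<close>.\<close>

lemma openin_tube_image:
  assumes "openin (handle_space k) P" "P \<subseteq> tube_dom"
  shows "openin (mspace M) (\<nu> ` P)"
proof (subst openin_subopen, rule ballI)
  fix x assume "x \<in> \<nu> ` P"
  then obtain q where q: "q \<in> P" "x = \<nu> q"
    by blast
  then have "q \<in> tube_dom"
    using assms(2) by blast
  from tube_flat_chart[OF this] obtain G F where
    G: "openin (handle_space k) G" "q \<in> G" "\<forall>x\<in>G \<inter> tube_dom. F x = \<nu> x"
      "open_map (top_of_set G) (mspace M) F" .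
  have "openin (handle_space k) (G \<inter> P)"
    using G(1) assms(1) by (rule openin_Int)
  then have "openin (top_of_set G) (G \<inter> P)"
    by (rule openin_subset_trans) (use openin_imp_subset[OF G(1)] in auto)
  then have "openin (mspace M) (F ` (G \<inter> P))"
    using G(4) by (simp add: open_map_def)
  moreover have "F ` (G \<inter> P) = \<nu> ` (G \<inter> P)"
    using G(3) assms(2) by (intro image_cong) auto
  ultimately show "\<exists>T. openin (mspace M) T \<and> x \<in> T \<and> T \<subseteq> \<nu> ` P"
    using q G(2) by (intro exI[of _ "\<nu> ` (G \<inter> P)"]) auto
qed

lemma open_map_end_map: "open_map (top_of_set end_dom) (mspace M) end_map"
  unfolding open_map_def
proof (intro allI impI)
  fix P assume P: "openin (top_of_set end_dom) P"
  have "reparam ` P \<subseteq> tube_dom"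
    using openin_imp_subset[OF P] reparam_mem by blast
  from openin_tube_image[OF openin_reparam_image[OF P] this]
  show "openin (mspace M) (end_map ` P)"
    by (simp add: end_map_def image_comp)
qed

text \<open>Near a point, \<open>end_map\<close> equals \<open>F \<circ> reparam\<close> for a CAT
  open embedding F that depends on the point. Both factors are CAT in both directions, so
  dependences compose near each point, and they are assembled by locality: in the handle coordinate
  for one direction, in the coordinate d for the other.\<close>

lemma cat_dependent_end_map:
  assumes Vd: "(V, d) \<in> matlas M"
  shows "cat_dependent C (end_dom \<inter> end_map -` V) (handle_coord k) (d \<circ> end_map)"
    "cat_dependent C (end_dom \<inter> end_map -` V) (d \<circ> end_map) (handle_coord k)"
proof -
  let ?E = "handle_space k" and ?X = "mspace M" and ?W = "end_dom \<inter> end_map -` V"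
  note d = cat_manifold_chart[OF M Vd]
  have WE: "?W \<subseteq> handle_carrier k"
    using openin_imp_subset[OF openin_end_dom] by blast
  have inj: "inj_on end_map ?W"
    using inj_on_end_map by (rule inj_on_subset) simp
  have inj_d: "inj_on (d \<circ> end_map) ?W"
    using inj by (rule comp_inj_on) (rule inj_on_subset[OF d(4)], auto)
  have loc: "\<exists>W'. p \<in> W' \<and> W' \<subseteq> ?W \<and> openin ?E W' \<and> openin ?X (end_map ` W') \<and>
      cat_related C W' (handle_coord k) (d \<circ> end_map)" if p: "p \<in> ?W" for p
  proof -
    have "reparam p \<in> tube_dom"
      using p reparam_mem by blast
    from tube_flat_chart[OF this] obtain G F where
      G: "openin ?E G" "reparam p \<in> G" "\<forall>x\<in>G \<inter> tube_dom. F x = \<nu> x"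
        "open_map (top_of_set G) ?X F" "cat_open_embedding C (open_submfd (handle_mfd k) G) M F" .
    \<comment> \<open>Small enough that \<open>reparam\<close> lands where F is known to agree with
      \<open>\<nu>\<close>, and that \<open>end_map\<close> lands in the chart V.\<close>
    let ?W' = "end_dom \<inter> reparam -` G \<inter> (end_dom \<inter> end_map -` V)"
    have "openin (top_of_set end_dom) (end_dom \<inter> reparam -` G)"
      using continuous_on_reparam _ G(1)
    proof (rule continuous_openin_preimage)
      show "reparam \<in> end_dom \<rightarrow> handle_carrier k"
        using reparam_mem openin_imp_subset[OF openin_tube_dom] by blast
    qed
    moreover have "openin (top_of_set end_dom) {p \<in> topspace (top_of_set end_dom). end_map p \<in> V}"
      using continuous_map_end_map d(3) by (rule openin_continuous_map_preimage)
    moreover have "{p \<in> topspace (top_of_set end_dom). end_map p \<in> V} = ?W"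
      by auto
    ultimately have W'D: "openin (top_of_set end_dom) ?W'"
      by (simp add: openin_Int)
    then have W'E: "openin ?E ?W'"
      using openin_end_dom by (rule openin_trans)
    have rW': "openin ?E (reparam ` ?W')"
      using W'D by (rule openin_reparam_image)
    have W'X: "openin ?X (end_map ` ?W')"
      using open_map_end_map W'D unfolding open_map_def by blast
    have Fr: "F (reparam p) = end_map p" if "p \<in> ?W'" for p
    proof -
      have "reparam p \<in> G \<inter> tube_dom"
        using that reparam_mem by blast
      with G(3) show ?thesis
        by (simp add: end_map_def)
    qed
    have sub: "reparam ` ?W' \<subseteq> G \<inter> F -` V"
    proof (rule image_subsetI)
      fix p assume p: "p \<in> ?W'"
      from p Fr[OF p] show "reparam p \<in> G \<inter> F -` V"
        by auto
    qed
    have FX: "F ` reparam ` ?W' = end_map ` ?W'"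
      unfolding image_image by (rule image_cong[OF refl Fr])
    note dep = cat_open_embedding_dependent[OF G(5,1) Vd]
    have "cat_dependent C (reparam ` ?W') (handle_coord k) (d \<circ> F)"
      by (rule cat_dependent_coord_subset[OF coord_chart_handle dep(1) rW' sub])
        (use openin_imp_subset[OF G(1)] in blast)
    then have 1: "cat_dependent C ?W' (handle_coord k \<circ> reparam) (d \<circ> F \<circ> reparam)"
      by (simp only: cat_dependent_image)
    \<comment> \<open>The source coordinate is now \<open>d \<circ> F\<close>, so restricting to a
      smaller set requires openness as seen through d. It comes from \<open>end_map\<close> being an
      open map into M.\<close>
    have "cat_dependent C (reparam ` ?W') (d \<circ> F) (handle_coord k)"
    proof (rule cat_dependent_subset[OF dep(2) sub])
      have FG: "(d \<circ> F) ` (G \<inter> F -` V) = d ` (F ` G \<inter> V)"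
        by auto
      have "end_map ` ?W' \<subseteq> F ` G \<inter> V"
        using sub unfolding FX[symmetric] by blast
      moreover have "(d \<circ> F) ` reparam ` ?W' = d ` end_map ` ?W'"
        unfolding FX[symmetric] by (simp only: image_comp comp_assoc)
      ultimately show "openin (top_of_set ((d \<circ> F) ` (G \<inter> F -` V))) ((d \<circ> F) ` reparam ` ?W')"
        unfolding FG using coord_chart_openin_image[OF d(2) W'X] by simp
    qed
    then have 2: "cat_dependent C ?W' (d \<circ> F \<circ> reparam) (handle_coord k \<circ> reparam)"
      by (simp only: cat_dependent_image)
    have DE: "end_dom \<subseteq> handle_carrier k"
      using openin_end_dom by (rule openin_imp_subset)
    have 3: "cat_dependent C ?W' (handle_coord k) (handle_coord k \<circ> reparam)"
      by (rule cat_dependent_coord_subset[OF coord_chart_handle cat_dependent_reparam(1) W'E _ DE]) blast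
    have 4: "cat_dependent C ?W' (handle_coord k \<circ> reparam) (handle_coord k)"
    proof (rule cat_dependent_subset[OF cat_dependent_reparam(2)])
      have "openin (top_of_set (handle_coord k ` tube_dom)) (handle_coord k ` reparam ` ?W')"
        by (rule coord_chart_openin_image[OF coord_chart_handle rW'])
          (use reparam_mem openin_imp_subset[OF openin_tube_dom] in blast)+
      then show "openin (top_of_set ((handle_coord k \<circ> reparam) ` end_dom)) ((handle_coord k \<circ> reparam) ` ?W')"
        by (simp only: image_comp[symmetric] reparam_image)
    qed blast
    have eq: "(d \<circ> F \<circ> reparam) p = (d \<circ> end_map) p" if "p \<in> ?W'" for p
      using Fr[OF that] by simp
    have "cat_dependent C ?W' (handle_coord k) (d \<circ> F \<circ> reparam) \<longleftrightarrow>
        cat_dependent C ?W' (handle_coord k) (d \<circ> end_map)"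
      by (rule cat_dependent_cong[OF refl]) (rule eq)
    from iffD1[OF this cat_dependent_trans[OF 3 1]]
    have "cat_dependent C ?W' (handle_coord k) (d \<circ> end_map)" .
    moreover have "cat_dependent C ?W' (d \<circ> F \<circ> reparam) (handle_coord k) \<longleftrightarrow>
        cat_dependent C ?W' (d \<circ> end_map) (handle_coord k)"
      by (rule cat_dependent_cong[OF _ refl]) (rule eq)
    from iffD1[OF this cat_dependent_trans[OF 2 4]]
    have "cat_dependent C ?W' (d \<circ> end_map) (handle_coord k)" .
    moreover have "p \<in> ?W'"
      using p G(2) by blast
    moreover have "?W' \<subseteq> ?W"
      by blast
    ultimately show ?thesis
      using W'E W'X by (intro exI[of _ ?W'] conjI)
  qed
  show "cat_dependent C ?W (handle_coord k) (d \<circ> end_map)"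
  proof (rule cat_dependent_coord_locally[OF coord_chart_handle WE])
    fix p assume "p \<in> ?W"
    from loc[OF this] show "\<exists>W'. p \<in> W' \<and> openin ?E W' \<and> W' \<subseteq> ?W \<and>
        cat_dependent C W' (handle_coord k) (d \<circ> end_map)"
      by blast
  qed
  show "cat_dependent C ?W (d \<circ> end_map) (handle_coord k)"
  \<comment> \<open>The pieces must be open in the coordinate \<open>d \<circ> end_map\<close>,
    which is why \<open>loc\<close> records that their images in M are open.\<close>
  proof (rule cat_dependent_locally[OF inj_d])
    fix p assume "p \<in> ?W"
    from loc[OF this] obtain W' where W': "p \<in> W'" "W' \<subseteq> ?W" "openin ?X (end_map ` W')"
        "cat_dependent C W' (d \<circ> end_map) (handle_coord k)"
      by blast
    have "end_map ` W' \<subseteq> end_map ` ?W" "end_map ` ?W \<subseteq> V"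
      using W'(2) by blast+
    from coord_chart_openin_image[OF d(2) W'(3) this]
    have "openin (top_of_set ((d \<circ> end_map) ` ?W)) ((d \<circ> end_map) ` W')"
      unfolding image_comp[symmetric] .
    with W' show "\<exists>W'. p \<in> W' \<and> W' \<subseteq> ?W \<and> openin (top_of_set ((d \<circ> end_map) ` ?W)) ((d \<circ> end_map) ` W') \<and>
        cat_dependent C W' (d \<circ> end_map) (handle_coord k)"
      by (intro exI[of _ W'] conjI)
  qed
qed

text \<open>By injectivity of \<open>\<nu>\<close>, the point x lies at one depth of the tube at
  most, so some tail of the tube avoids it, and the complement of the closed image of that tail is a
  neighbourhood of x. By \<open>diverges\<close>, all points of the end with small |t| go into the
  tail, uniformly in y, since the depth depends on t alone.\<close>

lemma end_map_separation:
  assumes x: "x \<in> topspace (mspace M)"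
  obtains \<epsilon> P where "\<epsilon> > 0" "openin (mspace M) P" "x \<in> P"
    "\<And>t y. (t, y) \<in> end_dom \<Longrightarrow> \<bar>t\<bar> < \<epsilon> \<Longrightarrow> end_map (t, y) \<notin> P"
proof -
  let ?A = "{0..} \<times> disk C k"
  obtain s where s: "s > 0" "x \<notin> \<nu> ` ({s..} \<times> disk C k)"
  proof (cases "x \<in> \<nu> ` ?A")
    case True
    then obtain a z where az: "x = \<nu> (a, z)" "(a, z) \<in> ?A"
      by auto
    \<comment> \<open>Any bound above the depth a of x would serve.\<close>
    have "x \<notin> \<nu> ` ({a + 1..} \<times> disk C k)"
    proof
      assume "x \<in> \<nu> ` ({a + 1..} \<times> disk C k)"
      then obtain b w where bw: "\<nu> (a, z) = \<nu> (b, w)" "a + 1 \<le> b" "w \<in> disk C k"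
        using az by auto
      have "(a, z) = (b, w)"
        using az(2) bw(2,3) by (intro inj_onD[OF inj_on_tube bw(1)]) auto
      with bw(2) show False
        by simp
    qed
    with az(2) show thesis
      by (intro that[of "a + 1"]) auto
  next
    case False
    then show thesis
      by (intro that[of 1]) auto
  qed
  from diverges[OF s(1)] obtain \<epsilon> where \<epsilon>: "\<epsilon> > 0" "\<forall>t\<in>J. \<bar>t\<bar> < \<epsilon> \<longrightarrow> s \<le> \<sigma> t"
    by blast
  have "closedin (top_of_set ?A) (?A \<inter> ({s..} \<times> UNIV))"
    by (intro closedin_closed_Int closed_Times) auto
  moreover have "?A \<inter> ({s..} \<times> UNIV) = {s..} \<times> disk C k"
    using s(1) by auto
  ultimately have "closedin (mspace M) (\<nu> ` ({s..} \<times> disk C k))"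
    using tube unfolding is_tubular_nbhd_map_def proper_map_def closed_map_def by metis
  then have "openin (mspace M) (topspace (mspace M) - \<nu> ` ({s..} \<times> disk C k))"
    by blast
  moreover have "end_map (t, y) \<notin> topspace (mspace M) - \<nu> ` ({s..} \<times> disk C k)"
    if ty: "(t, y) \<in> end_dom" "\<bar>t\<bar> < \<epsilon>" for t y
  proof -
    have "s \<le> fst (reparam (t, y))"
      using \<epsilon>(2) ty by (simp add: reparam_def)
    moreover have "snd (reparam (t, y)) \<in> disk C k"
      using subsetD[OF tube_dom_subset reparam_mem[OF ty(1)]] by auto
    ultimately have "reparam (t, y) \<in> {s..} \<times> disk C k"
      by (simp add: mem_Times_iff)
    then show ?thesis
      by (simp add: end_map_def)
  qed
  ultimately show thesis
    using \<epsilon>(1) s(2) x by (intro that[of \<epsilon> "topspace (mspace M) - \<nu> ` ({s..} \<times> disk C k)"]) auto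
qed

end

section \<open>Paracompactness and quotient topologies\<close>

text \<open>The closed thickening of A is the sum of A and a closed ball, hence compact. Half the
  radius e keeps it inside T.\<close>

lemma compact_neighbourhood:
  fixes A :: "'a::euclidean_space set"
  assumes "compact A" "open T" "A \<subseteq> T"
  obtains V Z where "open V" "compact Z" "A \<subseteq> V" "V \<subseteq> Z" "Z \<subseteq> T"
proof -
  obtain e where e: "e > 0" "(\<Union>x\<in>A. ball x e) \<subseteq> T"
    using compact_subset_open_imp_ball_epsilon_subset[OF assms] by blast
  let ?V = "\<Union>x\<in>A. ball x (e/2)" and ?Z = "{x + y | x y. x \<in> A \<and> y \<in> cball 0 (e/2)}"
  have "compact ?Z"
    using assms(1) by (intro compact_sums) auto
  moreover have "A \<subseteq> ?V"
    using e(1) by force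
  moreover have "?V \<subseteq> ?Z"
  proof
    fix z assume "z \<in> ?V"
    then obtain x where "x \<in> A" "dist x z < e/2"
      by auto
    then show "z \<in> ?Z"
      by (intro CollectI exI[of _ x] exI[of _ "z - x"]) (auto simp: dist_norm norm_minus_commute)
  qed
  moreover have "?Z \<subseteq> T"
  proof
    fix z assume "z \<in> ?Z"
    then obtain x y where xy: "z = x + y" "x \<in> A" "norm y \<le> e/2"
      by auto
    then have "z \<in> ball x e"
      using e(1) by (simp add: dist_norm)
    with xy(2) e(2) show "z \<in> T"
      by blast
  qed
  ultimately show thesis
    by (intro that[of ?V ?Z]) auto
qed

text \<open>
  Near the complement of the paracompact open set \<open>i ` topspace X\<close>, a refinement is assembled from
  finitely many pieces over each \<open>K m\<close>; away from the closed set \<open>\<Union>m. Z m\<close>, which these pieces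
  cover, a locally finite refinement taken in \<open>X\<close> stays locally finite in \<open>N\<close>.
\<close>

lemma paracompact_space_extend:
  fixes K Q :: "nat \<Rightarrow> 'b set"
  assumes X: "paracompact_space X"
    and i: "continuous_map X N i" "open_map X N i" "inj_on i (topspace X)"
    and cover: "topspace N \<subseteq> i ` topspace X \<union> (\<Union>m. K m)"
    and K: "\<And>m. compactin N (K m)" and Q: "\<And>m. openin N (Q m)" "\<And>m. K m \<subseteq> Q m"
    and fin: "\<And>x. x \<in> topspace N \<Longrightarrow> \<exists>V. openin N V \<and> x \<in> V \<and> finite {m. Q m \<inter> V \<noteq> {}}"
    and nbd: "\<And>m W. openin N W \<Longrightarrow> K m \<subseteq> W \<Longrightarrow>
      \<exists>V Z. openin N V \<and> closedin N Z \<and> K m \<subseteq> V \<and> V \<subseteq> Z \<and> Z \<subseteq> W"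
  shows "paracompact_space N"
  unfolding paracompact_space_def
proof (intro allI impI)
  fix \<U> assume \<U>: "(\<forall>U\<in>\<U>. openin N U) \<and> \<Union>\<U> = topspace N"
  have "\<exists>\<F>. finite \<F> \<and> \<F> \<subseteq> \<U> \<and> K m \<subseteq> \<Union>\<F>" for m
  proof -
    have "K m \<subseteq> \<Union>\<U>"
      using compactin_subset_topspace[OF K] \<U> by blast
    with \<U> show ?thesis
      by (intro mp[OF spec[OF conjunct2[OF K[of m, unfolded compactin_def]]]]) simp
  qed
  then obtain \<F> where \<F>: "\<And>m. finite (\<F> m)" "\<And>m. \<F> m \<subseteq> \<U>" "\<And>m. K m \<subseteq> \<Union>(\<F> m)"
    by metis
  \<comment> \<open>Finitely many members of the cover suffice over \<open>K m\<close>. Cutting them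
    with \<open>Q m\<close> makes the union of all these finite families locally finite, as the
    \<open>Q m\<close> are.\<close>
  define \<W> where "\<W> m = (\<lambda>U. U \<inter> Q m) ` \<F> m" for m
  have \<W>_open: "openin N W" if "W \<in> \<W> m" for W m
    using that \<U> \<F>(2) Q(1) unfolding \<W>_def by (auto intro!: openin_Int)
  have \<W>_sub: "W \<subseteq> Q m" if "W \<in> \<W> m" for W m
    using that unfolding \<W>_def by auto
  have "\<exists>V Z. openin N V \<and> closedin N Z \<and> K m \<subseteq> V \<and> V \<subseteq> Z \<and> Z \<subseteq> \<Union>(\<W> m)" for m
  proof (rule nbd)
    show "openin N (\<Union>(\<W> m))"
      using \<W>_open by (rule openin_Union)
    show "K m \<subseteq> \<Union>(\<W> m)"
      using \<F>(3)[of m] Q(2)[of m] unfolding \<W>_def by auto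
  qed
  then obtain V Z where VZ: "\<And>m. openin N (V m)" "\<And>m. closedin N (Z m)" "\<And>m. K m \<subseteq> V m"
      "\<And>m. V m \<subseteq> Z m" "\<And>m. Z m \<subseteq> \<Union>(\<W> m)"
    by metis
  have ZQ: "Z m \<subseteq> Q m" for m
    using VZ(5)[of m] \<W>_sub by blast
  \<comment> \<open>Since \<open>Z m\<close> lies in \<open>Q m\<close>, the sets \<open>Z m\<close>
    are a locally finite family of closed sets, so their union is closed.\<close>
  define Z' where "Z' = (\<Union>m. Z m)"
  have closed: "closedin N Z'"
    unfolding Z'_def
  proof (rule closedin_locally_finite_Union)
    show "closedin N S" if "S \<in> range Z" for S
      using that VZ(2) by blast
    show "locally_finite_in N (range Z)"
      unfolding locally_finite_in_def
    proof (intro conjI ballI)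
      show "\<Union>(range Z) \<subseteq> topspace N"
        using VZ(2) closedin_subset by blast
      fix x assume "x \<in> topspace N"
      then obtain B where B: "openin N B" "x \<in> B" "finite {m. Q m \<inter> B \<noteq> {}}"
        using fin by blast
      have "{U \<in> range Z. U \<inter> B \<noteq> {}} \<subseteq> Z ` {m. Q m \<inter> B \<noteq> {}}"
        using ZQ by blast
      from finite_subset[OF this finite_imageI[OF B(3)]] B(1,2)
      show "\<exists>V. openin N V \<and> x \<in> V \<and> finite {U \<in> range Z. U \<inter> V \<noteq> {}}"
        by blast
    qed
  qed
  let ?pull = "\<lambda>U. {x \<in> topspace X. i x \<in> U}"
  have "\<forall>U\<in>?pull ` \<U>. openin X U"
    using \<U> by (auto intro: openin_continuous_map_preimage[OF i(1)])
  moreover have "\<Union>(?pull ` \<U>) = topspace X"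
  proof
    show "topspace X \<subseteq> \<Union>(?pull ` \<U>)"
    proof
      fix x assume x: "x \<in> topspace X"
      then have "i x \<in> topspace N"
        using continuous_map_image_subset_topspace[OF i(1)] by blast
      then obtain U where "U \<in> \<U>" "i x \<in> U"
        using \<U> by auto
      with x show "x \<in> \<Union>(?pull ` \<U>)"
        by auto
    qed
  qed auto
  ultimately have "\<exists>\<V>. (\<forall>V\<in>\<V>. openin X V \<and> (\<exists>U\<in>?pull ` \<U>. V \<subseteq> U)) \<and>
      \<Union>\<V> = topspace X \<and> locally_finite_in X \<V>"
    by (intro mp[OF spec[OF X[unfolded paracompact_space_def]]] conjI)
  then obtain \<V> where \<V>: "\<forall>V\<in>\<V>. openin X V \<and> (\<exists>U\<in>?pull ` \<U>. V \<subseteq> U)"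
      "\<Union>\<V> = topspace X" "locally_finite_in X \<V>"
    by (elim exE conjE)
  \<comment> \<open>Removing Z' uncovers nothing, because the sets in \<open>\<W> m\<close> cover
    \<open>Z m\<close>. It keeps the new sets away from the neighbourhood \<open>V m\<close> of
    \<open>K m\<close>; outside the image of i, local finiteness of \<open>\<V>\<close> in X gives
    no control.\<close>
  define \<V>' where "\<V>' = (\<lambda>V. i ` V - Z') ` \<V>"
  let ?R = "(\<Union>m. \<W> m) \<union> \<V>'"
  have "\<forall>V\<in>?R. openin N V \<and> (\<exists>U\<in>\<U>. V \<subseteq> U)"
  proof (rule ballI)
    fix A assume "A \<in> ?R"
    then consider m where "A \<in> \<W> m" | V where "V \<in> \<V>" "A = i ` V - Z'"
      unfolding \<V>'_def by blast
    then show "openin N A \<and> (\<exists>U\<in>\<U>. A \<subseteq> U)"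
    proof cases
      case 1
      then show ?thesis
        using \<W>_open[OF 1] \<F>(2)[of m] unfolding \<W>_def by auto
    next
      case 2
      then have "openin X V" "\<exists>U\<in>\<U>. V \<subseteq> ?pull U"
        using \<V>(1) by auto
      then have "openin N (i ` V)" "\<exists>U\<in>\<U>. i ` V \<subseteq> U"
        using i(2) unfolding open_map_def by blast+
      then show ?thesis
        using closed unfolding 2(2) by (auto intro: openin_diff)
    qed
  qed
  note refines = this
  have union: "\<Union>?R = topspace N"
  proof
    show "\<Union>?R \<subseteq> topspace N"
      using refines by (intro Union_least openin_subset) blast
    show "topspace N \<subseteq> \<Union>?R"
    proof
      fix x assume x: "x \<in> topspace N"
      show "x \<in> \<Union>?R"
      proof (cases "x \<in> Z'")
        case True
        then show ?thesis
          using VZ(5) unfolding Z'_def by blast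
      next
        case False
        then have "x \<notin> (\<Union>m. K m)"
          using VZ(3,4) unfolding Z'_def by blast
        then have "x \<in> i ` \<Union>\<V>"
          using x cover unfolding \<V>(2) by blast
        then show ?thesis
          using False unfolding \<V>'_def by blast
      qed
    qed
  qed
  have "locally_finite_in N ?R"
    unfolding locally_finite_in_def
  proof (intro conjI ballI)
    show "\<Union>?R \<subseteq> topspace N"
      unfolding union ..
    fix x assume x: "x \<in> topspace N"
    then obtain B where B: "openin N B" "x \<in> B" "finite {m. Q m \<inter> B \<noteq> {}}"
      using fin by blast
    have "{W \<in> (\<Union>m. \<W> m). W \<inter> B \<noteq> {}} \<subseteq> (\<Union>m\<in>{m. Q m \<inter> B \<noteq> {}}. \<W> m)"
      using \<W>_sub by blast
    moreover have "finite (\<Union>m\<in>{m. Q m \<inter> B \<noteq> {}}. \<W> m)"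
      using B(3) \<F>(1) unfolding \<W>_def by blast
    ultimately have fin\<W>: "finite {W \<in> (\<Union>m. \<W> m). W \<inter> B \<noteq> {}}"
      by (rule finite_subset)
    obtain A where A: "openin N A" "x \<in> A" "finite {V \<in> \<V>'. V \<inter> A \<noteq> {}}"
    proof (cases "x \<in> i ` topspace X")
      case True
      then obtain x' where x': "x' \<in> topspace X" "x = i x'"
        by blast
      then obtain A' where A': "openin X A'" "x' \<in> A'" "finite {V \<in> \<V>. V \<inter> A' \<noteq> {}}"
        using \<V>(3) unfolding locally_finite_in_def by blast
      have "{V \<in> \<V>'. V \<inter> i ` A' \<noteq> {}} \<subseteq> (\<lambda>V. i ` V - Z') ` {V \<in> \<V>. V \<inter> A' \<noteq> {}}"
      proof
        fix S assume "S \<in> {V \<in> \<V>'. V \<inter> i ` A' \<noteq> {}}"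
        then obtain V where V: "V \<in> \<V>" "S = i ` V - Z'" "S \<inter> i ` A' \<noteq> {}"
          unfolding \<V>'_def by blast
        from V(3) obtain z where "z \<in> S" "z \<in> i ` A'"
          by blast
        then obtain a b where "a \<in> V" "b \<in> A'" "i a = i b"
          unfolding V(2) by (elim DiffE imageE) simp
        note ab = V(1,2) this
        then have "a \<in> topspace X" "b \<in> topspace X"
          using \<V>(2) openin_subset[OF A'(1)] by blast+
        then have "a = b"
          using i(3) ab(5) by (simp add: inj_on_eq_iff)
        then show "S \<in> (\<lambda>V. i ` V - Z') ` {V \<in> \<V>. V \<inter> A' \<noteq> {}}"
          using ab(1-4) by blast
      qed
      then have "finite {V \<in> \<V>'. V \<inter> i ` A' \<noteq> {}}"
        using A'(3) by (meson finite_imageI finite_subset)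
      then show thesis
        using A'(1,2) i(2) x'(2) unfolding open_map_def by (intro that[of "i ` A'"]) auto
    next
      case False
      then obtain m where "x \<in> K m"
        using x cover by blast
      then have "x \<in> V m"
        using VZ(3) by blast
      moreover have "{S \<in> \<V>'. S \<inter> V m \<noteq> {}} = {}"
        using VZ(4) unfolding \<V>'_def Z'_def by blast
      then have "finite {S \<in> \<V>'. S \<inter> V m \<noteq> {}}"
        by (rule ssubst) simp
      ultimately show thesis
        using VZ(1) by (intro that[of "V m"])
    qed
    have "{V \<in> ?R. V \<inter> (A \<inter> B) \<noteq> {}} \<subseteq>
        {W \<in> (\<Union>m. \<W> m). W \<inter> B \<noteq> {}} \<union> {V \<in> \<V>'. V \<inter> A \<noteq> {}}"
      by blast
    then have "finite {V \<in> ?R. V \<inter> (A \<inter> B) \<noteq> {}}"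
      using fin\<W> A(3) by (meson finite_UnI finite_subset)
    then show "\<exists>V. openin N V \<and> x \<in> V \<and> finite {U \<in> ?R. U \<inter> V \<noteq> {}}"
      using A B by (intro exI[of _ "A \<inter> B"]) (simp add: openin_Int)
  qed
  with refines union show "\<exists>\<V>. (\<forall>V\<in>\<V>. openin N V \<and> (\<exists>U\<in>\<U>. V \<subseteq> U)) \<and> \<Union>\<V> = topspace N \<and>
      locally_finite_in N \<V>"
    by (intro exI[of _ ?R] conjI)
qed

section \<open>Disjoint sums and quotients\<close>

lemma openin_disjoint_sum_topology:
  "openin (disjoint_sum_topology X Y) W \<longleftrightarrow> openin X (Inl -` W) \<and> openin Y (Inr -` W)"
proof -
  have "istopology (\<lambda>W. openin X (Inl -` W) \<and> openin Y (Inr -` W))"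
    unfolding istopology_def by (auto simp: vimage_Union)
  then show ?thesis
    unfolding disjoint_sum_topology_def by simp
qed

lemma topspace_disjoint_sum_topology:
  "topspace (disjoint_sum_topology X Y) = Inl ` topspace X \<union> Inr ` topspace Y"
proof
  show "topspace (disjoint_sum_topology X Y) \<subseteq> Inl ` topspace X \<union> Inr ` topspace Y"
  proof
    fix z assume "z \<in> topspace (disjoint_sum_topology X Y)"
    then obtain W where W: "openin X (Inl -` W)" "openin Y (Inr -` W)" "z \<in> W"
      unfolding topspace_def openin_disjoint_sum_topology by blast
    show "z \<in> Inl ` topspace X \<union> Inr ` topspace Y"
      using W(3) openin_subset[OF W(1)] openin_subset[OF W(2)] by (cases z) auto
  qed
  have "Inl -` (Inl ` topspace X \<union> Inr ` topspace Y) = topspace X"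
    "Inr -` (Inl ` topspace X \<union> Inr ` topspace Y) = topspace Y"
    by auto
  then have "openin (disjoint_sum_topology X Y) (Inl ` topspace X \<union> Inr ` topspace Y)"
    by (simp add: openin_disjoint_sum_topology)
  then show "Inl ` topspace X \<union> Inr ` topspace Y \<subseteq> topspace (disjoint_sum_topology X Y)"
    by (rule openin_subset)
qed

lemma openin_quotient_topology:
  "openin (quotient_topology X R) W \<longleftrightarrow>
     W \<subseteq> eq_class R ` topspace X \<and> openin X {x \<in> topspace X. eq_class R x \<in> W}"
proof -
  let ?L = "\<lambda>W. W \<subseteq> eq_class R ` topspace X \<and> openin X {x \<in> topspace X. eq_class R x \<in> W}"
  have "istopology ?L"
    unfolding istopology_def
  proof (intro conjI allI impI)
    fix S T assume ST: "?L S" "?L T"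
    have "{x \<in> topspace X. eq_class R x \<in> S \<inter> T} =
        {x \<in> topspace X. eq_class R x \<in> S} \<inter> {x \<in> topspace X. eq_class R x \<in> T}"
      by blast
    with ST show "openin X {x \<in> topspace X. eq_class R x \<in> S \<inter> T}"
      by (simp add: openin_Int)
    show "S \<inter> T \<subseteq> eq_class R ` topspace X"
      using ST by blast
  next
    fix \<K> assume K: "\<forall>K\<in>\<K>. ?L K"
    have "{x \<in> topspace X. eq_class R x \<in> \<Union>\<K>} = \<Union>((\<lambda>K. {x \<in> topspace X. eq_class R x \<in> K}) ` \<K>)"
      by blast
    with K show "openin X {x \<in> topspace X. eq_class R x \<in> \<Union>\<K>}"
      by auto
    show "\<Union>\<K> \<subseteq> eq_class R ` topspace X"
      using K by blast
  qed
  then show ?thesis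
    unfolding quotient_topology_def by simp
qed

section \<open>The topology of the quotient\<close>

definition handle_ends :: "'n::finite \<Rightarrow> 'n handle_pt set" where
  "handle_ends k = handle_pos k \<union> handle_neg k"

text \<open>The two attaching maps as one map on E minus E_0, so that N is a gluing of two spaces
  along a single open embedding.\<close>

definition handle_glue :: "('n handle_pt \<Rightarrow> 'p) \<Rightarrow> ('n handle_pt \<Rightarrow> 'p) \<Rightarrow> 'n handle_pt \<Rightarrow> 'p" where
  "handle_glue \<phi>p \<phi>n = (\<lambda>x. if 0 < fst x then \<phi>p x else \<phi>n x)"

lemma handle_ends_eq: "handle_ends k = {p \<in> handle_carrier k. fst p \<noteq> 0}"
  by (auto simp: handle_ends_def handle_pos_def handle_neg_def handle_carrier_def)

lemma openin_handle_pos: "openin (handle_space k) (handle_pos k)"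
  unfolding handle_carrier_def handle_pos_def by (intro openin_Times) auto

lemma openin_handle_neg: "openin (handle_space k) (handle_neg k)"
  unfolding handle_carrier_def handle_neg_def by (intro openin_Times) auto

lemma openin_handle_ends: "openin (handle_space k) (handle_ends k)"
  unfolding handle_ends_def using openin_handle_pos openin_handle_neg by (rule openin_Un)

text \<open>Points of one piece of N are separated inside that piece; open injections carry disjoint
  open sets to disjoint open sets.\<close>

lemma Hausdorff_image:
  assumes "Hausdorff_space Y" "open_map Y Z f" "inj_on f (topspace Y)"
    and "x \<in> topspace Y" "y \<in> topspace Y" "f x \<noteq> f y"
  shows "\<exists>U V. openin Z U \<and> openin Z V \<and> f x \<in> U \<and> f y \<in> V \<and> disjnt U V"
proof -
  obtain U V where UV: "openin Y U" "openin Y V" "x \<in> U" "y \<in> V" "disjnt U V"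
    using assms(1,4-6) unfolding Hausdorff_space_def by metis
  have "f ` U \<inter> f ` V = {}"
    using UV(5) inj_on_image_Int[OF assms(3) openin_subset[OF UV(1)] openin_subset[OF UV(2)]]
    by (simp add: disjnt_def)
  then show ?thesis
    using UV assms(2) unfolding open_map_def disjnt_def by (intro exI[of _ "f ` U"] exI[of _ "f ` V"]) auto
qed

lemma finite_nat_real_le: "finite {m::nat. real m \<le> a}"
proof -
  obtain n where "a \<le> real n"
    using real_arch_simple by blast
  then have "{m::nat. real m \<le> a} \<subseteq> {..n}"
    by auto
  then show ?thesis
    by (rule finite_subset) simp
qed

text \<open>The tubes are forgotten: what remains is one open embedding of
  \<open>handle_ends k\<close> into M that is CAT in both directions. In
  \<open>glue_separation\<close>, convergence to infinity is expressed at each point x by a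
  neighbourhood that the points of the ends with small |t| miss.\<close>

locale handle_gluing =
  fixes C :: cat and k :: "'n::finite" and M :: "('p, 'n) mfd"
    and \<phi>p \<phi>n :: "'n handle_pt \<Rightarrow> 'p"
  assumes M: "cat_manifold C M"
    and inj_glue: "inj_on (handle_glue \<phi>p \<phi>n) (handle_ends k)"
    and continuous_glue: "continuous_map (top_of_set (handle_ends k)) (mspace M) (handle_glue \<phi>p \<phi>n)"
    and open_glue: "open_map (top_of_set (handle_ends k)) (mspace M) (handle_glue \<phi>p \<phi>n)"
    and glue_interior: "handle_glue \<phi>p \<phi>n ` handle_ends k \<subseteq> mfd_interior M"
    and glue_separation: "x \<in> topspace (mspace M) \<Longrightarrow> \<exists>\<epsilon> P. 0 < \<epsilon> \<and> openin (mspace M) P \<and> x \<in> P \<and>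
      (\<forall>p\<in>handle_ends k. \<bar>fst p\<bar> < \<epsilon> \<longrightarrow> handle_glue \<phi>p \<phi>n p \<notin> P)"
    and cat_dependent_glue: "(V, d) \<in> matlas M \<Longrightarrow>
      cat_related C (handle_ends k \<inter> handle_glue \<phi>p \<phi>n -` V) (handle_coord k) (d \<circ> handle_glue \<phi>p \<phi>n)"
begin

abbreviation "X \<equiv> mspace M"
abbreviation "E \<equiv> handle_space k"
abbreviation "N \<equiv> handle_quotient k M \<phi>p \<phi>n"
abbreviation "D \<equiv> handle_ends k"
abbreviation "\<phi> \<equiv> handle_glue \<phi>p \<phi>n"
abbreviation "i \<equiv> incl_M k \<phi>p \<phi>n"
abbreviation "j \<equiv> incl_E k \<phi>p \<phi>n"

text \<open>A normal form for the gluing relation: points of the ends of \<open>E\<close> are moved to \<open>M\<close>.\<close>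

fun rep :: "'p + 'n handle_pt \<Rightarrow> 'p + 'n handle_pt" where
  "rep (Inl x) = Inl x"
| "rep (Inr y) = (if y \<in> D then Inl (\<phi> y) else Inr y)"

text \<open>Every point that is not in normal form reaches it in one step of the generating
  relation, and each step preserves the normal form. Hence the generated equivalence is equality of
  normal forms, and chains of identifications disappear from all later arguments.\<close>

lemma glue_rel_iff: "glue_rel k \<phi>p \<phi>n a b \<longleftrightarrow> rep a = rep b"
proof -
  define r :: "'p + 'n handle_pt \<Rightarrow> 'p + 'n handle_pt \<Rightarrow> bool" where "r = (\<lambda>a b. (\<exists>x\<in>handle_pos k. a = Inr x \<and> b = Inl (\<phi>p x)) \<or>
      (\<exists>x\<in>handle_neg k. a = Inr x \<and> b = Inl (\<phi>n x)))"
  have "\<phi> x = \<phi>p x" if "x \<in> handle_pos k" for x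
    using that by (auto simp: handle_glue_def handle_pos_def)
  moreover have "\<phi> x = \<phi>n x" if "x \<in> handle_neg k" for x
    using that by (auto simp: handle_glue_def handle_neg_def)
  ultimately have r: "r a b \<longleftrightarrow> (\<exists>x\<in>D. a = Inr x \<and> b = Inl (\<phi> x))" for a b
    unfolding r_def handle_ends_def bex_Un by simp
  have rel: "glue_rel k \<phi>p \<phi>n = equivclp r"
    unfolding glue_rel_def r_def ..
  have to_rep: "equivclp r a (rep a)" for a
  proof (cases "rep a = a")
    case False
    then have "r a (rep a)"
      unfolding r by (cases a) (simp_all split: if_splits)
    then show ?thesis
      by (rule r_into_equivclp)
  qed simp
  have r_rep: "rep a = rep b" if "r a b" for a b
    using that unfolding r by (elim bexE conjE) simp
  show ?thesis
    unfolding rel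
  proof
    assume "equivclp r a b"
    then show "rep a = rep b"
    proof (induction rule: equivclp_induct)
      case (step y z)
      then show ?case
        using r_rep[of y z] r_rep[of z y] by (elim disjE) simp_all
    qed simp
  next
    assume "rep a = rep b"
    then have "equivclp r a (rep b)"
      using to_rep[of a] by simp
    then show "equivclp r a b"
      by (rule equivclp_trans) (rule equivclp_sym[OF to_rep])
  qed
qed

lemma eq_class_eq_iff: "eq_class (glue_rel k \<phi>p \<phi>n) a = eq_class (glue_rel k \<phi>p \<phi>n) b \<longleftrightarrow> rep a = rep b"
proof
  assume "eq_class (glue_rel k \<phi>p \<phi>n) a = eq_class (glue_rel k \<phi>p \<phi>n) b"
  then have "b \<in> eq_class (glue_rel k \<phi>p \<phi>n) a"
    by (simp add: eq_class_def glue_rel_iff)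
  then show "rep a = rep b"
    by (simp add: eq_class_def glue_rel_iff)
qed (simp add: eq_class_def glue_rel_iff)

lemma D_subset: "D \<subseteq> handle_carrier k"
  using openin_handle_ends by (rule openin_imp_subset)

text \<open>The gluing relation is defined on whole types, so this and the next two equivalences
  hold without restriction to carriers. The only input is injectivity of the attaching map on
  \<open>D\<close>, used for \<open>j_eq_iff\<close>.\<close>

lemma i_eq_iff: "i x = i x' \<longleftrightarrow> x = x'"
  by (simp add: incl_M_def eq_class_eq_iff)

lemma j_eq_iff: "j y = j y' \<longleftrightarrow> y = y'"
  by (auto simp: incl_E_def eq_class_eq_iff inj_on_eq_iff[OF inj_glue])

lemma i_eq_j_iff: "i x = j y \<longleftrightarrow> y \<in> D \<and> x = \<phi> y"
  by (simp add: incl_M_def incl_E_def eq_class_eq_iff)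

lemma j_eq_i: "y \<in> D \<Longrightarrow> j y = i (\<phi> y)"
  using i_eq_j_iff[of "\<phi> y" y] by simp

lemma glue_in_X: "y \<in> D \<Longrightarrow> \<phi> y \<in> topspace X"
  using continuous_map_image_subset_topspace[OF continuous_glue] by auto

lemma inj_i: "inj_on i S"
  by (simp add: inj_on_def i_eq_iff)

lemma inj_j: "inj_on j S"
  by (simp add: inj_on_def j_eq_iff)

lemma openin_N_iff:
  "openin N W \<longleftrightarrow> W \<subseteq> i ` topspace X \<union> j ` handle_carrier k \<and>
     openin X {x \<in> topspace X. i x \<in> W} \<and> openin E {y \<in> handle_carrier k. j y \<in> W}"
proof -
  let ?Z = "disjoint_sum_topology X E" and ?q = "eq_class (glue_rel k \<phi>p \<phi>n)"
  have Z: "topspace ?Z = Inl ` topspace X \<union> Inr ` handle_carrier k"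
    by (simp add: topspace_disjoint_sum_topology)
  have image: "?q ` topspace ?Z = i ` topspace X \<union> j ` handle_carrier k"
    unfolding Z image_Un image_comp incl_M_def incl_E_def ..
  have "Inl -` {z \<in> topspace ?Z. ?q z \<in> W} = {x \<in> topspace X. i x \<in> W}"
    unfolding Z incl_M_def by auto
  moreover have "Inr -` {z \<in> topspace ?Z. ?q z \<in> W} = {y \<in> handle_carrier k. j y \<in> W}"
    unfolding Z incl_E_def by auto
  ultimately show ?thesis
    unfolding handle_quotient_def mspace_handle_mfd openin_quotient_topology image
      openin_disjoint_sum_topology by simp
qed

lemma topspace_N: "topspace N = i ` topspace X \<union> j ` handle_carrier k"
proof
  show "topspace N \<subseteq> i ` topspace X \<union> j ` handle_carrier k"
    using openin_topspace[of N] unfolding openin_N_iff by blast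
  have "{x \<in> topspace X. i x \<in> i ` topspace X \<union> j ` handle_carrier k} = topspace X"
    "{y \<in> handle_carrier k. j y \<in> i ` topspace X \<union> j ` handle_carrier k} = handle_carrier k"
    by auto
  then have "openin N (i ` topspace X \<union> j ` handle_carrier k)"
    unfolding openin_N_iff by simp
  then show "i ` topspace X \<union> j ` handle_carrier k \<subseteq> topspace N"
    by (rule openin_subset)
qed

lemma continuous_map_i: "continuous_map X N i"
  unfolding continuous_map_def topspace_N openin_N_iff by simp

lemma continuous_map_j: "continuous_map E N j"
  unfolding continuous_map_def topspace_N openin_N_iff by simp

text \<open>The preimage of i(P) in M is P itself, and its preimage in E is the preimage of P under
  the attaching map. The latter is open by continuity.\<close>

lemma open_map_i: "open_map X N i"
  unfolding open_map_def
proof (intro allI impI)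
  fix P assume P: "openin X P"
  have "{x \<in> topspace X. i x \<in> i ` P} = P"
    using openin_subset[OF P] by (auto simp: i_eq_iff)
  moreover have "openin (top_of_set D) {y \<in> topspace (top_of_set D). \<phi> y \<in> P}"
    using continuous_glue P by (rule openin_continuous_map_preimage)
  then have "openin E {y \<in> topspace (top_of_set D). \<phi> y \<in> P}"
    using openin_handle_ends by (rule openin_trans)
  moreover have "y \<in> D \<and> \<phi> y \<in> P \<longleftrightarrow> y \<in> handle_carrier k \<and> j y \<in> i ` P" for y
  proof
    assume y: "y \<in> D \<and> \<phi> y \<in> P"
    then have "i (\<phi> y) = j y"
      unfolding i_eq_j_iff by simp
    with y D_subset show "y \<in> handle_carrier k \<and> j y \<in> i ` P"
      by (metis imageI subsetD)
  next
    assume "y \<in> handle_carrier k \<and> j y \<in> i ` P"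
    then obtain x where "x \<in> P" "i x = j y"
      by (metis imageE)
    then show "y \<in> D \<and> \<phi> y \<in> P"
      unfolding i_eq_j_iff by simp
  qed
  then have "{y \<in> topspace (top_of_set D). \<phi> y \<in> P} = {y \<in> handle_carrier k. j y \<in> i ` P}"
    by simp
  ultimately show "openin N (i ` P)"
    unfolding openin_N_iff using P openin_subset[OF P] by (simp add: image_mono le_supI1)
qed

text \<open>Dual to \<open>open_map_i\<close>: the preimage of j(P) in M is the image of
  \<open>P \<inter> D\<close> under the attaching map, so here its openness as a map is
  used.\<close>

lemma open_map_j: "open_map E N j"
  unfolding open_map_def
proof (intro allI impI)
  fix P assume P: "openin E P"
  have PE: "P \<subseteq> handle_carrier k"
    using P by (rule openin_imp_subset)
  have 1: "{y \<in> handle_carrier k. j y \<in> j ` P} = P"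
    using PE by (auto simp: j_eq_iff)
  have "openin (top_of_set D) (P \<inter> D)"
    by (rule openin_subset_trans[OF openin_Int[OF P openin_handle_ends]]) (use D_subset in auto)
  then have "openin X (\<phi> ` (P \<inter> D))"
    using open_glue unfolding open_map_def by blast
  moreover from openin_subset[OF this]
  have "\<phi> ` (P \<inter> D) = {x \<in> topspace X. i x \<in> j ` P}"
    unfolding image_iff i_eq_j_iff by blast
  ultimately show "openin N (j ` P)"
    unfolding openin_N_iff 1 using P PE by (simp add: image_mono le_supI2)
qed

text \<open>A whole slab |t| < \<open>\<epsilon>\<close> around E_0 serves as neighbourhood of y:
  any point of it that is identified with a point of M lies in an end with small |t|, and these
  avoid P.\<close>

lemma handle_middle_separation:
  assumes "x \<in> topspace X" "y \<in> handle_carrier k" "y \<notin> D"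
  shows "\<exists>U V. openin N U \<and> openin N V \<and> i x \<in> U \<and> j y \<in> V \<and> disjnt U V"
proof -
  obtain \<epsilon> P where P: "0 < \<epsilon>" "openin X P" "x \<in> P" "\<forall>p\<in>D. \<bar>fst p\<bar> < \<epsilon> \<longrightarrow> \<phi> p \<notin> P"
    using glue_separation[OF assms(1)] by (elim exE conjE)
  let ?V = "{- \<epsilon> <..< \<epsilon>} \<times> hyp k"
  have "openin E ?V"
    unfolding handle_carrier_def by (intro openin_Times) auto
  then have "openin N (j ` ?V)"
    using open_map_j unfolding open_map_def by blast
  moreover have "openin N (i ` P)"
    using P(2) open_map_i unfolding open_map_def by blast
  moreover have "y \<in> ?V"
    using assms(2,3) P(1) unfolding handle_ends_eq handle_carrier_def by (cases y) auto
  moreover have "disjnt (i ` P) (j ` ?V)"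
  proof -
    have False if "z \<in> P" "p \<in> ?V" "i z = j p" for z p
    proof -
      have "p \<in> D" "z = \<phi> p"
        using that(3) unfolding i_eq_j_iff by simp_all
      moreover have "\<bar>fst p\<bar> < \<epsilon>"
        using that(2) by auto
      ultimately show False
        using P(4) that(1) by blast
    qed
    then show ?thesis
      unfolding disjnt_iff by (intro allI notI) (elim conjE imageE, simp)
  qed
  ultimately show ?thesis
    using P(3) by (intro exI[of _ "i ` P"] exI[of _ "j ` ?V"]) simp
qed

lemma Hausdorff_N: "Hausdorff_space N"
  unfolding Hausdorff_space_def
proof (intro allI impI, elim conjE)
  fix a b assume "a \<in> topspace N" "b \<in> topspace N" and ab: "a \<noteq> b"
  have split: "(\<exists>x\<in>topspace X. z = i x) \<or> (\<exists>y\<in>handle_carrier k. y \<notin> D \<and> z = j y)"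
    if "z \<in> topspace N" for z
  proof -
    consider x where "x \<in> topspace X" "z = i x" | y where "y \<in> handle_carrier k" "z = j y"
      using \<open>z \<in> topspace N\<close> unfolding topspace_N by blast
    then show ?thesis
    proof cases
      case 2
      show ?thesis
      proof (cases "y \<in> D")
        case True
        with 2 show ?thesis
          using j_eq_i glue_in_X by blast
      qed (use 2 in blast)
    qed blast
  qed
  have HX: "Hausdorff_space X"
    using M unfolding cat_manifold_def by blast
  have HE: "Hausdorff_space E"
    by (simp add: Hausdorff_space_subtopology)
  \<comment> \<open>Points in the ends of E are counted as points of M, so in the mixed cases the
    point of E lies in E_0.\<close>
  consider x y where "x \<in> topspace X" "a = i x" "y \<in> topspace X" "b = i y"
    | x y where "x \<in> topspace X" "a = i x" "y \<in> handle_carrier k" "y \<notin> D" "b = j y"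
    | x y where "x \<in> topspace X" "b = i x" "y \<in> handle_carrier k" "y \<notin> D" "a = j y"
    | x y where "x \<in> handle_carrier k" "a = j x" "y \<in> handle_carrier k" "b = j y"
    using split[OF \<open>a \<in> topspace N\<close>] split[OF \<open>b \<in> topspace N\<close>] by blast
  then show "\<exists>U V. openin N U \<and> openin N V \<and> a \<in> U \<and> b \<in> V \<and> disjnt U V"
  proof cases
    case 1
    then show ?thesis
      using Hausdorff_image[OF HX open_map_i inj_i] ab by simp
  next
    case 2
    then show ?thesis
      using handle_middle_separation by simp
  next
    case 3
    then show ?thesis
      using handle_middle_separation[of x y] by (metis disjnt_sym)
  next
    case 4
    then show ?thesis
      using Hausdorff_image[OF HE open_map_j inj_j] ab by simp
  qed
qed

lemma closed_hyp: "closed (hyp k :: (real ^ 'n) set)"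
  unfolding hyp_def by (intro closed_Collect_eq continuous_intros)

lemma closed_handle_carrier: "closed (handle_carrier k)"
  unfolding handle_carrier_def using closed_hyp by (intro closed_Times) auto

lemma compactin_j_image: "compact A \<Longrightarrow> A \<subseteq> handle_carrier k \<Longrightarrow> compactin N (j ` A)"
  by (rule image_compactin[OF _ continuous_map_j]) (simp add: compactin_subtopology)

lemma paracompact_N: "paracompact_space N"
proof (rule paracompact_space_extend)
  let ?A = "\<lambda>m. {y \<in> hyp k. real m \<le> norm y \<and> norm y \<le> real m + 1}"
  \<comment> \<open>The widths 1/(m+1) in the direction of t have to shrink. With a fixed width and
    n > 1, the images of these sets would accumulate in M at points on the lateral boundary of the
    tubes, where y tends to infinity while t stays fixed.\<close>
  let ?B = "\<lambda>m. {p \<in> handle_carrier k. \<bar>fst p\<bar> < 1 / (real m + 1) \<and>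
      real m - 1 < norm (snd p) \<and> norm (snd p) < real m + 2}"
  let ?K = "\<lambda>m. {0} \<times> ?A m"
  have KE: "?K m \<subseteq> handle_carrier k" for m
    unfolding handle_carrier_def by auto
  have cK: "compact (?K m)" for m
  proof -
    have "?A m = hyp k \<inter> {y. real m \<le> norm y} \<inter> cball 0 (real m + 1)"
      by auto
    moreover have "closed {y :: real ^ 'n. real m \<le> norm y}"
      by (intro closed_Collect_le continuous_intros)
    ultimately have "compact (?A m)"
      using closed_hyp by (simp add: closed_Int closed_Int_compact)
    then show ?thesis
      by (intro compact_Times) auto
  qed
  show "paracompact_space X"
    using M unfolding cat_manifold_def by blast
  show "continuous_map X N i" "open_map X N i" "inj_on i (topspace X)"
    by (rule continuous_map_i, rule open_map_i, rule inj_i)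
  show "compactin N (j ` ?K m)" for m
    using cK KE by (rule compactin_j_image)
  show "openin N (j ` ?B m)" for m
  proof -
    have "open {p :: 'n handle_pt. \<bar>fst p\<bar> < 1 / (real m + 1) \<and>
        real m - 1 < norm (snd p) \<and> norm (snd p) < real m + 2}"
      by (intro open_Collect_conj open_Collect_less continuous_intros)
    then have "openin E (handle_carrier k \<inter> {p. \<bar>fst p\<bar> < 1 / (real m + 1) \<and>
        real m - 1 < norm (snd p) \<and> norm (snd p) < real m + 2})"
      by (rule openin_open_Int)
    then show ?thesis
      using open_map_j unfolding open_map_def Collect_conj_eq by simp
  qed
  show "j ` ?K m \<subseteq> j ` ?B m" for m
    using KE[of m] by (intro image_mono) auto
  show "topspace N \<subseteq> i ` topspace X \<union> (\<Union>m. j ` ?K m)"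
  proof
    fix z assume z: "z \<in> topspace N"
    show "z \<in> i ` topspace X \<union> (\<Union>m. j ` ?K m)"
    proof (cases "z \<in> i ` topspace X")
      case False
      then obtain p where p: "p \<in> handle_carrier k" "z = j p"
        using z unfolding topspace_N by blast
      have "p \<notin> D"
      proof
        assume "p \<in> D"
        then have "z = i (\<phi> p)" "\<phi> p \<in> topspace X"
          using p(2) j_eq_i glue_in_X by simp_all
        with False show False
          by blast
      qed
      with p(1) have fp: "fst p = 0" "snd p \<in> hyp k"
        unfolding handle_ends_eq handle_carrier_def by auto
      have "real (nat \<lfloor>norm (snd p)\<rfloor>) \<le> norm (snd p)" "norm (snd p) \<le> real (nat \<lfloor>norm (snd p)\<rfloor>) + 1"
        by (simp_all add: of_nat_floor)
      with fp have "p \<in> ?K (nat \<lfloor>norm (snd p)\<rfloor>)"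
        by (simp add: mem_Times_iff)
      with p(2) show ?thesis
        by blast
    qed simp
  qed
  show "\<exists>V. openin N V \<and> z \<in> V \<and> finite {m. j ` ?B m \<inter> V \<noteq> {}}" if z: "z \<in> topspace N" for z
  proof -
    consider x where "x \<in> topspace X" "z = i x" | p where "p \<in> handle_carrier k" "z = j p"
      using z unfolding topspace_N by blast
    then show ?thesis
    proof cases
      case 1
      obtain \<epsilon> P where P: "0 < \<epsilon>" "openin X P" "x \<in> P" "\<forall>p\<in>D. \<bar>fst p\<bar> < \<epsilon> \<longrightarrow> \<phi> p \<notin> P"
        using glue_separation[OF 1(1)] by (elim exE conjE)
      \<comment> \<open>A common point comes from an end and has |t| at least
        \<open>\<epsilon>\<close> by the choice of P, while |t| < 1/(m+1) in the m-th set. This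
        bounds m.\<close>
      have "{m. j ` ?B m \<inter> i ` P \<noteq> {}} \<subseteq> {m. real m \<le> 1 / \<epsilon>}"
      proof (rule subsetI, unfold mem_Collect_eq)
        fix m assume "j ` ?B m \<inter> i ` P \<noteq> {}"
        then obtain w where "w \<in> j ` ?B m" "w \<in> i ` P"
          by blast
        then obtain p y where py: "p \<in> ?B m" "y \<in> P" "i y = j p"
          by (elim imageE) simp
        then have "p \<in> D" "y = \<phi> p"
          unfolding i_eq_j_iff by simp_all
        with P(4) py(2) have "\<epsilon> \<le> \<bar>fst p\<bar>"
          using linorder_not_less by blast
        with py(1) have "\<epsilon> < 1 / (real m + 1)"
          by simp
        then have "real m + 1 < 1 / \<epsilon>"
          using P(1) by (simp add: field_simps)
        then show "real m \<le> 1 / \<epsilon>"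
          by simp
      qed
      then have "finite {m. j ` ?B m \<inter> i ` P \<noteq> {}}"
        using finite_nat_real_le by (rule finite_subset)
      moreover have "openin N (i ` P)"
        using P(2) open_map_i unfolding open_map_def by blast
      ultimately show ?thesis
        using P(3) 1(2) by (intro exI[of _ "i ` P"]) simp
    next
      case 2
      let ?V = "handle_carrier k \<inter> {q. norm (snd q) < norm (snd p) + 1}"
      have "open {q :: 'n handle_pt. norm (snd q) < norm (snd p) + 1}"
        by (intro open_Collect_less continuous_intros)
      then have "openin N (j ` ?V)"
        using open_map_j unfolding open_map_def by (simp add: openin_open_Int)
      moreover have "{m. j ` ?B m \<inter> j ` ?V \<noteq> {}} \<subseteq> {m. real m \<le> norm (snd p) + 2}"
      proof (rule subsetI, unfold mem_Collect_eq)
        fix m assume "j ` ?B m \<inter> j ` ?V \<noteq> {}"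
        then obtain w where "w \<in> j ` ?B m" "w \<in> j ` ?V"
          by blast
        then obtain q q' where "q \<in> ?B m" "q' \<in> ?V" "j q = j q'"
          by (elim imageE) simp
        then have "q \<in> ?B m" "q \<in> ?V"
          unfolding j_eq_iff by simp_all
        then show "real m \<le> norm (snd p) + 2"
          by simp
      qed
      then have "finite {m. j ` ?B m \<inter> j ` ?V \<noteq> {}}"
        using finite_nat_real_le by (rule finite_subset)
      ultimately show ?thesis
        using 2 by (intro exI[of _ "j ` ?V"]) simp
    qed
  qed
  show "\<exists>V Z. openin N V \<and> closedin N Z \<and> j ` ?K m \<subseteq> V \<and> V \<subseteq> Z \<and> Z \<subseteq> W"
    if W: "openin N W" "j ` ?K m \<subseteq> W" for m W
  proof -
    have "openin E {p \<in> topspace E. j p \<in> W}"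
      using continuous_map_j W(1) by (rule openin_continuous_map_preimage)
    then obtain T where T: "open T" "{p \<in> topspace E. j p \<in> W} = handle_carrier k \<inter> T"
      unfolding openin_open by blast
    have "?K m \<subseteq> T"
      using W(2) T(2) KE[of m] by auto
    from compact_neighbourhood[OF cK T(1) this] obtain V Z where
      VZ: "open V" "compact Z" "?K m \<subseteq> V" "V \<subseteq> Z" "Z \<subseteq> T" .
    have "openin N (j ` (handle_carrier k \<inter> V))"
      using VZ(1) open_map_j unfolding open_map_def by (simp add: openin_open_Int)
    moreover have "compact (handle_carrier k \<inter> Z)"
      using closed_handle_carrier VZ(2) by (rule closed_Int_compact)
    \<comment> \<open>The Hausdorff property of N enters the proof of paracompactness here, turning
      a compact neighbourhood in E into a closed subset of N.\<close>
    then have "closedin N (j ` (handle_carrier k \<inter> Z))"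
      by (intro compactin_imp_closedin[OF Hausdorff_N] compactin_j_image) auto
    moreover have "j ` ?K m \<subseteq> j ` (handle_carrier k \<inter> V)"
      using VZ(3) KE[of m] by (intro image_mono) auto
    moreover have "j ` (handle_carrier k \<inter> V) \<subseteq> j ` (handle_carrier k \<inter> Z)"
      using VZ(4) by (intro image_mono) auto
    moreover have "j ` (handle_carrier k \<inter> Z) \<subseteq> W"
    proof (rule image_subsetI)
      fix p assume "p \<in> handle_carrier k \<inter> Z"
      then have "p \<in> handle_carrier k \<inter> T"
        using VZ(5) by blast
      then show "j p \<in> W"
        unfolding T(2)[symmetric] by simp
    qed
    ultimately show ?thesis
      by (intro exI[of _ "j ` (handle_carrier k \<inter> V)"] exI[of _ "j ` (handle_carrier k \<inter> Z)"] conjI)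
  qed
qed

end

section \<open>The charts of the quotient\<close>

lemma compatible_charts_sym:
  assumes "inj_on c U" "inj_on d V" "compatible_charts C (U, c) (V, d)"
  shows "compatible_charts C (V, d) (U, c)"
  using assms by (simp add: compatible_charts_iff Int_commute)

lemma inj_on_push:
  assumes "inj_on h S" "U \<subseteq> S" "inj_on c U"
  shows "inj_on (c \<circ> inv_into S h) (h ` U)"
  using assms by (auto simp: inj_on_def subset_iff)

lemma image_push:
  assumes "inj_on h S" "U \<subseteq> S"
  shows "(c \<circ> inv_into S h) ` h ` U = c ` U"
  using assms by (simp only: image_comp[symmetric] inv_into_image_cancel)

text \<open>The coordinate expression of h is the coordinate change out of the transported chart, so
  compatibility of charts in the target says precisely that h is CAT.\<close>

lemma cat_iso_of_compatible_push:
  assumes "inj_on h S" "U \<subseteq> S" "inj_on c U"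
    and "compatible_charts C (h ` U, c \<circ> inv_into S h) (V, d)"
  shows "cat_iso C (c ` (U \<inter> h -` V)) (d ` (h ` U \<inter> V)) (d \<circ> h \<circ> inv_into U c)"
proof -
  have "cat_dependent C (h ` U \<inter> V) (c \<circ> inv_into S h) d" "cat_dependent C (h ` U \<inter> V) d (c \<circ> inv_into S h)"
    using assms(4) compatible_charts_iff[OF inj_on_push[OF assms(1-3)]] by simp_all
  then show ?thesis
    unfolding cat_iso_chart_map_iff[OF assms(3)] cat_dependent_push[OF assms(1,2)] ..
qed

lemma is_chart_handle: "is_chart (handle_space k) (handle_carrier k, handle_coord k)"
  by (simp add: is_chart_iff coord_chart_handle handle_coord_carrier)

text \<open>In PL the identity is a CAT map only on sets that are locally unions of polytopes; here
  the image of the chart is all of R^n.\<close>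

lemma compatible_handle_chart: "compatible_charts C (handle_carrier k, handle_coord k) (handle_carrier k, handle_coord k)"
proof -
  have "cat_map C UNIV (\<lambda>z. z + 0 :: real ^ 'a)"
    by (intro cat_map_affine bounded_linear.linear[OF bounded_linear_ident]) simp
  then have "cat_dependent C (handle_carrier k) (handle_coord k) (handle_coord k)"
    by (intro cat_dependentI[of C "handle_coord k" "handle_carrier k" "\<lambda>z. z + 0"])
      (simp_all add: handle_coord_carrier)
  then show ?thesis
    by (simp add: compatible_charts_iff inj_on_handle_coord)
qed

context handle_gluing
begin

abbreviation "push_i c \<equiv> c \<circ> inv_into (topspace X) i"
abbreviation "j_chart \<equiv> (j ` handle_carrier k, handle_coord k \<circ> inv_into (handle_carrier k) j)"

lemma handle_atlas_eq:
  "handle_atlas k M \<phi>p \<phi>n \<A> = (\<lambda>(U, c). (i ` U, push_i c)) ` \<A> \<union> {j_chart}"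
  unfolding handle_atlas_def transport_atlas_def matlas_handle_mfd by simp

lemma matlas_chart:
  assumes "(U, c) \<in> matlas M"
  shows "is_chart X (U, c)" "coord_chart X U c"
  using cat_manifold_chart[OF M assms] by simp_all

lemma coord_chart_subset: "coord_chart X U c \<Longrightarrow> U \<subseteq> topspace X"
  unfolding coord_chart_def using openin_subset by blast

lemma is_chart_push_i: "is_chart X (U, c) \<Longrightarrow> is_chart N (i ` U, push_i c)"
  by (rule is_chart_push[OF continuous_map_i open_map_i inj_i])

lemma coord_chart_push_i: "coord_chart X U c \<Longrightarrow> coord_chart N (i ` U) (push_i c)"
  by (rule coord_chart_push[OF continuous_map_i open_map_i inj_i])

lemma is_chart_j: "is_chart N j_chart"
  using is_chart_push[OF continuous_map_j open_map_j inj_j is_chart_handle] by simp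

lemma coord_chart_j: "coord_chart N (fst j_chart) (snd j_chart)"
  using is_chart_j unfolding is_chart_iff by simp

lemma inj_on_j_chart: "inj_on (snd j_chart) (fst j_chart)"
  using coord_chart_j by (rule coord_chart_inj_on)

lemma compatible_i_i:
  fixes c d :: "'p \<Rightarrow> real ^ 'n"
  assumes "coord_chart X U c" "coord_chart X V d" "compatible_charts C (U, c) (V, d)"
  shows "compatible_charts C (i ` U, push_i c) (i ` V, push_i d)"
proof -
  note U = coord_chart_subset[OF assms(1)] and V = coord_chart_subset[OF assms(2)]
  have UV: "i ` U \<inter> i ` V = i ` (U \<inter> V)"
    using inj_i[of UNIV] by (simp add: image_Int)
  have eq: "(push_i c \<circ> i) x = c x" if "x \<in> U \<inter> V" for x and c :: "'p \<Rightarrow> real ^ 'n"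
    using that U inv_into_f_f[OF inj_i, of x "topspace X"] by auto
  have "cat_dependent C (U \<inter> V) c d" "cat_dependent C (U \<inter> V) d c"
    using assms(3) compatible_charts_iff[OF coord_chart_inj_on[OF assms(1)]] by simp_all
  moreover have "cat_dependent C (i ` (U \<inter> V)) (push_i c) (push_i d) \<longleftrightarrow> cat_dependent C (U \<inter> V) c d"
    unfolding cat_dependent_image by (rule cat_dependent_cong) (simp_all only: eq)
  moreover have "cat_dependent C (i ` (U \<inter> V)) (push_i d) (push_i c) \<longleftrightarrow> cat_dependent C (U \<inter> V) d c"
    unfolding cat_dependent_image by (rule cat_dependent_cong) (simp_all only: eq)
  ultimately show ?thesis
    unfolding compatible_charts_iff[OF coord_chart_inj_on[OF coord_chart_push_i[OF assms(1)]]] UV by simp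
qed

lemma i_j_overlap: "V \<subseteq> topspace X \<Longrightarrow> i ` V \<inter> j ` handle_carrier k = j ` (D \<inter> \<phi> -` V)"
proof
  show "i ` V \<inter> j ` handle_carrier k \<subseteq> j ` (D \<inter> \<phi> -` V)"
  proof
    fix z assume "z \<in> i ` V \<inter> j ` handle_carrier k"
    then obtain x y where xy: "x \<in> V" "z = i x" "z = j y"
      by blast
    then have "y \<in> D" "x = \<phi> y"
      using i_eq_j_iff[of x y] by simp_all
    with xy show "z \<in> j ` (D \<inter> \<phi> -` V)"
      by blast
  qed
  show "j ` (D \<inter> \<phi> -` V) \<subseteq> i ` V \<inter> j ` handle_carrier k"
  proof (rule image_subsetI)
    fix y assume "y \<in> D \<inter> \<phi> -` V"
    then have y: "y \<in> handle_carrier k" "j y = i (\<phi> y)" "\<phi> y \<in> V"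
      using subsetD[OF D_subset, of y] j_eq_i[of y] by simp_all
    have "j y \<in> i ` V"
      unfolding y(2) using y(3) by (rule imageI)
    then show "j y \<in> i ` V \<inter> j ` handle_carrier k"
      using imageI[OF y(1)] by (rule IntI)
  qed
qed

lemma j_chart_j: "y \<in> handle_carrier k \<Longrightarrow> (snd j_chart \<circ> j) y = handle_coord k y"
  using inv_into_f_f[OF inj_j, of y "handle_carrier k"] by simp

lemma push_i_j: "y \<in> D \<Longrightarrow> (push_i d \<circ> j) y = (d \<circ> \<phi>) y"
  by (simp add: j_eq_i glue_in_X inv_into_f_f[OF inj_i])

text \<open>Parametrized by j, the overlap of the two pieces is an open part of the ends of E. There
  the chart of the handle reads \<open>handle_coord k\<close> and the transported chart of M reads
  \<open>d \<circ> \<phi>\<close>, so the coordinate change is the attaching map in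
  coordinates.\<close>

lemma cat_dependent_overlap_iff:
  assumes "V \<subseteq> topspace X"
  shows "cat_dependent C (i ` V \<inter> fst j_chart) (snd j_chart) (push_i d) \<longleftrightarrow>
      cat_dependent C (D \<inter> \<phi> -` V) (handle_coord k) (d \<circ> \<phi>)"
    and "cat_dependent C (i ` V \<inter> fst j_chart) (push_i d) (snd j_chart) \<longleftrightarrow>
      cat_dependent C (D \<inter> \<phi> -` V) (d \<circ> \<phi>) (handle_coord k)"
proof -
  have e: "(snd j_chart \<circ> j) y = handle_coord k y" "(push_i d \<circ> j) y = (d \<circ> \<phi>) y" if "y \<in> D \<inter> \<phi> -` V" for y
    using that subsetD[OF D_subset, of y] by (simp_all only: IntD1 j_chart_j push_i_j)
  show "cat_dependent C (i ` V \<inter> fst j_chart) (snd j_chart) (push_i d) \<longleftrightarrow>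
      cat_dependent C (D \<inter> \<phi> -` V) (handle_coord k) (d \<circ> \<phi>)"
    unfolding fst_conv i_j_overlap[OF assms] cat_dependent_image by (rule cat_dependent_cong) (simp_all only: e)
  show "cat_dependent C (i ` V \<inter> fst j_chart) (push_i d) (snd j_chart) \<longleftrightarrow>
      cat_dependent C (D \<inter> \<phi> -` V) (d \<circ> \<phi>) (handle_coord k)"
    unfolding fst_conv i_j_overlap[OF assms] cat_dependent_image by (rule cat_dependent_cong) (simp_all only: e)
qed

text \<open>Stated for any chart compatible with the atlas of M, so that it covers the charts of an
  orientation too. Since the attaching map is given as CAT in atlas charts only, atlas charts around
  the points of U mediate.\<close>

lemma compatible_i_j:
  assumes c: "coord_chart X U c" and atlas: "\<forall>\<kappa>\<in>matlas M. compatible_charts C (U, c) \<kappa>"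
  shows "compatible_charts C (i ` U, push_i c) j_chart"
proof -
  have "compatible_charts C (i ` U, push_i c) (fst j_chart, snd j_chart)"
  proof (rule compatible_charts_via_cover[OF coord_chart_push_i[OF c] coord_chart_j])
    fix z assume "z \<in> i ` U \<inter> fst j_chart"
    then obtain x where x: "x \<in> U" "z = i x"
      by blast
    then have "x \<in> topspace X"
      using coord_chart_subset[OF c] by blast
    then have "x \<in> (\<Union>\<kappa>\<in>matlas M. fst \<kappa>)"
      using M unfolding cat_manifold_def by blast
    then obtain V d where Vd: "(V, d) \<in> matlas M" "x \<in> V"
      by auto
    note d = matlas_chart(2)[OF Vd(1)]
    have "compatible_charts C (i ` U, push_i c) (i ` V, push_i d)"
      using atlas Vd(1) by (intro compatible_i_i c d) blast
    moreover have "compatible_charts C (i ` V, push_i d) (fst j_chart, snd j_chart)"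
      unfolding compatible_charts_iff[OF coord_chart_inj_on[OF coord_chart_push_i[OF d]]]
        cat_dependent_overlap_iff[OF coord_chart_subset[OF d]]
      using cat_dependent_glue[OF Vd(1)] by simp
    ultimately show "\<exists>A a. z \<in> A \<and> coord_chart N A a \<and>
        compatible_charts C (i ` U, push_i c) (A, a) \<and> compatible_charts C (A, a) (fst j_chart, snd j_chart)"
      using x(2) Vd(2) coord_chart_push_i[OF d] by (intro exI[of _ "i ` V"] exI[of _ "push_i d"]) simp
  qed
  then show ?thesis
    by simp
qed

lemma compatible_j_i:
  assumes c: "coord_chart X U c" and atlas: "\<forall>\<kappa>\<in>matlas M. compatible_charts C (U, c) \<kappa>"
  shows "compatible_charts C j_chart (i ` U, push_i c)"
  using compatible_charts_sym[OF coord_chart_inj_on[OF coord_chart_push_i[OF c]] inj_on_j_chart]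
    compatible_i_j[OF assms] by simp

lemma compatible_j_j: "compatible_charts C j_chart j_chart"
proof -
  have e: "(snd j_chart \<circ> j) y = handle_coord k y" if "y \<in> handle_carrier k" for y
    using that by (rule j_chart_j)
  have "cat_dependent C (j ` handle_carrier k) (snd j_chart) (snd j_chart) \<longleftrightarrow>
      cat_dependent C (handle_carrier k) (handle_coord k) (handle_coord k)"
    unfolding cat_dependent_image by (rule cat_dependent_cong) (simp_all only: e)
  then show ?thesis
    using compatible_handle_chart[of C k] inj_on_j_chart
    by (simp add: compatible_charts_iff inj_on_handle_coord)
qed

lemma matlas_compatible: "(U, c) \<in> matlas M \<Longrightarrow> \<forall>\<kappa>\<in>matlas M. compatible_charts C (U, c) \<kappa>"
  using M unfolding cat_manifold_def by blast

abbreviation "N_mfd \<equiv> attach_handle k M \<phi>p \<phi>n"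

lemma mspace_N_mfd: "mspace N_mfd = N"
  by (simp add: attach_handle_def)

lemma matlas_N_mfd: "matlas N_mfd = (\<lambda>(U, c). (i ` U, push_i c)) ` matlas M \<union> {j_chart}"
  unfolding attach_handle_def handle_atlas_eq by simp

lemma N_mfd_chart_cases:
  assumes "\<kappa> \<in> matlas N_mfd"
  obtains U c where "(U, c) \<in> matlas M" "\<kappa> = (i ` U, push_i c)" | "\<kappa> = j_chart"
  using assms unfolding matlas_N_mfd by auto

lemma compatible_push_i:
  assumes c: "coord_chart X U c" and atlas: "\<forall>\<kappa>\<in>matlas M. compatible_charts C (U, c) \<kappa>"
    and \<kappa>: "\<kappa> \<in> matlas N_mfd"
  shows "compatible_charts C (i ` U, push_i c) \<kappa>"
  using \<kappa>
proof (cases rule: N_mfd_chart_cases)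
  case (1 V d)
  show ?thesis
    unfolding 1(2) using atlas 1(1) by (intro compatible_i_i[OF c matlas_chart(2)[OF 1(1)]]) blast
next
  case 2
  show ?thesis
    unfolding 2 by (rule compatible_i_j[OF c atlas])
qed

lemma compatible_j:
  assumes \<kappa>: "\<kappa> \<in> matlas N_mfd"
  shows "compatible_charts C j_chart \<kappa>"
  using \<kappa>
proof (cases rule: N_mfd_chart_cases)
  case (1 V d)
  show ?thesis
    unfolding 1(2) by (rule compatible_j_i[OF matlas_chart(2)[OF 1(1)] matlas_compatible[OF 1(1)]])
next
  case 2
  show ?thesis
    unfolding 2 by (rule compatible_j_j)
qed

lemma cat_manifold_N: "cat_manifold C N_mfd"
  unfolding cat_manifold_def mspace_N_mfd
proof (intro conjI ballI)
  show "Hausdorff_space N" "paracompact_space N"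
    by (rule Hausdorff_N, rule paracompact_N)
  show "is_chart N \<kappa>" if "\<kappa> \<in> matlas N_mfd" for \<kappa>
    using that
  proof (cases rule: N_mfd_chart_cases)
    case (1 U c)
    then show ?thesis
      using is_chart_push_i[OF matlas_chart(1)] by simp
  next
    case 2
    then show ?thesis
      using is_chart_j by simp
  qed
  have "(\<Union>\<kappa>\<in>matlas N_mfd. fst \<kappa>) = i ` (\<Union>\<kappa>\<in>matlas M. fst \<kappa>) \<union> j ` handle_carrier k"
    unfolding matlas_N_mfd by (auto simp: split_def)
  moreover have "(\<Union>\<kappa>\<in>matlas M. fst \<kappa>) = topspace X"
    using M unfolding cat_manifold_def by blast
  ultimately show "(\<Union>\<kappa>\<in>matlas N_mfd. fst \<kappa>) = topspace N"
    unfolding topspace_N by simp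
  show "compatible_charts C \<kappa> \<kappa>'" if "\<kappa> \<in> matlas N_mfd" and \<kappa>': "\<kappa>' \<in> matlas N_mfd" for \<kappa> \<kappa>'
    using that(1)
  proof (cases rule: N_mfd_chart_cases)
    case (1 U c)
    show ?thesis
      unfolding 1(2) by (rule compatible_push_i[OF matlas_chart(2)[OF 1(1)] matlas_compatible[OF 1(1)] \<kappa>'])
  next
    case 2
    show ?thesis
      unfolding 2 by (rule compatible_j[OF \<kappa>'])
  qed
qed

lemma cat_open_embedding_i: "cat_open_embedding C M N_mfd i"
proof -
  have "cat_iso C (c ` (U \<inter> i -` V)) (d ` (i ` U \<inter> V)) (d \<circ> i \<circ> inv_into U c)"
    if Uc: "(U, c) \<in> matlas M" and Vd: "(V, d) \<in> matlas N_mfd" for U c V d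
    by (rule cat_iso_of_compatible_push[OF inj_i coord_chart_subset coord_chart_inj_on compatible_push_i])
      (use matlas_chart(2)[OF Uc] matlas_compatible[OF Uc] Vd in auto)
  then show ?thesis
    unfolding cat_open_embedding_def mspace_N_mfd
    using injective_open_imp_embedding_map[OF continuous_map_i open_map_i inj_i] open_map_i by blast
qed

lemma cat_open_embedding_j: "cat_open_embedding C (handle_mfd k) N_mfd j"
proof -
  have "cat_iso C (handle_coord k ` (handle_carrier k \<inter> j -` V)) (d ` (j ` handle_carrier k \<inter> V))
      (d \<circ> j \<circ> inv_into (handle_carrier k) (handle_coord k))" if Vd: "(V, d) \<in> matlas N_mfd" for V d
    by (rule cat_iso_of_compatible_push[OF inj_j order_refl inj_on_handle_coord compatible_j[OF Vd]])
  then show ?thesis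
    unfolding cat_open_embedding_def mspace_N_mfd mspace_handle_mfd matlas_handle_mfd
    using injective_open_imp_embedding_map[OF continuous_map_j open_map_j inj_j] open_map_j by auto
qed

end

section \<open>Local degree of coordinate changes\<close>

lemma orientation_preserving_on_cong:
  assumes "\<And>x. x \<in> U \<Longrightarrow> f x = g x"
  shows "orientation_preserving_on U f \<longleftrightarrow> orientation_preserving_on U g"
proof -
  have "hom_induced (int CARD('a)) (top_of_set U) (U - {x}) euclidean (- {0}) (\<lambda>y. f y - f x) =
      hom_induced (int CARD('a)) (top_of_set U) (U - {x}) euclidean (- {0}) (\<lambda>y. g y - g x)"
    if "x \<in> U" for x
    by (rule hom_induced_eq) (use assms that in simp)
  then show ?thesis
    unfolding orientation_preserving_on_def by simp
qed

lemma continuous_map_diff_point: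
  fixes f :: "'a::topological_space \<Rightarrow> 'b::real_normed_vector"
  assumes "continuous_on U f" "inj_on f U" "x \<in> U"
  shows "continuous_map (top_of_set U) euclidean (\<lambda>y. f y - f x)"
    "(\<lambda>y. f y - f x) \<in> U - {x} \<rightarrow> - {0}"
  using assms by (auto intro: continuous_on_diff continuous_on_const simp: inj_on_eq_iff)

text \<open>By excision, every local homology class at \<open>x\<close> comes from any given neighbourhood of \<open>x\<close>.\<close>

lemma orientation_preserving_on_locally:
  fixes f :: "real ^ 'n::finite \<Rightarrow> real ^ 'n"
  assumes f: "continuous_on U f" "inj_on f U"
    and loc: "\<And>x. x \<in> U \<Longrightarrow> \<exists>U'. x \<in> U' \<and> openin (top_of_set U) U' \<and> orientation_preserving_on U' f"
  shows "orientation_preserving_on U f"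
  unfolding orientation_preserving_on_def
proof (intro ballI)
  let ?n = "int CARD('n)"
  fix x a assume x: "x \<in> U" and a: "a \<in> carrier (relative_homology_group ?n (top_of_set U) (U - {x}))"
  obtain U' where U': "x \<in> U'" "openin (top_of_set U) U'" "orientation_preserving_on U' f"
    using loc[OF x] by (elim exE conjE)
  have sub: "U' \<subseteq> U"
    using U'(2) by (rule openin_imp_subset)
  \<comment> \<open>The set U - U' is excised. It is closed and U - {x} is open, so the closure and
    interior demanded by the excision axiom are these sets themselves.\<close>
  have "closedin (top_of_set U) (U - U')"
    using U'(2) by (metis closedin_diff closedin_topspace topspace_euclidean_subtopology)
  moreover have "openin (top_of_set U) (U - {x})"
    by (simp add: openin_delete)
  moreover have "U - U' \<subseteq> U - {x}"
    using U'(1) by blast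
  ultimately have "hom_induced ?n (subtopology (top_of_set U) (U - (U - U'))) ((U - {x}) - (U - U'))
      (subtopology (top_of_set U) U) (U - {x}) id
    \<in> iso (relative_homology_group ?n (subtopology (top_of_set U) (U - (U - U'))) ((U - {x}) - (U - U')))
          (relative_homology_group ?n (subtopology (top_of_set U) U) (U - {x}))"
    by (intro homology_excision_axiom) (simp_all add: closure_of_closedin interior_of_openin)
  moreover have "U - (U - U') = U'" "(U - {x}) - (U - U') = U' - {x}"
    using sub by blast+
  ultimately have "hom_induced ?n (top_of_set U') (U' - {x}) (top_of_set U) (U - {x}) id
    \<in> iso (relative_homology_group ?n (top_of_set U') (U' - {x}))
          (relative_homology_group ?n (top_of_set U) (U - {x}))"
    using sub by (simp add: subtopology_subtopology inf.absorb2)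
  then obtain b where b: "b \<in> carrier (relative_homology_group ?n (top_of_set U') (U' - {x}))"
      "a = hom_induced ?n (top_of_set U') (U' - {x}) (top_of_set U) (U - {x}) id b"
    using a unfolding iso_def bij_betw_def by blast
  have id: "continuous_map (top_of_set U') (top_of_set U) id" "id \<in> U' - {x} \<rightarrow> U - {x}"
    using sub by (auto simp: continuous_map_in_subtopology)
  \<comment> \<open>Applied both to f and to the identity: the two sides of the degree equation for
    a reduce to the two sides for the same class b over U'.\<close>
  have push: "hom_induced ?n (top_of_set U) (U - {x}) euclidean (- {0}) (\<lambda>y. g y - g x) a =
      hom_induced ?n (top_of_set U') (U' - {x}) euclidean (- {0}) (\<lambda>y. g y - g x) b"
    if "continuous_on U g" "inj_on g U" for g :: "real ^ 'n \<Rightarrow> real ^ 'n"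
    unfolding b(2) hom_induced_compose'[OF id continuous_map_diff_point[OF that x]] by (simp add: o_def)
  have "hom_induced ?n (top_of_set U') (U' - {x}) euclidean (- {0}) (\<lambda>y. f y - f x) b =
      hom_induced ?n (top_of_set U') (U' - {x}) euclidean (- {0}) (\<lambda>y. y - x) b"
    using U'(1,3) b(1) unfolding orientation_preserving_on_def by blast
  then show "hom_induced ?n (top_of_set U) (U - {x}) euclidean (- {0}) (\<lambda>y. f y - f x) a =
      hom_induced ?n (top_of_set U) (U - {x}) euclidean (- {0}) (\<lambda>y. y - x) a"
    using push[OF f] push[OF continuous_on_id inj_on_id2] by simp
qed

text \<open>A local class a at y is the image under f of b = g_* a at x = g y. Translating y to 0
  sends a to (f - f x)_* b. By the hypothesis on f this equals the class of b translated from x to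
  0, which is (g - g y)_* a.\<close>

lemma orientation_preserving_on_inverse:
  fixes f g :: "real ^ 'n::finite \<Rightarrow> real ^ 'n"
  assumes hom: "homeomorphism U V f g" and f: "orientation_preserving_on U f"
  shows "orientation_preserving_on V g"
  unfolding orientation_preserving_on_def
proof (intro ballI)
  let ?n = "int CARD('n)"
  fix y a assume y: "y \<in> V" and a: "a \<in> carrier (relative_homology_group ?n (top_of_set V) (V - {y}))"
  define x where "x = g y"
  have x: "x \<in> U" "f x = y"
    using hom y unfolding homeomorphism_def x_def by auto
  have fg: "f z \<in> V" "g (f z) = z" if "z \<in> U" for z
    using hom that unfolding homeomorphism_def by auto
  have gf: "g z \<in> U" "f (g z) = z" if "z \<in> V" for z
    using hom that unfolding homeomorphism_def by auto
  have inj_f: "inj_on f U"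
    by (rule inj_on_inverseI[of _ g]) (rule fg(2))
  have inj_g: "inj_on g V"
    by (rule inj_on_inverseI[of _ f]) (rule gf(2))
  have cf: "continuous_on U f" and cg: "continuous_on V g"
    using hom unfolding homeomorphism_def by simp_all
  have mf: "continuous_map (top_of_set U) (top_of_set V) f" "f \<in> U - {x} \<rightarrow> V - {y}"
    using cf fg x inj_f by (auto simp: continuous_map_in_subtopology inj_on_eq_iff)
  have mg: "continuous_map (top_of_set V) (top_of_set U) g" "g \<in> V - {y} \<rightarrow> U - {x}"
    using cg gf y inj_g unfolding x_def by (auto simp: continuous_map_in_subtopology inj_on_eq_iff)
  define b where "b = hom_induced ?n (top_of_set V) (V - {y}) (top_of_set U) (U - {x}) g a"
  have b: "b \<in> carrier (relative_homology_group ?n (top_of_set U) (U - {x}))"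
    unfolding b_def by (rule hom_induced_carrier)
  have "hom_induced ?n (top_of_set U) (U - {x}) (top_of_set V) (V - {y}) f b =
      hom_induced ?n (top_of_set V) (V - {y}) (top_of_set V) (V - {y}) (f \<circ> g) a"
    unfolding b_def by (rule hom_induced_compose'[OF mg mf])
  also have "\<dots> = a"
    \<comment> \<open>f o g is the identity on V only, not as a function on the whole type.\<close>
    by (rule hom_induced_id_gen) (use gf a in auto)
  finally have fb: "hom_induced ?n (top_of_set U) (U - {x}) (top_of_set V) (V - {y}) f b = a" .
  note shift_V = continuous_map_diff_point[OF continuous_on_id inj_on_id2 y]
  note shift_U = continuous_map_diff_point[OF continuous_on_id inj_on_id2 x(1)]
  have "hom_induced ?n (top_of_set V) (V - {y}) euclidean (- {0}) (\<lambda>z. z - y) a =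
      hom_induced ?n (top_of_set U) (U - {x}) euclidean (- {0}) ((\<lambda>z. z - y) \<circ> f) b"
    unfolding fb[symmetric] by (rule hom_induced_compose'[OF mf shift_V])
  also have "\<dots> = hom_induced ?n (top_of_set U) (U - {x}) euclidean (- {0}) (\<lambda>z. f z - f x) b"
    by (simp add: o_def x(2))
  also have "\<dots> = hom_induced ?n (top_of_set U) (U - {x}) euclidean (- {0}) (\<lambda>z. z - x) b"
    using f x(1) b unfolding orientation_preserving_on_def by blast
  also have "\<dots> = hom_induced ?n (top_of_set V) (V - {y}) euclidean (- {0}) ((\<lambda>z. z - x) \<circ> g) a"
    unfolding b_def by (rule hom_induced_compose'[OF mg shift_U])
  finally show "hom_induced ?n (top_of_set V) (V - {y}) euclidean (- {0}) (\<lambda>z. g z - g y) a =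
      hom_induced ?n (top_of_set V) (V - {y}) euclidean (- {0}) (\<lambda>z. z - y) a"
    by (simp add: o_def x_def)
qed

lemma orientation_preserving_on_id: "orientation_preserving_on U (\<lambda>x. x)"
  unfolding orientation_preserving_on_def by simp

text \<open>The counterpart of \<open>cat_dependent\<close> for orientations, so that statements
  about N can be moved to M or E along i and j. Inverting c on W itself, rather than on the domain
  of a chart, makes it depend on W, c and d alone; \<open>orientation_related_inv_into\<close>
  returns to charts.\<close>

definition orientation_related ::
    "'p set \<Rightarrow> ('p \<Rightarrow> real ^ 'n::finite) \<Rightarrow> ('p \<Rightarrow> real ^ 'n) \<Rightarrow> bool" where
  "orientation_related W c d \<longleftrightarrow> orientation_preserving_on (c ` W) (d \<circ> inv_into W c)"

lemma orientation_related_inv_into: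
  assumes "inj_on c U" "W \<subseteq> U"
  shows "orientation_preserving_on (c ` W) (d \<circ> inv_into U c) \<longleftrightarrow> orientation_related W c d"
  unfolding orientation_related_def
proof (rule orientation_preserving_on_cong)
  fix z assume "z \<in> c ` W"
  then obtain x where "x \<in> W" "z = c x"
    by blast
  then show "(d \<circ> inv_into U c) z = (d \<circ> inv_into W c) z"
    using inv_into_f_f[OF assms(1), of x] inv_into_f_f[OF inj_on_subset[OF assms], of x] assms(2) by auto
qed

lemma orientation_related_cong:
  assumes "inj_on c W" "\<And>x. x \<in> W \<Longrightarrow> c x = c' x" "\<And>x. x \<in> W \<Longrightarrow> d x = d' x"
  shows "orientation_related W c d \<longleftrightarrow> orientation_related W c' d'"
proof -
  have inj': "inj_on c' W"
    using assms(1) inj_on_cong[of W c c'] assms(2) by blast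
  have im: "c ` W = c' ` W"
    using assms(2) by (rule image_cong[OF refl])
  show ?thesis
    unfolding orientation_related_def im
  proof (rule orientation_preserving_on_cong)
    fix z assume "z \<in> c' ` W"
    then obtain x where x: "x \<in> W" "z = c' x"
      by blast
    then have "inv_into W c z = x" "inv_into W c' z = x"
      using inv_into_f_f[OF assms(1) x(1)] inv_into_f_f[OF inj' x(1)] assms(2) by simp_all
    then show "(d \<circ> inv_into W c) z = (d' \<circ> inv_into W c') z"
      using assms(3)[OF x(1)] by simp
  qed
qed

lemma orientation_related_image:
  assumes "inj_on (c \<circ> h) W"
  shows "orientation_related (h ` W) c d \<longleftrightarrow> orientation_related W (c \<circ> h) (d \<circ> h)"
proof -
  have inj: "inj_on c (h ` W)"
    using assms by (rule inj_on_imageI)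
  show ?thesis
    unfolding orientation_related_def image_comp[symmetric]
  proof (rule orientation_preserving_on_cong)
    fix z assume "z \<in> c ` h ` W"
    then obtain x where x: "x \<in> W" "z = c (h x)"
      by blast
    then have "inv_into (h ` W) c z = h x" "inv_into W (c \<circ> h) z = x"
      using inv_into_f_f[OF inj, of "h x"] inv_into_f_f[OF assms x(1)] by simp_all
    then show "(d \<circ> inv_into (h ` W) c) z = (d \<circ> h \<circ> inv_into W (c \<circ> h)) z"
      by simp
  qed
qed

lemma orientation_related_refl: "inj_on c W \<Longrightarrow> orientation_related W c c"
  unfolding orientation_related_def
  by (subst orientation_preserving_on_cong[where g = "\<lambda>x. x"])
    (auto simp: orientation_preserving_on_id)

lemma cat_dependent_continuous_on:
  assumes "inj_on c W" "cat_dependent C W c d"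
  shows "continuous_on (c ` W) (d \<circ> inv_into W c)"
proof -
  from assms(2) obtain f where f: "cat_map C (c ` W) f" "\<forall>x\<in>W. f (c x) = d x"
    by (rule cat_dependentE)
  have "(d \<circ> inv_into W c) z = f z" if "z \<in> c ` W" for z
    using that f(2) assms(1) by auto
  with cat_map_imp_continuous_on[OF f(1)] show ?thesis
    using continuous_on_cong[OF refl] by metis
qed

text \<open>CAT dependence enters through continuity: in both directions it makes the coordinate
  change a homeomorphism, so the lemma on inverses applies.\<close>

lemma orientation_related_sym:
  assumes c: "inj_on c W" and d: "inj_on d W"
    and dep: "cat_dependent C W c d" "cat_dependent C W d c"
    and "orientation_related W c d"
  shows "orientation_related W d c"
proof -
  have "homeomorphism (c ` W) (d ` W) (d \<circ> inv_into W c) (c \<circ> inv_into W d)"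
    unfolding homeomorphism_def
    using cat_dependent_continuous_on[OF c dep(1)] cat_dependent_continuous_on[OF d dep(2)] c d
      image_push[OF c order_refl, of d] image_push[OF d order_refl, of c] by simp
  from orientation_preserving_on_inverse[OF this] assms(5) show ?thesis
    unfolding orientation_related_def by blast
qed

lemma orientation_related_locally:
  assumes c: "inj_on c W" and d: "inj_on d W" and dep: "cat_dependent C W c d"
    and loc: "\<And>x. x \<in> W \<Longrightarrow> \<exists>W'. x \<in> W' \<and> W' \<subseteq> W \<and> openin (top_of_set (c ` W)) (c ` W') \<and>
      orientation_related W' c d"
  shows "orientation_related W c d"
  unfolding orientation_related_def
proof (rule orientation_preserving_on_locally)
  show "continuous_on (c ` W) (d \<circ> inv_into W c)"
    using c dep by (rule cat_dependent_continuous_on)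
  show "inj_on (d \<circ> inv_into W c) (c ` W)"
    using c d by (auto simp: inj_on_def)
  fix z assume "z \<in> c ` W"
  then obtain x where x: "x \<in> W" "z = c x"
    by blast
  from loc[OF x(1)] obtain W' where W': "x \<in> W'" "W' \<subseteq> W" "openin (top_of_set (c ` W)) (c ` W')"
      "orientation_related W' c d"
    by (elim exE conjE)
  then have "orientation_preserving_on (c ` W') (d \<circ> inv_into W c)"
    using orientation_related_inv_into[OF c W'(2)] by blast
  with W' x(2) show "\<exists>U'. z \<in> U' \<and> openin (top_of_set (c ` W)) U' \<and>
      orientation_preserving_on U' (d \<circ> inv_into W c)"
    by (intro exI[of _ "c ` W'"]) simp
qed

lemma orientation_related_push:
  assumes "inj_on h S" "U \<subseteq> S" "inj_on c U"
  shows "orientation_related (h ` U \<inter> V) (c \<circ> inv_into S h) d \<longleftrightarrow> orientation_related (U \<inter> h -` V) c (d \<circ> h)"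
proof -
  have im: "h ` U \<inter> V = h ` (U \<inter> h -` V)"
    by auto
  have e: "(c \<circ> inv_into S h \<circ> h) x = c x" if "x \<in> U \<inter> h -` V" for x
    using that assms(2) inv_into_f_f[OF assms(1), of x] by auto
  have "inj_on c (U \<inter> h -` V)"
    using assms(3) by (rule inj_on_subset) simp
  then have inj: "inj_on (c \<circ> inv_into S h \<circ> h) (U \<inter> h -` V)"
    using e inj_on_cong[of "U \<inter> h -` V" "c \<circ> inv_into S h \<circ> h" c] by blast
  show ?thesis
    unfolding im orientation_related_image[OF inj]
    by (rule orientation_related_cong[OF inj]) (simp_all only: e)
qed

section \<open>The orientation of the quotient\<close>

context handle_gluing
begin

text \<open>A transported chart has the same image as the original one, so it exhibits the same
  points as interior; the chart of the handle has image R^n, so it makes all of its points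
  interior.\<close>

lemma mfd_interior_N: "mfd_interior N_mfd = i ` mfd_interior M \<union> j ` handle_carrier k"
proof
  show "mfd_interior N_mfd \<subseteq> i ` mfd_interior M \<union> j ` handle_carrier k"
  proof
    fix z assume "z \<in> mfd_interior N_mfd"
    then obtain W e where We: "(W, e) \<in> matlas N_mfd" "z \<in> W" "e z \<in> interior (e ` W)"
      unfolding mfd_interior_def by auto
    from We(1) show "z \<in> i ` mfd_interior M \<union> j ` handle_carrier k"
    proof (cases rule: N_mfd_chart_cases)
      case (1 U c)
      then obtain x where x: "x \<in> U" "z = i x"
        using We(2) by auto
      have U: "U \<subseteq> topspace X"
        using coord_chart_subset[OF matlas_chart(2)[OF 1(1)]] .
      then have "e z = c x"
        using 1(2) x inv_into_f_f[OF inj_i, of x "topspace X"] by auto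
      moreover have "e ` W = c ` U"
        using 1(2) image_push[OF inj_i U, of c] by simp
      ultimately have "x \<in> mfd_interior M"
        using We(3) 1(1) x(1) unfolding mfd_interior_def by auto
      with x(2) show ?thesis
        by blast
    next
      case 2
      with We(2) show ?thesis
        by simp
    qed
  qed
  show "i ` mfd_interior M \<union> j ` handle_carrier k \<subseteq> mfd_interior N_mfd"
  proof
    fix z assume "z \<in> i ` mfd_interior M \<union> j ` handle_carrier k"
    then consider x where "x \<in> mfd_interior M" "z = i x" | "z \<in> j ` handle_carrier k"
      by blast
    then show "z \<in> mfd_interior N_mfd"
    proof cases
      case 1
      then obtain U c where Uc: "(U, c) \<in> matlas M" "x \<in> U" "c x \<in> interior (c ` U)"
        unfolding mfd_interior_def by auto
      have U: "U \<subseteq> topspace X"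
        using coord_chart_subset[OF matlas_chart(2)[OF Uc(1)]] .
      have "push_i c z = c x"
        using 1(2) Uc(2) U inv_into_f_f[OF inj_i, of x "topspace X"] by auto
      moreover have "push_i c ` i ` U = c ` U"
        by (rule image_push[OF inj_i U])
      moreover have "(i ` U, push_i c) \<in> matlas N_mfd"
        unfolding matlas_N_mfd using Uc(1) by force
      moreover have "z \<in> i ` U"
        using 1(2) Uc(2) by blast
      ultimately show ?thesis
        unfolding mfd_interior_def using Uc(3)
        by (intro CollectI bexI[of _ "(i ` U, push_i c)"]) simp_all
    next
      case 2
      have "snd j_chart ` fst j_chart = UNIV"
        using image_push[OF inj_j order_refl, of "handle_coord k"] handle_coord_carrier[of k] by simp
      moreover have "j_chart \<in> matlas N_mfd"
        unfolding matlas_N_mfd by simp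
      ultimately show ?thesis
        unfolding mfd_interior_def using 2
        by (intro CollectI bexI[of _ j_chart]) simp_all
    qed
  qed
qed

lemma openin_glue_preimage:
  assumes "openin X V"
  shows "openin E (D \<inter> \<phi> -` V)"
proof -
  have "openin (top_of_set D) {y \<in> topspace (top_of_set D). \<phi> y \<in> V}"
    using continuous_glue assms by (rule openin_continuous_map_preimage)
  moreover have "{y \<in> topspace (top_of_set D). \<phi> y \<in> V} = D \<inter> \<phi> -` V"
    by auto
  ultimately show ?thesis
    using openin_handle_ends openin_trans by fastforce
qed

section \<open>An orientation of M for which the handle is oriented\<close>

context
  fixes \<O> :: "('p, 'n) chart set"
  assumes \<O>: "is_orientation C M \<O>" and oriented: "oriented_handle k \<O> \<phi>p \<phi>n"
begin

abbreviation "\<O>N \<equiv> handle_atlas k M \<phi>p \<phi>n \<O>"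

lemma oriented_chart:
  assumes "(U, c) \<in> \<O>"
  shows "is_chart X (U, c)" "coord_chart X U c" "inj_on c U" "U \<subseteq> topspace X" "open (c ` U)"
    "\<forall>\<kappa>\<in>matlas M. compatible_charts C (U, c) \<kappa>"
proof -
  have *: "is_chart X (U, c) \<and> open (c ` U) \<and> (\<forall>\<kappa>\<in>matlas M. compatible_charts C (U, c) \<kappa>)"
    using \<O> assms unfolding is_orientation_def by fastforce
  then show "is_chart X (U, c)" "open (c ` U)" "\<forall>\<kappa>\<in>matlas M. compatible_charts C (U, c) \<kappa>"
    by simp_all
  from * show c: "coord_chart X U c"
    by (simp add: is_chart_iff)
  from c show "inj_on c U"
    by (rule coord_chart_inj_on)
  from c show "U \<subseteq> topspace X"
    by (rule coord_chart_subset)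
qed

lemma orientation_related_i_i:
  assumes Uc: "(U, c) \<in> \<O>" and Vd: "(V, d) \<in> \<O>"
  shows "orientation_related (i ` U \<inter> i ` V) (push_i c) (push_i d)"
proof -
  have "orientation_preserving_on (c ` (U \<inter> V)) (d \<circ> inv_into U c)"
    using \<O> Uc Vd unfolding is_orientation_def by fast
  then have "orientation_related (U \<inter> V) c d"
    using orientation_related_inv_into[OF oriented_chart(3)[OF Uc], of "U \<inter> V"] by simp
  moreover have inj: "inj_on c (U \<inter> V)"
    using oriented_chart(3)[OF Uc] by (rule inj_on_subset) simp
  have e: "(push_i d \<circ> i) x = d x" if "x \<in> U \<inter> V" for x
    using that oriented_chart(4)[OF Vd] inv_into_f_f[OF inj_i, of x "topspace X"] by auto
  have "orientation_related (U \<inter> V) c d \<longleftrightarrow> orientation_related (U \<inter> V) c (push_i d \<circ> i)"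
    by (rule orientation_related_cong[OF inj]) (simp_all only: e)
  moreover have "U \<inter> i -` i ` V = U \<inter> V"
    by (auto simp: i_eq_iff)
  ultimately show ?thesis
    unfolding orientation_related_push[OF inj_i oriented_chart(4,3)[OF Uc]] by simp
qed

text \<open>\<open>oriented_handle\<close> gives local degree 1 separately on the positive and the
  negative end. These are open and cover the ends of E, and local degree is a local matter.\<close>

lemma orientation_related_glue:
  assumes Vd: "(V, d) \<in> \<O>"
  shows "orientation_related (D \<inter> \<phi> -` V) (handle_coord k) (d \<circ> \<phi>)"
proof (rule orientation_related_locally)
  let ?W = "D \<inter> \<phi> -` V"
  have WE: "?W \<subseteq> handle_carrier k"
    using D_subset by blast
  show inj: "inj_on (handle_coord k) ?W"
    using inj_on_handle_coord WE by (rule inj_on_subset)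
  have "inj_on \<phi> ?W"
    using inj_glue by (rule inj_on_subset) simp
  then show "inj_on (d \<circ> \<phi>) ?W"
    by (rule comp_inj_on) (rule inj_on_subset[OF oriented_chart(3)[OF Vd]], auto)
  have "compatible_charts C (i ` V, push_i d) (fst j_chart, snd j_chart)"
    using compatible_i_j[OF oriented_chart(2,6)[OF Vd]] by simp
  then show "cat_dependent C ?W (handle_coord k) (d \<circ> \<phi>)"
    unfolding compatible_charts_iff[OF coord_chart_inj_on[OF coord_chart_push_i[OF oriented_chart(2)[OF Vd]]]]
      cat_dependent_overlap_iff[OF oriented_chart(4)[OF Vd]] by blast
  have openV: "openin X V"
    using oriented_chart(2)[OF Vd] unfolding coord_chart_def by blast
  \<comment> \<open>\<open>\<psi>\<close> stands for \<open>\<phi>p\<close> or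
    \<open>\<phi>n\<close>, and P for the end on which it coincides with the common map
    \<open>\<phi>\<close>.\<close>
  have half: "orientation_related (?W \<inter> P) (handle_coord k) (d \<circ> \<phi>)"
    if P: "P \<subseteq> D" and eq: "\<forall>y\<in>P. \<phi> y = \<psi> y"
      and op: "orientation_preserving_map (restrict_atlas P (matlas (handle_mfd k))) \<O> \<psi>" for P \<psi>
  proof -
    have PE: "handle_carrier k \<inter> P = P"
      using P D_subset by blast
    have "orientation_preserving_on (handle_coord k ` (P \<inter> \<psi> -` V)) (d \<circ> \<psi> \<circ> inv_into P (handle_coord k))"
      using op Vd unfolding orientation_preserving_map_def restrict_atlas_def matlas_handle_mfd
      by (auto simp: PE)
    moreover have PW: "P \<inter> \<psi> -` V = ?W \<inter> P"
      using P eq by auto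
    moreover have "inj_on (handle_coord k) P"
      using inj_on_handle_coord PE by (metis inf.cobounded1 inj_on_subset)
    ultimately have "orientation_related (?W \<inter> P) (handle_coord k) (d \<circ> \<psi>)"
      using orientation_related_inv_into[of "handle_coord k" P "?W \<inter> P" "d \<circ> \<psi>"] by simp
    moreover have "inj_on (handle_coord k) (?W \<inter> P)"
      using inj Int_lower1 by (rule inj_on_subset)
    then have "orientation_related (?W \<inter> P) (handle_coord k) (d \<circ> \<phi>) \<longleftrightarrow>
        orientation_related (?W \<inter> P) (handle_coord k) (d \<circ> \<psi>)"
      by (rule orientation_related_cong) (use eq in simp_all)
    ultimately show ?thesis
      by simp
  qed
  have op: "openin (top_of_set (handle_coord k ` ?W)) (handle_coord k ` (?W \<inter> P))"
    if "openin E P" for P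
    using coord_chart_openin_image[OF coord_chart_handle openin_Int[OF openin_glue_preimage[OF openV] that] Int_lower1 WE] .
  have pos: "orientation_related (?W \<inter> handle_pos k) (handle_coord k) (d \<circ> \<phi>)"
    by (rule half[of "handle_pos k" \<phi>p]) (use oriented in \<open>auto simp: oriented_handle_def handle_ends_def handle_glue_def handle_pos_def\<close>)
  have neg: "orientation_related (?W \<inter> handle_neg k) (handle_coord k) (d \<circ> \<phi>)"
    by (rule half[of "handle_neg k" \<phi>n]) (use oriented in \<open>auto simp: oriented_handle_def handle_ends_def handle_glue_def handle_neg_def\<close>)
  fix y assume y: "y \<in> ?W"
  then consider "y \<in> handle_pos k" | "y \<in> handle_neg k"
    unfolding handle_ends_def by blast
  then show "\<exists>W'. y \<in> W' \<and> W' \<subseteq> ?W \<and> openin (top_of_set (handle_coord k ` ?W)) (handle_coord k ` W') \<and>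
      orientation_related W' (handle_coord k) (d \<circ> \<phi>)"
  proof cases
    case 1
    then show ?thesis
      using y pos op[OF openin_handle_pos] by (intro exI[of _ "?W \<inter> handle_pos k"] conjI IntI[of y ?W] Int_lower1)
  next
    case 2
    then show ?thesis
      using y neg op[OF openin_handle_neg] by (intro exI[of _ "?W \<inter> handle_neg k"] conjI IntI[of y ?W] Int_lower1)
  qed
qed

lemma orientation_related_j_i:
  assumes Vd: "(V, d) \<in> \<O>"
  shows "orientation_related (fst j_chart \<inter> i ` V) (snd j_chart) (push_i d)"
proof -
  let ?W = "D \<inter> \<phi> -` V"
  have WE: "?W \<subseteq> handle_carrier k"
    using D_subset by blast
  have e: "(snd j_chart \<circ> j) y = handle_coord k y" "(push_i d \<circ> j) y = (d \<circ> \<phi>) y" if "y \<in> ?W" for y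
    using that subsetD[OF D_subset, of y] by (simp_all only: IntD1 j_chart_j push_i_j)
  have "inj_on (handle_coord k) ?W"
    using inj_on_handle_coord WE by (rule inj_on_subset)
  then have inj: "inj_on (snd j_chart \<circ> j) ?W"
    using e(1) inj_on_cong[of ?W "snd j_chart \<circ> j" "handle_coord k"] by blast
  have set: "fst j_chart \<inter> i ` V = j ` ?W"
    using i_j_overlap[OF oriented_chart(4)[OF Vd]] by (simp add: Int_commute)
  have "orientation_related ?W (snd j_chart \<circ> j) (push_i d \<circ> j) \<longleftrightarrow>
      orientation_related ?W (handle_coord k) (d \<circ> \<phi>)"
    by (rule orientation_related_cong[OF inj]) (simp_all only: e)
  with orientation_related_glue[OF Vd] show ?thesis
    unfolding set orientation_related_image[OF inj] by blast
qed

text \<open>The hypothesis on the handle speaks only of coordinate changes from E to M; this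
  direction is obtained by inverting them.\<close>

lemma orientation_related_i_j:
  assumes Vd: "(V, d) \<in> \<O>"
  shows "orientation_related (i ` V \<inter> fst j_chart) (push_i d) (snd j_chart)"
proof (rule orientation_related_sym)
  note inj_d = coord_chart_inj_on[OF coord_chart_push_i[OF oriented_chart(2)[OF Vd]]]
  show "inj_on (snd j_chart) (i ` V \<inter> fst j_chart)"
    using inj_on_j_chart by (rule inj_on_subset) simp
  show "inj_on (push_i d) (i ` V \<inter> fst j_chart)"
    using inj_d by (rule inj_on_subset) simp
  have "compatible_charts C (i ` V, push_i d) (fst j_chart, snd j_chart)"
    using compatible_i_j[OF oriented_chart(2,6)[OF Vd]] by simp
  then show "cat_dependent C (i ` V \<inter> fst j_chart) (snd j_chart) (push_i d)"
    "cat_dependent C (i ` V \<inter> fst j_chart) (push_i d) (snd j_chart)"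
    unfolding compatible_charts_iff[OF inj_d] by blast+
  show "orientation_related (i ` V \<inter> fst j_chart) (snd j_chart) (push_i d)"
    using orientation_related_j_i[OF Vd] by (simp only: Int_commute)
qed

lemma handle_atlas_chart_cases:
  assumes "\<kappa> \<in> \<O>N"
  obtains U c where "(U, c) \<in> \<O>" "\<kappa> = (i ` U, push_i c)" | "\<kappa> = j_chart"
  using assms unfolding handle_atlas_eq by auto

lemma orientation_related_from_i:
  assumes Uc: "(U, c) \<in> \<O>" and \<kappa>: "\<kappa> \<in> \<O>N"
  shows "orientation_related (i ` U \<inter> fst \<kappa>) (push_i c) (snd \<kappa>)"
  using \<kappa>
proof (cases rule: handle_atlas_chart_cases)
  case (1 V d)
  then show ?thesis
    using orientation_related_i_i[OF Uc 1(1)] by simp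
next
  case 2
  show ?thesis
    unfolding 2 by (rule orientation_related_i_j[OF Uc])
qed

lemma orientation_related_from_j:
  assumes \<kappa>: "\<kappa> \<in> \<O>N"
  shows "orientation_related (fst j_chart \<inter> fst \<kappa>) (snd j_chart) (snd \<kappa>)"
  using \<kappa>
proof (cases rule: handle_atlas_chart_cases)
  case (1 V d)
  then show ?thesis
    using orientation_related_j_i[OF 1(1)] by simp
next
  case 2
  show ?thesis
    unfolding 2 using orientation_related_refl[OF inj_on_j_chart] by simp
qed

lemma handle_atlas_chart:
  assumes \<kappa>: "\<kappa> \<in> \<O>N"
  shows "is_chart N \<kappa>" "open (snd \<kappa> ` fst \<kappa>)" "\<forall>\<kappa>'\<in>matlas N_mfd. compatible_charts C \<kappa> \<kappa>'"
    "inj_on (snd \<kappa>) (fst \<kappa>)"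
proof -
  show chart: "is_chart N \<kappa>"
    using \<kappa> by (cases rule: handle_atlas_chart_cases) (use is_chart_push_i oriented_chart(1) is_chart_j in auto)
  show "open (snd \<kappa> ` fst \<kappa>)"
    using \<kappa>
  proof (cases rule: handle_atlas_chart_cases)
    case (1 U c)
    then show ?thesis
      using image_push[OF inj_i oriented_chart(4)[OF 1(1)], of c] oriented_chart(5)[OF 1(1)] by simp
  next
    case 2
    then show ?thesis
      using image_push[OF inj_j order_refl, of "handle_coord k"] handle_coord_carrier[of k] by simp
  qed
  show "\<forall>\<kappa>'\<in>matlas N_mfd. compatible_charts C \<kappa> \<kappa>'"
    using \<kappa>
  proof (cases rule: handle_atlas_chart_cases)
    case (1 U c)
    show ?thesis
      unfolding 1(2) using compatible_push_i[OF oriented_chart(2,6)[OF 1(1)]] by blast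
  next
    case 2
    show ?thesis
      unfolding 2 using compatible_j by blast
  qed
  have "coord_chart N (fst \<kappa>) (snd \<kappa>)"
    using chart is_chart_iff[of N "fst \<kappa>" "snd \<kappa>"] by simp
  then show "inj_on (snd \<kappa>) (fst \<kappa>)"
    by (rule coord_chart_inj_on)
qed

lemma orientation_N: "is_orientation C N_mfd \<O>N"
  unfolding is_orientation_def mspace_N_mfd
proof (intro conjI ballI)
  fix \<kappa> assume \<kappa>: "\<kappa> \<in> \<O>N"
  show "is_chart N \<kappa>" "open (snd \<kappa> ` fst \<kappa>)"
    by (rule handle_atlas_chart[OF \<kappa>])+
  show "compatible_charts C \<kappa> \<kappa>'" if "\<kappa>' \<in> matlas N_mfd" for \<kappa>'
    using handle_atlas_chart(3)[OF \<kappa>] that by blast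
next
  have "(\<Union>\<kappa>\<in>\<O>N. fst \<kappa>) = i ` (\<Union>\<kappa>\<in>\<O>. fst \<kappa>) \<union> j ` handle_carrier k"
    unfolding handle_atlas_eq by (auto simp: split_def)
  moreover have "(\<Union>\<kappa>\<in>\<O>. fst \<kappa>) = mfd_interior M"
    using \<O> unfolding is_orientation_def by blast
  ultimately show "(\<Union>\<kappa>\<in>\<O>N. fst \<kappa>) = mfd_interior N_mfd"
    unfolding mfd_interior_N by simp
next
  have "orientation_preserving_on (snd \<kappa> ` (fst \<kappa> \<inter> fst \<kappa>')) (snd \<kappa>' \<circ> inv_into (fst \<kappa>) (snd \<kappa>))"
    if \<kappa>: "\<kappa> \<in> \<O>N" and \<kappa>': "\<kappa>' \<in> \<O>N" for \<kappa> \<kappa>'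
  proof -
    have "orientation_related (fst \<kappa> \<inter> fst \<kappa>') (snd \<kappa>) (snd \<kappa>')"
      using \<kappa>
    proof (cases rule: handle_atlas_chart_cases)
      case (1 U c)
      then show ?thesis
        using orientation_related_from_i[OF 1(1) \<kappa>'] by simp
    next
      case 2
      show ?thesis
        unfolding 2 by (rule orientation_related_from_j[OF \<kappa>'])
    qed
    then show ?thesis
      using orientation_related_inv_into[OF handle_atlas_chart(4)[OF \<kappa>]] by blast
  qed
  then show "case \<kappa> of (U, c) \<Rightarrow> \<forall>(V, d)\<in>\<O>N.
      orientation_preserving_on (c ` (U \<inter> V)) (d \<circ> inv_into U c)"
    if "\<kappa> \<in> \<O>N" for \<kappa>
    using that by (auto simp: split_def)
qed

lemma orientation_preserving_i: "orientation_preserving_map \<O> \<O>N i"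
proof -
  have "orientation_preserving_on (c ` (U \<inter> i -` V)) (d \<circ> i \<circ> inv_into U c)"
    if Uc: "(U, c) \<in> \<O>" and Vd: "(V, d) \<in> \<O>N" for U c V d
  proof -
    have "orientation_related (i ` U \<inter> V) (push_i c) d"
      using orientation_related_from_i[OF Uc Vd] by simp
    then have "orientation_related (U \<inter> i -` V) c (d \<circ> i)"
      unfolding orientation_related_push[OF inj_i oriented_chart(4,3)[OF Uc]] .
    then show ?thesis
      using orientation_related_inv_into[OF oriented_chart(3)[OF Uc], of "U \<inter> i -` V"] by simp
  qed
  then show ?thesis
    unfolding orientation_preserving_map_def by blast
qed

lemma orientation_preserving_j:
  "orientation_preserving_map (matlas (handle_mfd k)) \<O>N j"
proof -
  have "orientation_preserving_on (handle_coord k ` (handle_carrier k \<inter> j -` V))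
      (d \<circ> j \<circ> inv_into (handle_carrier k) (handle_coord k))"
    if Vd: "(V, d) \<in> \<O>N" for V d
  proof -
    have "orientation_related (j ` handle_carrier k \<inter> V) (snd j_chart) d"
      using orientation_related_from_j[OF Vd] by simp
    then have "orientation_related (handle_carrier k \<inter> j -` V) (handle_coord k) (d \<circ> j)"
      unfolding snd_conv orientation_related_push[OF inj_j order_refl inj_on_handle_coord] .
    then show ?thesis
      using orientation_related_inv_into[OF inj_on_handle_coord, of "handle_carrier k \<inter> j -` V"] by simp
  qed
  then show ?thesis
    unfolding orientation_preserving_map_def matlas_handle_mfd by blast
qed

end

end

section \<open>Gluing both ends\<close>

text \<open>The condition involving \<open>\<epsilon>\<close> says that \<open>\<phi>\<close> converges to infinity in \<open>M\<close> at the end \<open>t = 0\<close>.\<close>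

definition handle_end_map ::
    "cat \<Rightarrow> 'n::finite \<Rightarrow> ('p, 'n) mfd \<Rightarrow> 'n handle_pt set \<Rightarrow> ('n handle_pt \<Rightarrow> 'p) \<Rightarrow> bool" where
  "handle_end_map C k M P \<phi> \<longleftrightarrow>
     openin (handle_space k) P \<and> inj_on \<phi> P \<and>
     continuous_map (top_of_set P) (mspace M) \<phi> \<and> open_map (top_of_set P) (mspace M) \<phi> \<and>
     \<phi> ` P \<subseteq> mfd_interior M \<and>
     (\<forall>x\<in>topspace (mspace M). \<exists>\<epsilon> Q. 0 < \<epsilon> \<and> openin (mspace M) Q \<and> x \<in> Q \<and>
        (\<forall>p\<in>P. \<bar>fst p\<bar> < \<epsilon> \<longrightarrow> \<phi> p \<notin> Q)) \<and>
     (\<forall>(V, d)\<in>matlas M. cat_related C (P \<inter> \<phi> -` V) (handle_coord k) (d \<circ> \<phi>))"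

text \<open>Lets the two attaching maps be replaced by their common extension
  \<open>handle_glue\<close>, which agrees with each of them on its own end only.\<close>

lemma handle_end_map_cong:
  assumes "handle_end_map C k M P \<phi>" "\<And>p. p \<in> P \<Longrightarrow> \<psi> p = \<phi> p"
  shows "handle_end_map C k M P \<psi>"
proof -
  have inj: "inj_on \<psi> P \<longleftrightarrow> inj_on \<phi> P"
    using assms(2) by (rule inj_on_cong)
  have cont: "continuous_map (top_of_set P) (mspace M) \<psi> \<longleftrightarrow> continuous_map (top_of_set P) (mspace M) \<phi>"
    by (intro iffI) (erule continuous_map_eq, simp add: assms(2))+
  have im: "\<psi> ` Q = \<phi> ` Q" if "Q \<subseteq> P" for Q
    using that assms(2) by (intro image_cong) auto
  have op: "open_map (top_of_set P) (mspace M) \<psi> \<longleftrightarrow> open_map (top_of_set P) (mspace M) \<phi>"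
    unfolding open_map_def using im openin_imp_subset by metis
  have vim: "P \<inter> \<psi> -` V = P \<inter> \<phi> -` V" for V
    using assms(2) by auto
  have dep: "cat_dependent C (P \<inter> \<phi> -` V) (handle_coord k) (d \<circ> \<psi>) \<longleftrightarrow>
      cat_dependent C (P \<inter> \<phi> -` V) (handle_coord k) (d \<circ> \<phi>)"
    "cat_dependent C (P \<inter> \<phi> -` V) (d \<circ> \<psi>) (handle_coord k) \<longleftrightarrow>
      cat_dependent C (P \<inter> \<phi> -` V) (d \<circ> \<phi>) (handle_coord k)" for V d
    by (rule cat_dependent_cong; simp add: assms(2))+
  have sep: "(\<forall>p\<in>P. \<bar>fst p\<bar> < \<epsilon> \<longrightarrow> \<psi> p \<notin> Q) \<longleftrightarrow> (\<forall>p\<in>P. \<bar>fst p\<bar> < \<epsilon> \<longrightarrow> \<phi> p \<notin> Q)" for \<epsilon> Q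
    using assms(2) by simp
  show ?thesis
    using assms(1) unfolding handle_end_map_def inj cont op im[OF order_refl] vim dep sep .
qed

text \<open>Continuity, openness and the CAT conditions are local, and P and Q are open.
  Disjointness of the images is what makes the combined map injective.\<close>

lemma handle_end_map_Un:
  assumes M: "cat_manifold C M"
    and P: "handle_end_map C k M P \<phi>" and Q: "handle_end_map C k M Q \<phi>"
    and disjoint: "\<phi> ` P \<inter> \<phi> ` Q = {}"
  shows "handle_end_map C k M (P \<union> Q) \<phi>"
proof -
  let ?E = "handle_space k" and ?X = "mspace M"
  have openP: "openin ?E P" and openQ: "openin ?E Q"
    using P Q unfolding handle_end_map_def by blast+
  have PQE: "P \<union> Q \<subseteq> handle_carrier k"
    using openin_imp_subset[OF openP] openin_imp_subset[OF openQ] by simp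
  have inj: "inj_on \<phi> (P \<union> Q)"
    using P Q disjoint unfolding handle_end_map_def inj_on_Un by blast
  have cont: "continuous_map (top_of_set P) ?X \<phi>" "continuous_map (top_of_set Q) ?X \<phi>"
    using P Q unfolding handle_end_map_def by blast+
  have preimage: "openin ?E (R \<inter> \<phi> -` V)"
    if "continuous_map (top_of_set R) ?X \<phi>" "openin ?E R" "openin ?X V" for R V
  proof -
    have "openin (top_of_set R) {y \<in> topspace (top_of_set R). \<phi> y \<in> V}"
      using that(1,3) by (rule openin_continuous_map_preimage)
    moreover have "{y \<in> topspace (top_of_set R). \<phi> y \<in> V} = R \<inter> \<phi> -` V"
      by auto
    ultimately have "openin (top_of_set R) (R \<inter> \<phi> -` V)"
      by simp
    then show ?thesis
      using that(2) by (rule openin_trans)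
  qed
  have contPQ: "continuous_map (top_of_set (P \<union> Q)) ?X \<phi>"
    unfolding continuous_map_def
  proof (intro conjI allI impI)
    show "\<phi> \<in> topspace (top_of_set (P \<union> Q)) \<rightarrow> topspace ?X"
      using continuous_map_image_subset_topspace[OF cont(1)]
        continuous_map_image_subset_topspace[OF cont(2)] by auto
    fix V assume V: "openin ?X V"
    have "{x \<in> topspace (top_of_set (P \<union> Q)). \<phi> x \<in> V} = (P \<inter> \<phi> -` V) \<union> (Q \<inter> \<phi> -` V)"
      by auto
    moreover have "openin ?E ((P \<inter> \<phi> -` V) \<union> (Q \<inter> \<phi> -` V))"
      using preimage[OF cont(1) openP V] preimage[OF cont(2) openQ V] by (rule openin_Un)
    then have "openin (top_of_set (P \<union> Q)) ((P \<inter> \<phi> -` V) \<union> (Q \<inter> \<phi> -` V))"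
      by (rule openin_subset_trans) (use PQE in auto)
    ultimately show "openin (top_of_set (P \<union> Q)) {x \<in> topspace (top_of_set (P \<union> Q)). \<phi> x \<in> V}"
      by simp
  qed
  have open_map: "open_map (top_of_set P) ?X \<phi>" "open_map (top_of_set Q) ?X \<phi>"
    using P Q unfolding handle_end_map_def by simp_all
  have opens: "openin ?X (\<phi> ` S)"
    if "open_map (top_of_set R) ?X \<phi>" "openin ?E R" "openin ?E S" "S \<subseteq> R" for R S
  proof -
    have "openin (top_of_set R) S"
      using that(3,4) openin_imp_subset[OF that(2)] by (rule openin_subset_trans)
    with that(1) show ?thesis
      by (simp add: open_map_def)
  qed
  have open_mapPQ: "open_map (top_of_set (P \<union> Q)) ?X \<phi>"
    unfolding open_map_def
  proof (intro allI impI)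
    fix R assume R: "openin (top_of_set (P \<union> Q)) R"
    then have RE: "openin ?E R"
      using openin_Un[OF openP openQ] by (rule openin_trans)
    have "openin ?X (\<phi> ` (R \<inter> P))" "openin ?X (\<phi> ` (R \<inter> Q))"
      using opens[OF open_map(1) openP openin_Int[OF RE openP] Int_lower2]
        opens[OF open_map(2) openQ openin_Int[OF RE openQ] Int_lower2] .
    then have "openin ?X (\<phi> ` (R \<inter> P) \<union> \<phi> ` (R \<inter> Q))"
      by (rule openin_Un)
    moreover have "\<phi> ` (R \<inter> P) \<union> \<phi> ` (R \<inter> Q) = \<phi> ` R"
      using openin_imp_subset[OF R] by blast
    ultimately show "openin ?X (\<phi> ` R)"
      by simp
  qed
  have sep: "\<exists>\<epsilon> S. 0 < \<epsilon> \<and> openin ?X S \<and> x \<in> S \<and> (\<forall>p\<in>P \<union> Q. \<bar>fst p\<bar> < \<epsilon> \<longrightarrow> \<phi> p \<notin> S)"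
    if x: "x \<in> topspace ?X" for x
  proof -
    have sepP: "\<forall>x\<in>topspace ?X. \<exists>\<epsilon> S. 0 < \<epsilon> \<and> openin ?X S \<and> x \<in> S \<and> (\<forall>p\<in>P. \<bar>fst p\<bar> < \<epsilon> \<longrightarrow> \<phi> p \<notin> S)"
      and sepQ: "\<forall>x\<in>topspace ?X. \<exists>\<epsilon> S. 0 < \<epsilon> \<and> openin ?X S \<and> x \<in> S \<and> (\<forall>p\<in>Q. \<bar>fst p\<bar> < \<epsilon> \<longrightarrow> \<phi> p \<notin> S)"
      using P Q unfolding handle_end_map_def by simp_all
    obtain \<epsilon> S where S: "0 < \<epsilon>" "openin ?X S" "x \<in> S" "\<forall>p\<in>P. \<bar>fst p\<bar> < \<epsilon> \<longrightarrow> \<phi> p \<notin> S"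
      using bspec[OF sepP x] by (elim exE conjE)
    obtain \<delta> T where T: "0 < \<delta>" "openin ?X T" "x \<in> T" "\<forall>p\<in>Q. \<bar>fst p\<bar> < \<delta> \<longrightarrow> \<phi> p \<notin> T"
      using bspec[OF sepQ x] by (elim exE conjE)
    show ?thesis
      \<comment> \<open>The smaller slab and the common neighbourhood avoid both ends at
        once.\<close>
      using S T by (intro exI[of _ "min \<epsilon> \<delta>"] exI[of _ "S \<inter> T"]) (auto intro: openin_Int)
  qed
  have dep: "cat_related C ((P \<union> Q) \<inter> \<phi> -` V) (handle_coord k) (d \<circ> \<phi>)" if Vd: "(V, d) \<in> matlas M" for V d
  proof -
    let ?W = "(P \<union> Q) \<inter> \<phi> -` V"
    note d = cat_manifold_chart[OF M Vd]
    have depPQ: "cat_related C (R \<inter> \<phi> -` V) (handle_coord k) (d \<circ> \<phi>)" if "R = P \<or> R = Q" for R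
    proof -
      have "handle_end_map C k M R \<phi>"
        using that P Q by auto
      then have "\<forall>(V, d)\<in>matlas M. cat_related C (R \<inter> \<phi> -` V) (handle_coord k) (d \<circ> \<phi>)"
        unfolding handle_end_map_def by (elim conjE)
      from bspec[OF this Vd] show ?thesis
        by simp
    qed
    have loc: "\<exists>W'. p \<in> W' \<and> W' \<subseteq> ?W \<and> openin ?E W' \<and> openin ?X (\<phi> ` W') \<and>
        cat_related C W' (handle_coord k) (d \<circ> \<phi>)"
      if p: "p \<in> ?W" for p
    proof -
      obtain R where R: "R = P \<or> R = Q" "p \<in> R"
        using p by blast
      have R': "continuous_map (top_of_set R) ?X \<phi>" "open_map (top_of_set R) ?X \<phi>" "openin ?E R"
        using R(1) cont open_map openP openQ by auto
      have W': "openin ?E (R \<inter> \<phi> -` V)"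
        by (rule preimage[OF R'(1,3) d(3)])
      moreover have "openin ?X (\<phi> ` (R \<inter> \<phi> -` V))"
        by (rule opens[OF R'(2,3) W' Int_lower1])
      moreover have "p \<in> R \<inter> \<phi> -` V" "R \<inter> \<phi> -` V \<subseteq> ?W"
        using R p by auto
      ultimately show ?thesis
        using depPQ[OF R(1)] by (intro exI[of _ "R \<inter> \<phi> -` V"] conjI) simp_all
    qed
    have WE: "?W \<subseteq> handle_carrier k"
      using PQE by blast
    have "cat_dependent C ?W (handle_coord k) (d \<circ> \<phi>)"
    proof (rule cat_dependent_coord_locally[OF coord_chart_handle WE])
      fix p assume "p \<in> ?W"
      from loc[OF this] obtain W' where "p \<in> W'" "W' \<subseteq> ?W" "openin ?E W'"
          "cat_dependent C W' (handle_coord k) (d \<circ> \<phi>)"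
        by (elim exE conjE)
      then show "\<exists>W'. p \<in> W' \<and> openin ?E W' \<and> W' \<subseteq> ?W \<and>
          cat_dependent C W' (handle_coord k) (d \<circ> \<phi>)"
        by (intro exI[of _ W'] conjI)
    qed
    moreover have "cat_dependent C ?W (d \<circ> \<phi>) (handle_coord k)"
    proof (rule cat_dependent_locally)
      \<comment> \<open>The local inverses over P and over Q fit together because the combined map
        is injective.\<close>
      have "inj_on \<phi> ?W"
        using inj by (rule inj_on_subset) simp
      then show "inj_on (d \<circ> \<phi>) ?W"
        by (rule comp_inj_on) (rule inj_on_subset[OF d(4)], auto)
      fix p assume "p \<in> ?W"
      from loc[OF this] obtain W' where W': "p \<in> W'" "W' \<subseteq> ?W" "openin ?X (\<phi> ` W')"
          "cat_dependent C W' (d \<circ> \<phi>) (handle_coord k)"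
        by (elim exE conjE)
      have "\<phi> ` W' \<subseteq> \<phi> ` ?W" "\<phi> ` ?W \<subseteq> V"
        using W'(2) by blast+
      from coord_chart_openin_image[OF d(2) W'(3) this]
      have "openin (top_of_set ((d \<circ> \<phi>) ` ?W)) ((d \<circ> \<phi>) ` W')"
        unfolding image_comp[symmetric] .
      with W' show "\<exists>W'. p \<in> W' \<and> W' \<subseteq> ?W \<and> openin (top_of_set ((d \<circ> \<phi>) ` ?W)) ((d \<circ> \<phi>) ` W') \<and>
          cat_dependent C W' (d \<circ> \<phi>) (handle_coord k)"
        by (intro exI[of _ W'] conjI)
    qed
    ultimately show ?thesis ..
  qed
  have "\<phi> ` (P \<union> Q) \<subseteq> mfd_interior M"
    using P Q unfolding handle_end_map_def image_Un by blast
  with openin_Un[OF openP openQ] inj contPQ open_mapPQ sep dep show ?thesis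
    unfolding handle_end_map_def by (intro conjI ballI) (simp_all only: split_paired_all case_prod_conv)
qed

lemma (in tube_end) handle_end_map: "handle_end_map C k M end_dom end_map"
  unfolding handle_end_map_def
proof (intro conjI ballI)
  fix x assume "x \<in> topspace (mspace M)"
  from end_map_separation[OF this] obtain \<epsilon> P where "\<epsilon> > 0" "openin (mspace M) P" "x \<in> P"
    "\<forall>t y. (t, y) \<in> end_dom \<longrightarrow> \<bar>t\<bar> < \<epsilon> \<longrightarrow> end_map (t, y) \<notin> P"
    by metis
  then show "\<exists>\<epsilon> Q. 0 < \<epsilon> \<and> openin (mspace M) Q \<and> x \<in> Q \<and>
      (\<forall>p\<in>end_dom. \<bar>fst p\<bar> < \<epsilon> \<longrightarrow> end_map p \<notin> Q)"
    by (intro exI[of _ \<epsilon>] exI[of _ P]) simp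
next
  show "case \<kappa> of (V, d) \<Rightarrow> cat_related C (end_dom \<inter> end_map -` V) (handle_coord k) (d \<circ> end_map)" if "\<kappa> \<in> matlas M" for \<kappa>
    using that cat_dependent_end_map by (cases \<kappa>) simp
qed (rule openin_end_dom inj_on_end_map continuous_map_end_map open_map_end_map end_map_interior)+

section \<open>From the two tubes to the gluing\<close>

lemma cat_iso_reflect:
  assumes "cat_iso C {0<..} T (\<rho> :: real \<Rightarrow> real)"
  shows "cat_iso C {..<0} T (\<lambda>t. \<rho> (- t))"
proof -
  note \<rho> = cat_isoE_inv_into[OF assms]
  have "linear (uminus :: real \<Rightarrow> real)"
    by (intro linearI) auto
  then have neg: "cat_map C S (\<lambda>t. - t + 0)" if "open S" for S :: "real set"
    using that by (rule cat_map_affine[rotated])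
  \<comment> \<open>\<open>cat_iso_iff_cat_dependent\<close> expects both domain and target as
    images of one parameter set; here the first coordinate is the identity.\<close>
  have dom: "(\<lambda>t. t) ` {..<0::real} = {..<0}"
    by simp
  have "(\<lambda>t. \<rho> (- t)) ` {..<0} = \<rho> ` uminus ` {..<0}"
    by (simp only: image_image)
  then have img: "(\<lambda>t. \<rho> (- t)) ` {..<0} = T"
    using \<rho>(2) by simp
  have "cat_dependent C {..<0} (\<lambda>t. t) (\<lambda>t. \<rho> (- t))"
  proof (rule cat_dependentI[of C "\<lambda>t. t" "{..<0}" "\<lambda>t. \<rho> (- t + 0)"])
    show "cat_map C ((\<lambda>t. t) ` {..<0}) (\<lambda>t. \<rho> (- t + 0))"
      unfolding dom by (rule cat_map_compose[OF neg \<rho>(3)]) auto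
  qed simp
  moreover have "cat_dependent C {..<0} (\<lambda>t. \<rho> (- t)) (\<lambda>t. t)"
  proof (rule cat_dependentI[of C "\<lambda>t. \<rho> (- t)" "{..<0}" "\<lambda>s. - inv_into {0<..} \<rho> s + 0"])
    show "cat_map C ((\<lambda>t. \<rho> (- t)) ` {..<0}) (\<lambda>s. - inv_into {0<..} \<rho> s + 0)"
      unfolding img by (rule cat_map_compose[OF \<rho>(4) neg[OF open_UNIV]]) simp
    show "- inv_into {0<..} \<rho> (\<rho> (- t)) + 0 = t" if "t \<in> {..<0}" for t
      using that inv_into_f_f[OF \<rho>(1), of "- t"] by simp
  qed
  ultimately show ?thesis
    using cat_iso_iff_cat_dependent[of "{..<0}" "\<lambda>t. \<rho> (- t)" "\<lambda>t. t" "\<lambda>t. \<rho> (- t)" C]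
    unfolding dom img by simp
qed

text \<open>Surjectivity provides \<open>\<epsilon>\<close> with \<open>\<rho> \<epsilon>\<close> =
  s, and smaller arguments have larger values.\<close>

lemma antimono_iso_diverges:
  assumes "cat_iso C {0<..} {0<..} (\<rho> :: real \<Rightarrow> real)" "strict_antimono_on {0<..} \<rho>" "s > 0"
  shows "\<exists>\<epsilon>>0. \<forall>t\<in>{0<..}. \<bar>t\<bar> < \<epsilon> \<longrightarrow> s \<le> \<rho> t"
proof -
  have "s \<in> \<rho> ` {0<..}"
    using cat_isoE_inv_into(2)[OF assms(1)] assms(3) by simp
  then obtain \<epsilon> where "\<epsilon> > 0" "s = \<rho> \<epsilon>"
    by auto
  moreover have "\<rho> \<epsilon> < \<rho> t" if "t > 0" "t < \<epsilon>" for t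
    using assms(2) that \<open>\<epsilon> > 0\<close> by (simp add: monotone_on_def)
  ultimately show ?thesis
    by (intro exI[of _ \<epsilon>]) (auto intro: less_imp_le)
qed

theorem lemma3p4:
  fixes C :: cat and k :: "'n::finite" and M :: "('p, 'n) mfd"
    and r r' :: "real \<Rightarrow> 'p" and \<nu> \<nu>' :: "'n handle_pt \<Rightarrow> 'p"
    and \<rho> :: "real \<Rightarrow> real" and \<Lambda> :: "real ^ 'n \<Rightarrow> real ^ 'n"
    and \<phi>p \<phi>n :: "'n handle_pt \<Rightarrow> 'p"
    and N :: "(('p + 'n handle_pt) set, 'n) mfd"
    and i\<^sub>M :: "'p \<Rightarrow> ('p + 'n handle_pt) set"
    and i\<^sub>E :: "'n handle_pt \<Rightarrow> ('p + 'n handle_pt) set"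
  defines "\<phi>p \<equiv> phi_pos C k \<rho> \<Lambda> \<nu>" and "\<phi>n \<equiv> phi_neg C k \<rho> \<Lambda> \<nu>'"
  defines "N \<equiv> attach_handle k M \<phi>p \<phi>n"
    and "i\<^sub>M \<equiv> incl_M k \<phi>p \<phi>n" and "i\<^sub>E \<equiv> incl_E k \<phi>p \<phi>n"
  assumes "cat_manifold C M"
    and "is_ray C k M r" and "is_ray C k M r'"
    and "r ` {0..} \<inter> r' ` {0..} = {}"
    and "is_tubular_nbhd_map C k M r \<nu>" and "is_tubular_nbhd_map C k M r' \<nu>'"
    and "\<nu> ` ({0..} \<times> disk C k) \<inter> \<nu>' ` ({0..} \<times> disk C k) = {}"
    and "cat_iso C {0<..} {0<..} \<rho>" and "strict_antimono_on {0<..} \<rho>"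
    and "cat_iso C (open_disk C k) (hyp k) \<Lambda>" and "radial_expansion C k \<Lambda>"
  shows "cat_manifold C N \<and>
    cat_open_embedding C M N i\<^sub>M \<and>
    cat_open_embedding C (handle_mfd k) N i\<^sub>E \<and>
    (\<forall>\<O>. is_orientation C M \<O> \<and> oriented_handle k \<O> \<phi>p \<phi>n \<longrightarrow>
       is_orientation C N (handle_atlas k M \<phi>p \<phi>n \<O>) \<and>
       orientation_preserving_map \<O> (handle_atlas k M \<phi>p \<phi>n \<O>) i\<^sub>M \<and>
       orientation_preserving_map (matlas (handle_mfd k)) (handle_atlas k M \<phi>p \<phi>n \<O>) i\<^sub>E)"
proof -
  interpret p: tube_end C k M r \<nu> "{0<..}" \<rho> \<Lambda>
  proof
    show "\<exists>\<epsilon>>0. \<forall>t\<in>{0<..}. \<bar>t\<bar> < \<epsilon> \<longrightarrow> s \<le> \<rho> t" if "s > 0" for s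
      using antimono_iso_diverges[OF assms(13,14) that] .
  qed (use assms in simp_all)
  interpret n: tube_end C k M r' \<nu>' "{..<0}" "\<lambda>t. \<rho> (- t)" \<Lambda>
  proof
    show "cat_iso C {..<0} {0<..} (\<lambda>t. \<rho> (- t))"
      by (rule cat_iso_reflect) (rule assms(13))
    show "\<exists>\<epsilon>>0. \<forall>t\<in>{..<0}. \<bar>t\<bar> < \<epsilon> \<longrightarrow> s \<le> \<rho> (- t)" if s: "s > 0" for s
    proof -
      obtain \<epsilon> where "\<epsilon> > 0" "\<forall>t\<in>{0<..}. \<bar>t\<bar> < \<epsilon> \<longrightarrow> s \<le> \<rho> t"
        using antimono_iso_diverges[OF assms(13,14) s] by blast
      then show ?thesis
        by (intro exI[of _ \<epsilon>]) simp
    qed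
  qed (use assms in simp_all)
  have \<phi>p: "p.end_map = \<phi>p"
    by (simp add: p.end_map_def p.reparam_def \<phi>p_def phi_pos_def fun_eq_iff)
  have \<phi>n: "n.end_map = \<phi>n"
    by (simp add: n.end_map_def n.reparam_def \<phi>n_def phi_neg_def fun_eq_iff)
  let ?\<phi> = "handle_glue \<phi>p \<phi>n"
  have eq_p: "?\<phi> x = \<phi>p x" if "x \<in> handle_pos k" for x
    using that by (auto simp: handle_glue_def handle_pos_def)
  have eq_n: "?\<phi> x = \<phi>n x" if "x \<in> handle_neg k" for x
    using that by (auto simp: handle_glue_def handle_neg_def)
  \<comment> \<open>Both ends are restated for one and the same map, as
    \<open>handle_end_map_Un\<close> requires.\<close>
  have "handle_end_map C k M (handle_pos k) ?\<phi>"
    using p.handle_end_map eq_p unfolding \<phi>p handle_pos_def by (rule handle_end_map_cong)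
  moreover have "handle_end_map C k M (handle_neg k) ?\<phi>"
    using n.handle_end_map eq_n unfolding \<phi>n handle_neg_def by (rule handle_end_map_cong)
  moreover have "?\<phi> ` handle_pos k \<inter> ?\<phi> ` handle_neg k = {}"
  proof -
    have "?\<phi> ` handle_pos k = p.end_map ` p.end_dom" "?\<phi> ` handle_neg k = n.end_map ` n.end_dom"
      unfolding \<phi>p \<phi>n using eq_p eq_n by (simp_all add: handle_pos_def handle_neg_def)
    then show ?thesis
      using p.end_map_image_subset n.end_map_image_subset assms(12) by blast
  qed
  ultimately have glue: "handle_end_map C k M (handle_ends k) ?\<phi>"
    unfolding handle_ends_def by (rule handle_end_map_Un[OF assms(6)])
  interpret handle_gluing C k M \<phi>p \<phi>n
    by unfold_locales (use glue assms(6) in \<open>auto simp: handle_end_map_def\<close>)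
  show ?thesis
    unfolding N_def i\<^sub>M_def i\<^sub>E_def
    using cat_manifold_N cat_open_embedding_i cat_open_embedding_j orientation_N
      orientation_preserving_i orientation_preserving_j by blast
qed

end
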